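(* Let $X$ be the Brady complex of $B_4$. Then $X$ is of exponential mesoscopic rank at every vertex. More precisely, for every vertex $O$ of $X$ and every integer $k\ge 32$, the mesoscopic rank profile $\varphi_O$ of $X$ at $O$ satisfies $\varphi_O(r)\ge (3/2)^{2\mu_k-4}$ for all $r\in[k-1,k]$, where $\mu_k=\left\lceil k\left(\tfrac{2}{\sqrt3}-1\right)+\left(\tfrac{2}{\sqrt3}-3\right)\right\rceil$. In particular the group $B_4/\langle z\rangle$ is of exponential mesoscopic rank.
   Context: Let $B_4=\langle a,b,c,d,e,f\mid ba=ae=eb,\ de=ec=cd,\ bc=cf=fb,\ df=fa=ad,\ ca=ac,\ ef=fe\rangle$ and $x=bac$. There are exactly sixteen factorizations $x=a_1a_2a_3$ with $a_i\in\{a,\dots,f\}$ (the cyclic length-3 subwords of $bcadefbacdfe$ and $faecfaecfaec$). Brady's complex $V$ has one vertex and one Euclidean tetrahedron per factorization, with edges $v_{i-1}v_i$ labelled $a_i$ (length 1), $v_0v_2,v_1v_3$ labelled $a_1a_2,a_2a_3$ (length $\sqrt2$), $v_0v_3$ labelled $x$ (length $\sqrt3$), glued along equally labelled edges; $\pi_1(V)=B_4$, its universal cover $Y$ is CAT(0) and splits isometrically as $X\times\mathbb{R}$, the $\mathbb{R}$-factor being the direction of the central element $z=x^4$. The Brady complex $X$ is a 2-dimensional CAT(0) simplicial complex with Euclidean equilateral triangle faces, on which $B_4/\langle z\rangle$ acts properly with compact quotient. For a point $A$ of $X$, a flat is an isometric copy of $\mathbb{R}^2$ in $X$, and the mesoscopic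 rank profile $\varphi_A(r)$ is the number of distinct flat balls (balls isometric to Euclidean disks) of radius $r$ centered at $A$ not included in any flat of $X$; $X$ has exponential mesoscopic rank at $A$ if $\varphi_A$ converges exponentially fast to infinity. A group is of exponential mesoscopic rank if it acts properly, isometrically, cocompactly on a CAT(0) complex of exponential mesoscopic rank at some point. *)

theory Defs
  imports "HOL-Analysis.Analysis"
begin

section \<open>The group B4 via Brady's presentation (words modulo the group congruence)\<close>

datatype gen = Ga | Gb | Gc | Gd | Ge | Gf

type_synonym letter = "gen \<times> bool"   (* (s, True) = s, (s, False) = s^-1 *)
type_synonym word = "letter list"

definition pos :: "gen list \<Rightarrow> word" where
  "pos xs = map (\<lambda>s. (s, True)) xs"

definition B4_rels :: "(gen list \<times> gen list) set" where
  "B4_rels = {([Gb,Ga],[Ga,Ge]), ([Ga,Ge],[Ge,Gb]),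
              ([Gd,Ge],[Ge,Gc]), ([Ge,Gc],[Gc,Gd]),
              ([Gb,Gc],[Gc,Gf]), ([Gc,Gf],[Gf,Gb]),
              ([Gd,Gf],[Gf,Ga]), ([Gf,Ga],[Ga,Gd]),
              ([Gc,Ga],[Ga,Gc]), ([Ge,Gf],[Gf,Ge])}"

inductive beq :: "word \<Rightarrow> word \<Rightarrow> bool" where
  refl: "beq w w"
| sym: "beq u v \<Longrightarrow> beq v u"
| trans: "beq u v \<Longrightarrow> beq v w \<Longrightarrow> beq u w"
| cancel: "beq (u @ [(s, b), (s, \<not> b)] @ v) (u @ v)"
| rel: "(l, r) \<in> B4_rels \<Longrightarrow> beq (u @ pos l @ v) (u @ pos r @ v)"

definition xword :: word where "xword = pos [Gb, Ga, Gc]"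

definition xpow :: "nat \<Rightarrow> word" where "xpow n = concat (replicate n xword)"

text \<open>Vertices of X: left cosets g<x> in B4 (represented as sets of words).\<close>
definition coset_rel :: "word \<Rightarrow> word \<Rightarrow> bool" where
  "coset_rel u v \<longleftrightarrow> (\<exists>n. beq (u @ xpow n) v \<or> beq (v @ xpow n) u)"

definition Xvertex :: "word \<Rightarrow> word set" where
  "Xvertex u = {v. coset_rel u v}"

definition Xvertices :: "word set set" where
  "Xvertices = range Xvertex"

text \<open>The sixteen factorizations x = a1 a2 a3 (cyclic length-3 subwords).\<close>
definition brady_words :: "gen list list" where
  "brady_words = [[Gb,Gc,Ga,Gd,Ge,Gf,Gb,Ga,Gc,Gd,Gf,Ge],
                  [Gf,Ga,Ge,Gc,Gf,Ga,Ge,Gc,Gf,Ga,Ge,Gc]]"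

definition factorizations :: "(gen \<times> gen \<times> gen) set" where
  "factorizations = {(w ! i, w ! ((i+1) mod 12), w ! ((i+2) mod 12)) | w i.
                       w \<in> set brady_words \<and> i < 12}"

text \<open>Triangles of X: projections of Brady's tetrahedra g, g a1, g a1 a2, g x
  along the central direction (g and g x project to the same vertex).\<close>
definition Xtriangles :: "word set set set" where
  "Xtriangles = {{Xvertex g, Xvertex (g @ pos [a1]), Xvertex (g @ pos [a1, a2])} | g a1 a2 a3.
                   (a1, a2, a3) \<in> factorizations}"

type_synonym point = "word set \<Rightarrow> real"   (* barycentric coordinates *)

definition supp :: "point \<Rightarrow> word set set" where
  "supp p = {v. p v \<noteq> 0}"

definition Xpoints :: "point set" where
  "Xpoints = {p. \<exists>t\<in>Xtriangles. supp p \<subseteq> t \<and> (\<forall>v. 0 \<le> p v) \<and> (\<Sum>v\<in>t. p v) = 1}"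

definition same_cell :: "point \<Rightarrow> point \<Rightarrow> bool" where
  "same_cell p q \<longleftrightarrow> (\<exists>t\<in>Xtriangles. supp p \<subseteq> t \<and> supp q \<subseteq> t)"

text \<open>Euclidean distance inside a common equilateral triangle of side length 1,
  in barycentric coordinates.\<close>
definition local_dist :: "point \<Rightarrow> point \<Rightarrow> real" where
  "local_dist p q = sqrt ((1/2) * (\<Sum>v\<in>supp p \<union> supp q. (p v - q v)^2))"

definition Xdist :: "point \<Rightarrow> point \<Rightarrow> real" where
  "Xdist p q = Inf {(\<Sum>i<n. local_dist (c i) (c (Suc i))) | c n.
      c 0 = p \<and> c n = q \<and>
      (\<forall>i\<le>n. c i \<in> Xpoints) \<and> (\<forall>i<n. same_cell (c i) (c (Suc i)))}"

definition vertex_point :: "word set \<Rightarrow> point" where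
  "vertex_point w = (\<lambda>v. if v = w then 1 else 0)"

definition is_flat :: "point set \<Rightarrow> bool" where
  "is_flat F \<longleftrightarrow> (\<exists>f :: complex \<Rightarrow> point. (\<forall>u. f u \<in> Xpoints) \<and>
      (\<forall>u v. Xdist (f u) (f v) = dist u v) \<and> F = range f)"

definition flat_ball :: "point \<Rightarrow> real \<Rightarrow> point set \<Rightarrow> bool" where
  "flat_ball A r D \<longleftrightarrow> (\<exists>f :: complex \<Rightarrow> point. f 0 = A \<and>
      (\<forall>u\<in>cball 0 r. f u \<in> Xpoints) \<and>
      (\<forall>u\<in>cball 0 r. \<forall>v\<in>cball 0 r. Xdist (f u) (f v) = dist u v) \<and>
      D = f ` cball 0 r)"

definition mrp :: "point \<Rightarrow> real \<Rightarrow> ereal" where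
  "mrp A r = (let S = {D. flat_ball A r D \<and> \<not> (\<exists>F. is_flat F \<and> D \<subseteq> F)}
              in if finite S then ereal (real (card S)) else \<infinity>)"

definition mu :: "int \<Rightarrow> int" where
  "mu k = \<lceil>real_of_int k * (2 / sqrt 3 - 1) + (2 / sqrt 3 - 3)\<rceil>"

end

theory Submission
  imports Defs
begin

text \<open>Distances in the Brady complex are bounded below with the dual Garside structure of \<open>B\<^sub>4\<close> instead of
  comparison geometry. For a vertex \<open>p\<close> let \<open>d(v, p)\<close> be the least number of generators in a positive path from
  \<open>v\<close> to \<open>p\<close>; it is read off the left-weighted normal form. Since \<open>d(\<cdot>, p)\<close> changes by \<open>-1\<close> or \<open>2\<close> along a
  positive edge, it is affine on every triangle with a gradient of one of three directions at mutual angle 120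
  degrees. Hence \<open>\<alpha> F - \<beta> G\<close>, for two such functions \<open>F, G\<close> and \<open>\<alpha>, \<beta> \<ge> 0\<close>, is steepest where the two
  gradients differ, and three height functions that restrict to the three linear forms of a flat region
  make this region isometrically embedded.

  The discs lie in regions which are flat except for a wedge of 120 degrees removed at a vertex \<open>w\<close>; at \<open>w\<close>
  the four remaining triangles form a path in the link that starts at \<open>b\<close> and ends at \<open>d\<close>. No two triangles at
  \<open>w\<close>, one on the edge \<open>b\<close> and one on the edge \<open>d\<close>, share their third vertex, so the path does not close up to a
  hexagon. The disc is placed so that \<open>w\<close> is outside its interior while all four triangles meet it; a flat
  containing the disc would have to contain them and to continue across both edges. Below \<open>w\<close> the region is a
  pile of horizontal strips in blocks of three, and every block can be chosen in two ways.\<close>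


text \<open>\<open>Xdist\<close> is an infimum over all chains: an upper bound needs one path, but a
  lower bound needs functions that are Lipschitz on all of X. Vertex distances supply them because
  normal forms turn every \<open>d(v, p)\<close> into a computation with fourteen simple elements,
  whose local rules are checked by evaluation. Linearity on a region is then established from its
  far ends only: the bounds 1 and -2 per edge squeeze every value in between. One of the three
  gradient directions of a region points into the removed wedge. There the height functions of two
  targets, one on each side of the wedge, are combined by a maximum, which is again a height
  function because heights that agree at one vertex are congruent mod 3 everywhere. Blocks have
  three strips because the relation df = fa = ad restores the line label after three strips, while
  one strip of ac = ca and two strips of ba = ae = eb reach a twisted copy of it. Roughly 0.31 k
  free blocks fit into the disc, and each doubles the number of discs, which exceeds the required
  factor 3/2.\<close>

section \<open>The dual Garside structure\<close>

text \<open>\<open>psi\<close> and \<open>phi\<close> are conjugation by the Garside element: \<open>psi a = x\<inverse> a x\<close> and \<open>phi a = x a x\<inverse>\<close>.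
  \<open>cof a b = Some h\<close> says that \<open>h a b\<close> is one of the sixteen factorizations of \<open>x\<close>.\<close>

primrec psi :: "gen \<Rightarrow> gen" where
  "psi Ga = Gf" | "psi Gb = Gd" | "psi Gc = Ge" | "psi Gd = Gb" | "psi Ge = Ga" | "psi Gf = Gc"

primrec phi :: "gen \<Rightarrow> gen" where
  "phi Ga = Ge" | "phi Gb = Gd" | "phi Gc = Gf" | "phi Gd = Gb" | "phi Ge = Gc" | "phi Gf = Ga"

fun cof :: "gen \<Rightarrow> gen \<Rightarrow> gen option" where
  "cof Ga Gc = Some Gb" | "cof Ga Gd = Some Gc" | "cof Ga Ge = Some Gf"
| "cof Gb Ga = Some Gf" | "cof Gb Gc = Some Ge"
| "cof Gc Ga = Some Gb" | "cof Gc Gd = Some Ga" | "cof Gc Gf = Some Ge"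
| "cof Gd Ge = Some Ga" | "cof Gd Gf = Some Gc"
| "cof Ge Gb = Some Gf" | "cof Ge Gc = Some Ga" | "cof Ge Gf = Some Gd"
| "cof Gf Ga = Some Gc" | "cof Gf Gb = Some Ge" | "cof Gf Ge = Some Gd"
| "cof _ _ = None"

text \<open>The fourteen simple elements; \<open>Coatom h\<close> is \<open>h\<inverse> x\<close>, so that \<open>a b = Coatom (the (cof a b))\<close>.\<close>

datatype simple = Unit | Atom gen | Coatom gen | Whole

primrec len :: "simple \<Rightarrow> int" where
  "len Unit = 0" | "len (Atom a) = 1" | "len (Coatom h) = 2" | "len Whole = 3"

fun mul :: "simple \<Rightarrow> simple \<Rightarrow> simple option" where
  "mul Unit s = Some s"
| "mul s Unit = Some s"
| "mul (Atom a) (Atom b) = map_option Coatom (cof a b)"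
| "mul (Atom a) (Coatom h) = (if a = h then Some Whole else None)"
| "mul (Coatom h) (Atom a) = (if a = psi h then Some Whole else None)"
| "mul _ _ = None"

primrec tw :: "(gen \<Rightarrow> gen) \<Rightarrow> simple \<Rightarrow> simple" where
  "tw f Unit = Unit" | "tw f (Atom a) = Atom (f a)" | "tw f (Coatom h) = Coatom (f h)" | "tw f Whole = Whole"

definition gens :: "gen list" where "gens = [Ga, Gb, Gc, Gd, Ge, Gf]"

definition simples :: "simple list" where
  "simples = Unit # Whole # map Atom gens @ map Coatom gens"

text \<open>The atom that moves from \<open>Coatom h\<close> into \<open>Atom a\<close>: it is a
  prefix of h^-1 x and keeps a t simple. Two distinct coatoms share at most one atom as a prefix, so
  for distinct a and h the first hit is the only one.\<close>

definition meet :: "gen \<Rightarrow> gen \<Rightarrow> gen option" where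
  "meet a h = List.find (\<lambda>t. cof a t \<noteq> None \<and> cof h t \<noteq> None) gens"

text \<open>\<open>red u s = (p, r)\<close> with \<open>u s = p r\<close> and \<open>p\<close> the greatest simple prefix of \<open>u s\<close>.\<close>

fun red :: "simple \<Rightarrow> simple \<Rightarrow> simple \<times> simple" where
  "red Unit s = (s, Unit)"
| "red Whole s = (Whole, s)"
| "red s Unit = (s, Unit)"
| "red s Whole = (Whole, tw psi s)"
| "red (Atom a) (Atom b) = (case cof a b of None \<Rightarrow> (Atom a, Atom b) | Some h \<Rightarrow> (Coatom h, Unit))"
| "red (Atom a) (Coatom h) = (if a = h then (Whole, Unit) else
     (case meet a h of None \<Rightarrow> (Atom a, Coatom h)
        | Some t \<Rightarrow> (Coatom (the (cof a t)), Atom (psi (the (cof h t))))))"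
| "red (Coatom g) (Atom b) = (if b = psi g then (Whole, Unit) else (Coatom g, Atom b))"
| "red (Coatom g) (Coatom h) =
     (case cof h (psi g) of None \<Rightarrow> (Coatom g, Coatom h) | Some k \<Rightarrow> (Whole, Atom (psi k)))"

section \<open>Finite checks for products of simple elements\<close>

lemma in_gens: "a \<in> set gens"
  by (cases a) (auto simp: gens_def)

lemma in_simples: "s \<in> set simples"
  using in_gens by (cases s) (auto simp: simples_def)

lemma psi_phi [simp]: "psi (phi a) = a" and phi_psi [simp]: "phi (psi a) = a"
  by (cases a; simp)+

lemma tw_psi_phi [simp]: "tw psi (tw phi s) = s" and tw_phi_psi [simp]: "tw phi (tw psi s) = s"
  by (cases s; simp)+

lemma len_tw [simp]: "len (tw f s) = len s"
  by (cases s) auto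

lemma tw_eq_iff [simp]: "tw f s = Unit \<longleftrightarrow> s = Unit" "tw f s = Whole \<longleftrightarrow> s = Whole"
  by (cases s; simp)+

text \<open>One step of \<open>push_assoc\<close>: after u and v have passed the factor s, their
  remainders still multiply to a simple element, so the induction on the list can continue.\<close>

lemma red_assoc:
  assumes "mul u v = Some w"
  shows "fst (red u (fst (red v s))) = fst (red w s)"
    and "mul (snd (red u (fst (red v s)))) (snd (red v s)) = Some (snd (red w s))"
proof -
  have "list_all (\<lambda>u. list_all (\<lambda>v. case mul u v of None \<Rightarrow> True | Some w \<Rightarrow>
     list_all (\<lambda>s. fst (red u (fst (red v s))) = fst (red w s) \<and>
       mul (snd (red u (fst (red v s)))) (snd (red v s)) = Some (snd (red w s))) simples) simples) simples"
    by code_simp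
  then show "fst (red u (fst (red v s))) = fst (red w s)"
    and "mul (snd (red u (fst (red v s)))) (snd (red v s)) = Some (snd (red w s))"
    using assms in_simples unfolding list_all_iff by (fastforce split: option.splits)+
qed

text \<open>The domino rule of Garside theory: what leaves a left-weighted pair when u passes
  through it starts with a left-weighted pair again. If the first output is x, \<open>prep\<close>
  takes it off the list, so that case is set apart.\<close>

lemma red_domino:
  assumes "red s t = (s, t)" "s \<noteq> Unit" "s \<noteq> Whole" "t \<noteq> Unit" "t \<noteq> Whole"
    and "fst (red u s) \<noteq> Whole"
  shows "fst (red (snd (red u s)) t) \<noteq> Whole" (is ?A)
    and "red (fst (red u s)) (fst (red (snd (red u s)) t)) = (fst (red u s), fst (red (snd (red u s)) t))" (is ?B)
proof -
  let ?P = "\<lambda>s t u. fst (red u s) = Whole \<or> fst (red (snd (red u s)) t) \<noteq> Whole \<and>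
       red (fst (red u s)) (fst (red (snd (red u s)) t)) = (fst (red u s), fst (red (snd (red u s)) t))"
  have "list_all (\<lambda>s. list_all (\<lambda>t. s \<noteq> Unit \<and> t \<noteq> Unit \<and> s \<noteq> Whole \<and> t \<noteq> Whole \<and> red s t = (s, t) \<longrightarrow>
     list_all (?P s t) simples) simples) simples"
    by code_simp
  then have "list_all (?P s t) simples"
    using assms in_simples unfolding list_all_iff by blast
  then show ?A ?B
    using assms in_simples unfolding list_all_iff by blast+
qed

lemma red_facts:
  shows red_tw: "red (tw phi u) (tw phi s) = (tw phi (fst (red u s)), tw phi (snd (red u s)))" (is ?A)
    and red_len: "len (fst (red u s)) + len (snd (red u s)) = len u + len s" (is ?B)
    and red_ne_Unit: "s \<noteq> Unit \<Longrightarrow> fst (red u s) \<noteq> Unit"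
    and red_idem: "fst (red u s) \<noteq> Whole \<Longrightarrow> snd (red u s) \<noteq> Unit \<Longrightarrow> red (fst (red u s)) (snd (red u s)) = red u s"
    and red_snd_ne_Whole: "fst (red u s) \<noteq> Whole \<Longrightarrow> snd (red u s) \<noteq> Whole"
    and red_mul: "mul u s = Some w \<Longrightarrow> red u s = (w, Unit)"
    and red_Whole: "red u Whole = (Whole, tw psi u)" (is ?C)
proof -
  let ?P = "\<lambda>u s. red (tw phi u) (tw phi s) = (tw phi (fst (red u s)), tw phi (snd (red u s))) \<and>
     len (fst (red u s)) + len (snd (red u s)) = len u + len s \<and>
     (s \<noteq> Unit \<longrightarrow> fst (red u s) \<noteq> Unit) \<and>
     (fst (red u s) \<noteq> Whole \<longrightarrow> snd (red u s) \<noteq> Unit \<longrightarrow> red (fst (red u s)) (snd (red u s)) = red u s) \<and>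
     (fst (red u s) \<noteq> Whole \<longrightarrow> snd (red u s) \<noteq> Whole) \<and>
     (case mul u s of None \<Rightarrow> True | Some w \<Rightarrow> red u s = (w, Unit)) \<and>
     red u Whole = (Whole, tw psi u)"
  have "list_all (\<lambda>u. list_all (?P u) simples) simples"
    by code_simp
  then have *: "?P u s"
    using in_simples unfolding list_all_iff by blast
  show ?A ?B ?C
    "s \<noteq> Unit \<Longrightarrow> fst (red u s) \<noteq> Unit"
    "fst (red u s) \<noteq> Whole \<Longrightarrow> snd (red u s) \<noteq> Unit \<Longrightarrow> red (fst (red u s)) (snd (red u s)) = red u s"
    "fst (red u s) \<noteq> Whole \<Longrightarrow> snd (red u s) \<noteq> Whole"
    "mul u s = Some w \<Longrightarrow> red u s = (w, Unit)"
    using * by auto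
qed

section \<open>Normal forms of left cosets\<close>

text \<open>Lists of simple elements stand for left cosets of \<open>\<langle>x\<rangle>\<close>: a leading \<open>x\<close> is moved to the right
  end, where it disappears. \<open>push u\<close> is left multiplication by \<open>u\<close>.\<close>

fun prep :: "simple \<Rightarrow> simple list \<Rightarrow> simple list" where
  "prep Unit L = L" | "prep Whole L = map (tw phi) L" | "prep s L = s # L"

fun push :: "simple \<Rightarrow> simple list \<Rightarrow> simple list" where
  "push u [] = prep u []"
| "push u (s # L) = prep (fst (red u s)) (push (snd (red u s)) L)"

abbreviation lweighted :: "simple \<Rightarrow> simple \<Rightarrow> bool" where
  "lweighted s t \<equiv> red s t = (s, t)"

definition proper :: "simple list \<Rightarrow> bool" where
  "proper L \<longleftrightarrow> (\<forall>s\<in>set L. s \<noteq> Unit \<and> s \<noteq> Whole)"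

definition normal :: "simple list \<Rightarrow> bool" where
  "normal L \<longleftrightarrow> proper L \<and> successively lweighted L"

definition length_of :: "simple list \<Rightarrow> int" where
  "length_of L = sum_list (map len L)"

lemma length_of_simps [simp]:
  "length_of [] = 0" "length_of (s # L) = len s + length_of L" "length_of (map (tw f) L) = length_of L"
  by (simp_all add: length_of_def o_def)

lemma proper_simps [simp]: "proper []" "proper (s # L) \<longleftrightarrow> s \<noteq> Unit \<and> s \<noteq> Whole \<and> proper L"
  "proper (map (tw f) L) \<longleftrightarrow> proper L"
  by (auto simp: proper_def)

lemma prep_proper: "s \<noteq> Unit \<Longrightarrow> s \<noteq> Whole \<Longrightarrow> prep s L = s # L"
  by (cases s) auto

lemma prep_tw: "prep (tw phi s) (map (tw phi) L) = map (tw phi) (prep s L)"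
  by (cases s) auto

lemma push_tw: "push (tw phi u) (map (tw phi) L) = map (tw phi) (push u L)"
  by (induction L arbitrary: u) (auto simp: red_tw prep_tw prep_tw[of _ "[]", simplified])

text \<open>For \<open>p = Whole\<close> the factor x has already left the list and twisted it, so u
  crosses it as \<open>tw psi u\<close>; \<open>push_tw\<close> accounts for the twist.\<close>

lemma push_prep:
  assumes "p \<noteq> Unit"
  shows "push u (prep p L) = prep (fst (red u p)) (push (snd (red u p)) L)"
proof (cases "p = Whole")
  case True
  have "push u (map (tw phi) L) = map (tw phi) (push (tw psi u) L)"
    using push_tw[of "tw psi u" L] by simp
  then show ?thesis using True by (simp add: red_Whole)
qed (use assms in \<open>auto simp: prep_proper\<close>)

lemma push_Unit: "proper L \<Longrightarrow> push Unit L = L"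
  by (induction L) (auto simp: prep_proper)

lemma push_assoc:
  assumes "mul u v = Some w" "proper L"
  shows "push u (push v L) = push w L"
  using assms
proof (induction L arbitrary: u v w)
  case Nil
  show ?case
  proof (cases "v = Unit")
    case True
    then show ?thesis using Nil by (cases u) auto
  next
    case False
    then show ?thesis using Nil by (simp add: push_prep red_mul)
  qed
next
  case (Cons s L)
  have "push u (push v (s # L)) =
      prep (fst (red u (fst (red v s)))) (push (snd (red u (fst (red v s)))) (push (snd (red v s)) L))"
    using Cons.prems by (simp add: push_prep red_ne_Unit)
  also have "\<dots> = prep (fst (red w s)) (push (snd (red w s)) L)"
    using Cons.IH[OF red_assoc(2)[OF Cons.prems(1)]] Cons.prems red_assoc(1)[OF Cons.prems(1)] by simp
  finally show ?case by simp
qed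

lemma normal_Nil [simp]: "normal []"
  by (simp add: normal_def)

lemma normal_Cons:
  "normal (s # L) \<longleftrightarrow> s \<noteq> Unit \<and> s \<noteq> Whole \<and> normal L \<and> (L = [] \<or> lweighted s (hd L))"
  by (cases L) (auto simp: normal_def)

lemma normal_proper: "normal L \<Longrightarrow> proper L"
  by (simp add: normal_def)

lemma lweighted_tw_phi: "lweighted (tw phi s) (tw phi t) \<longleftrightarrow> lweighted s t"
proof -
  have "tw phi s = tw phi t \<longleftrightarrow> s = t" for s t
    by (metis tw_psi_phi)
  then show ?thesis by (simp add: red_tw prod_eq_iff)
qed

lemma normal_map_phi [simp]: "normal (map (tw phi) L) \<longleftrightarrow> normal L"
proof (induction L)
  case (Cons s L)
  then show ?case by (cases L) (auto simp: normal_Cons lweighted_tw_phi)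
qed simp

lemma normal_map_psi [simp]: "normal (map (tw psi) L) \<longleftrightarrow> normal L"
  using normal_map_phi[of "map (tw psi) L"] by (simp add: o_def)

lemma normal_push: "normal L \<Longrightarrow> normal (push u L)"
proof (induction L arbitrary: u)
  case Nil
  show ?case by (cases u) (auto simp: normal_Cons)
next
  case (Cons s L)
  define p r where "p = fst (red u s)" and "r = snd (red u s)"
  have s: "s \<noteq> Unit" "s \<noteq> Whole" "normal L" using Cons.prems by (auto simp: normal_Cons)
  have nL: "normal (push r L)" using Cons.IH s by simp
  have pU: "p \<noteq> Unit" using s by (simp add: p_def red_ne_Unit)
  have "normal (prep p (push r L))"
  proof (cases "p = Whole")
    case True
    then show ?thesis using nL by simp
  next
    case False
    have "push r L = [] \<or> lweighted p (hd (push r L))"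
    proof (cases L)
      case Nil
      have "r \<noteq> Whole" using False red_snd_ne_Whole by (simp add: p_def r_def)
      then show ?thesis using Nil red_idem[of u s] False
        by (cases "r = Unit") (auto simp: prep_proper p_def r_def)
    next
      case (Cons t L2)
      have t: "t \<noteq> Unit" "t \<noteq> Whole" "lweighted s t"
        using Cons Cons.prems by (auto simp: normal_Cons)
      have "fst (red r t) \<noteq> Unit" "fst (red r t) \<noteq> Whole" "lweighted p (fst (red r t))"
        using red_ne_Unit t(1) red_domino[OF t(3) s(1,2) t(1,2)] False by (auto simp: p_def r_def)
      then show ?thesis using Cons by (simp add: prep_proper)
    qed
    then show ?thesis using False pU nL by (simp add: prep_proper normal_Cons)
  qed
  then show ?case by (simp add: p_def r_def)
qed

lemma push_normal: "normal (s # L) \<Longrightarrow> push s L = s # L"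
proof (induction L arbitrary: s)
  case Nil
  then show ?case by (simp add: normal_Cons prep_proper)
next
  case (Cons t L)
  then have "push t L = t # L" "lweighted s t" "s \<noteq> Unit" "s \<noteq> Whole" by (auto simp: normal_Cons)
  then show ?case by (simp add: prep_proper)
qed

lemma push_Whole: "normal L \<Longrightarrow> push Whole L = map (tw phi) L"
  by (cases L) (auto simp: push_normal)

text \<open>The remainder behind the first factor is trivial, the untouched factor s, or a single
  atom that travels on. A factor x can thus arise only once, at the end of the journey, and its
  disappearance turns the gain of 1 into a loss of 2.\<close>

lemma length_push_Atom:
  assumes "normal L"
  shows "length_of (push (Atom a) L) \<in> {length_of L + 1, length_of L - 2}"
  using assms
proof (induction L arbitrary: a)
  case Nil
  then show ?case by simp
next
  case (Cons s L)
  define p r where "p = fst (red (Atom a) s)" and "r = snd (red (Atom a) s)"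
  have nL: "normal L" and s: "s \<noteq> Unit" "s \<noteq> Whole" using Cons.prems by (auto simp: normal_Cons)
  have len: "len p + len r = 1 + len s" using red_len[of "Atom a" s] by (simp add: p_def r_def)
  have push: "push (Atom a) (s # L) = prep p (push r L)" by (simp add: p_def r_def)
  have "p = Whole \<and> r = Unit \<or> p \<noteq> Unit \<and> p \<noteq> Whole \<and> (r = Unit \<or> r = s \<or> (\<exists>b. r = Atom b))"
    using s by (cases s) (auto simp: p_def r_def split: option.splits)
  then consider "p = Whole" "r = Unit" | "p \<noteq> Unit" "p \<noteq> Whole" "r = Unit"
    | "p \<noteq> Unit" "p \<noteq> Whole" "r = s" | b where "p \<noteq> Unit" "p \<noteq> Whole" "r = Atom b" by blast
  then show ?case
  proof cases
    case 1
    then show ?thesis using push len nL by (simp add: push_Unit normal_proper)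
  next
    case 2
    then show ?thesis using push len nL by (simp add: push_Unit normal_proper prep_proper)
  next
    case 3
    then show ?thesis using push len Cons.prems by (simp add: push_normal prep_proper)
  next
    case 4
    then show ?thesis using push len Cons.IH[OF nL, of b] by (auto simp: prep_proper)
  qed
qed

subsection \<open>The action of words on normal forms\<close>

text \<open>An inverse letter acts as s^-1 = x^-1 (x s^-1), where x s^-1 is
  \<open>Coatom (phi s)\<close>; moving x^-1 to the right end twists the list by
  \<open>psi\<close>.\<close>

primrec lact :: "letter \<Rightarrow> simple list \<Rightarrow> simple list" where
  "lact (s, b) L = (if b then push (Atom s) L else map (tw psi) (push (Coatom (phi s)) L))"

declare lact.simps [simp del]

abbreviation wact :: "word \<Rightarrow> simple list \<Rightarrow> simple list" where
  "wact w L \<equiv> foldr lact w L"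

lemma lact_True: "lact (s, True) L = push (Atom s) L"
  by (simp add: lact.simps)

lemma lact_False: "lact (s, False) L = map (tw psi) (push (Coatom (phi s)) L)"
  by (simp add: lact.simps)

lemma normal_lact: "normal L \<Longrightarrow> normal (lact l L)"
  by (cases l) (simp add: lact.simps normal_push)

lemma normal_wact: "normal L \<Longrightarrow> normal (wact w L)"
  by (induction w) (auto simp: normal_lact)

lemma push_Atom_psi: "push (Atom s) (map (tw psi) L) = map (tw psi) (push (Atom (phi s)) L)"
proof -
  have "map (tw phi) (push (Atom s) (map (tw psi) L)) = push (Atom (phi s)) L"
    using push_tw[of "Atom s" "map (tw psi) L"] by (simp add: o_def)
  then have "map (tw psi) (map (tw phi) (push (Atom s) (map (tw psi) L))) = map (tw psi) (push (Atom (phi s)) L)"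
    by simp
  then show ?thesis by (simp add: o_def)
qed

lemma lact_cancel:
  assumes "normal L"
  shows "lact (s, b) (lact (s, \<not> b) L) = L"
proof (cases b)
  case True
  have "lact (s, b) (lact (s, \<not> b) L) = map (tw psi) (push (Atom (phi s)) (push (Coatom (phi s)) L))"
    using True by (simp add: lact_True lact_False push_Atom_psi)
  also have "\<dots> = L"
    using assms by (simp add: push_assoc[of _ _ Whole] normal_proper push_Whole o_def)
  finally show ?thesis .
next
  case False
  have "lact (s, b) (lact (s, \<not> b) L) = map (tw psi) (push (Coatom (phi s)) (push (Atom s) L))"
    using False by (simp add: lact_True lact_False)
  also have "\<dots> = L"
    using assms by (simp add: push_assoc[of _ _ Whole] normal_proper push_Whole o_def)
  finally show ?thesis .
qed

lemma wact_pos2: "cof a b = Some h \<Longrightarrow> normal L \<Longrightarrow> wact (pos [a, b]) L = push (Coatom h) L"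
  by (simp add: pos_def lact_True push_assoc[of _ _ "Coatom h"] normal_proper)

lemma beq_wact: "beq u v \<Longrightarrow> normal L \<Longrightarrow> wact u L = wact v L"
proof (induction arbitrary: L rule: beq.induct)
  case (cancel u s b v)
  then show ?case by (simp add: lact_cancel normal_wact)
next
  case (rel l r u v)
  have "wact (pos l) M = wact (pos r) M" if "normal M" for M
    using rel(1) that unfolding B4_rels_def by (auto simp: wact_pos2)
  then show ?case using rel(2) by (simp add: normal_wact)
qed auto

lemma wact_xword: "normal L \<Longrightarrow> wact xword L = map (tw phi) L"
proof -
  assume n: "normal L"
  have "wact xword L = push (Atom Gb) (wact (pos [Ga, Gc]) L)"
    by (simp add: xword_def pos_def lact_True)
  also have "\<dots> = push Whole L"
    using n by (simp add: wact_pos2 push_assoc[of _ _ Whole] normal_proper)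
  finally show ?thesis using n by (simp add: push_Whole)
qed

lemma wact_xpow:
  assumes "normal L"
  shows "\<exists>f. wact (xpow n) L = map (tw f) L"
proof (induction n)
  case 0
  have "map (tw id) L = L" by (rule map_idI) (metis id_apply simple.exhaust tw.simps)
  then show ?case by (metis concat.simps(1) foldr_Nil id_apply replicate_0 xpow_def)
next
  case (Suc n)
  then obtain f where f: "wact (xpow n) L = map (tw f) L" by blast
  have "wact (xpow (Suc n)) L = map (tw phi) (map (tw f) L)"
    using wact_xword[OF normal_wact[OF assms, of "xpow n"]] f by (simp add: xpow_def)
  moreover have "tw phi (tw f s) = tw (phi \<circ> f) s" for s by (cases s) auto
  ultimately show ?case by auto
qed

definition winv :: "word \<Rightarrow> word" where
  "winv w = rev (map (\<lambda>(s, b). (s, \<not> b)) w)"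

lemma winv_simps [simp]: "winv [] = []" "winv ((s, b) # w) = winv w @ [(s, \<not> b)]"
  "winv (u @ v) = winv v @ winv u"
  by (auto simp: winv_def)

lemma winv_winv [simp]: "winv (winv w) = w"
  by (induction w) auto

lemma wact_winv: "normal L \<Longrightarrow> wact (winv w) (wact w L) = L"
proof (induction w)
  case (Cons l w)
  obtain s b where l: "l = (s, b)" by force
  have "lact (s, \<not> b) (lact (s, b) (wact w L)) = wact w L"
    using lact_cancel[of "wact w L" s "\<not> b"] Cons by (simp add: normal_wact)
  then show ?case using Cons l by simp
qed simp

lemma wact_winv': "normal L \<Longrightarrow> wact w (wact (winv w) L) = L"
  using wact_winv[of L "winv w"] by simp

subsection \<open>Directed distance functions on vertices\<close>

lemma coset_rel_refl: "coset_rel u u"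
  unfolding coset_rel_def by (rule exI[of _ 0]) (simp add: xpow_def beq.refl)

lemma Xvertex_eqD: "Xvertex u = Xvertex v \<Longrightarrow> coset_rel u v"
  using coset_rel_refl[of v] unfolding Xvertex_def by auto

text \<open>Representatives of one coset differ by a power of x, which acts on a normal form by
  relabelling letters and so preserves its length.\<close>

lemma coset_rel_wact_winv:
  assumes "coset_rel u v" "normal M"
  shows "length_of (wact (winv u) M) = length_of (wact (winv v) M)"
proof -
  have *: "length_of (wact (winv u) M) = length_of (wact (winv v) M)" if "beq (u @ xpow n) v" for u v n
  proof -
    define K where "K = wact (winv v) M"
    have nK: "normal K" using assms(2) by (simp add: K_def normal_wact)
    have "M = wact v K" using assms(2) by (simp add: K_def wact_winv')
    also have "\<dots> = wact u (wact (xpow n) K)" using beq_wact[OF that nK] by simp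
    finally have "wact (winv u) M = wact (xpow n) K" using wact_winv normal_wact nK by simp
    then show ?thesis using wact_xpow[OF nK, of n] by (auto simp: K_def)
  qed
  from assms(1) show ?thesis unfolding coset_rel_def using *[of u _ v] *[of v _ u] by auto
qed

lemma coset_rel_nf: 
  assumes "coset_rel u v"
  shows "wact w (wact u []) = wact w (wact v [])"
proof -
  have "wact (xpow n) [] = []" for n using wact_xpow[OF normal_Nil, of n] by auto
  then show ?thesis using assms unfolding coset_rel_def
    by (metis beq_wact foldr_append normal_Nil comp_apply)
qed

definition pdist :: "word \<Rightarrow> word \<Rightarrow> int" where
  "pdist u p = length_of (wact (winv u) (wact p []))"

definition vdist :: "word \<Rightarrow> word set \<Rightarrow> int" where
  "vdist p v = pdist (SOME u. u \<in> v) p"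

lemma vdist_Xvertex: "vdist p (Xvertex u) = pdist u p"
proof -
  have "(SOME u'. u' \<in> Xvertex u) \<in> Xvertex u"
    by (rule someI[of _ u]) (simp add: Xvertex_def coset_rel_refl)
  then have "coset_rel u (SOME u'. u' \<in> Xvertex u)" by (simp add: Xvertex_def)
  then show ?thesis
    by (simp add: vdist_def pdist_def coset_rel_wact_winv normal_wact)
qed

text \<open>This is \<open>length_push_Atom\<close> read backwards: the normal form seen from u is
  the letter a times the one seen from u a.\<close>

lemma pdist_step: "pdist (u @ pos [a]) p \<in> {pdist u p - 1, pdist u p + 2}"
proof -
  define L where "L = wact (winv u) (wact p [])"
  have n: "normal L" by (simp add: L_def normal_wact)
  have "length_of (lact (a, True) (lact (a, False) L)) \<in>
      {length_of (lact (a, False) L) + 1, length_of (lact (a, False) L) - 2}"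
    using length_push_Atom[OF normal_lact[OF n]] by (simp add: lact_True)
  then have "length_of L \<in> {length_of (lact (a, False) L) + 1, length_of (lact (a, False) L) - 2}"
    using lact_cancel[OF n, of a True] by simp
  then show ?thesis by (auto simp: pdist_def pos_def L_def)
qed

section \<open>Vertices and triangles\<close>

declare beq.trans [trans]

lemma beq_append: "beq u v \<Longrightarrow> beq (p @ u @ q) (p @ v @ q)"
proof (induction rule: beq.induct)
  case (cancel u s b v)
  show ?case using beq.cancel[of "p @ u" s b "v @ q"] by simp
next
  case (rel l r u v)
  show ?case using beq.rel[OF rel, of "p @ u" "v @ q"] by simp
qed (auto intro: beq.intros)

lemma beq_left: "beq u v \<Longrightarrow> beq (p @ u) (p @ v)"
  using beq_append[of u v p "[]"] by simp

lemma beq_right: "beq u v \<Longrightarrow> beq (u @ q) (v @ q)"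
  using beq_append[of u v "[]" q] by simp

lemma beq_winv: "beq (w @ winv w) []"
proof (induction w rule: rev_induct)
  case (snoc l w)
  obtain s b where l: "l = (s, b)" by force
  show ?case using beq.cancel[of w s b "winv w"] snoc beq.trans l by auto
qed (simp add: beq.refl)

lemma beq_winv': "beq (winv w @ w) []"
  using beq_winv[of "winv w"] by simp

lemma beq_cancel_right:
  assumes "beq (u @ z) (v @ z)"
  shows "beq u v"
proof -
  have "beq u (u @ z @ winv z)" using beq_left[OF beq_winv, of u z] by (auto intro: beq.sym)
  moreover have "beq (u @ z @ winv z) (v @ z @ winv z)" using beq_right[OF assms, of "winv z"] by simp
  moreover have "beq (v @ z @ winv z) v" using beq_left[OF beq_winv, of v z] by simp
  ultimately show ?thesis by (meson beq.trans)
qed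

lemma xpow_add: "xpow (m + n) = xpow m @ xpow n"
  by (simp add: xpow_def replicate_add)

lemma xpow_0 [simp]: "xpow 0 = []" and xpow_Suc: "xpow (Suc n) = xword @ xpow n"
  by (simp_all add: xpow_def)

lemma coset_rel_sym: "coset_rel u v \<Longrightarrow> coset_rel v u"
  by (auto simp: coset_rel_def)

lemma coset_rel_common_right:
  assumes "beq (u @ xpow m) (v @ xpow n)"
  shows "coset_rel u v"
proof (cases "m \<le> n")
  case True
  then have "xpow n = xpow (n - m) @ xpow m" using xpow_add[of "n - m" m] by simp
  then have "beq u (v @ xpow (n - m))" using assms beq_cancel_right[of u "xpow m" "v @ xpow (n - m)"] by simp
  then show ?thesis unfolding coset_rel_def by (auto intro: beq.sym)
next
  case False
  then have "xpow m = xpow (m - n) @ xpow n" using xpow_add[of "m - n" n] by simp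
  then have "beq (u @ xpow (m - n)) v" using assms beq_cancel_right[of "u @ xpow (m - n)" "xpow n" v] by simp
  then show ?thesis unfolding coset_rel_def by auto
qed

lemma coset_rel_iff: "coset_rel u v \<longleftrightarrow> (\<exists>m n. beq (u @ xpow m) (v @ xpow n))"
proof
  assume "coset_rel u v"
  then obtain n where "beq (u @ xpow n) v \<or> beq (v @ xpow n) u" by (auto simp: coset_rel_def)
  then have "beq (u @ xpow n) (v @ xpow 0) \<or> beq (u @ xpow 0) (v @ xpow n)" by (auto intro: beq.sym)
  then show "\<exists>m n. beq (u @ xpow m) (v @ xpow n)" by blast
qed (auto intro: coset_rel_common_right)

lemma coset_rel_trans:
  assumes "coset_rel u v" "coset_rel v w"
  shows "coset_rel u w"
proof -
  obtain m n where 1: "beq (u @ xpow m) (v @ xpow n)" using assms(1) coset_rel_iff by blast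
  obtain k l where 2: "beq (v @ xpow k) (w @ xpow l)" using assms(2) coset_rel_iff by blast
  have "beq (u @ xpow (m + k)) (v @ xpow (n + k))" using beq_right[OF 1, of "xpow k"] by (simp add: xpow_add)
  moreover have "beq (v @ xpow (k + n)) (w @ xpow (l + n))" using beq_right[OF 2, of "xpow n"] by (simp add: xpow_add)
  ultimately show ?thesis using coset_rel_iff beq.trans by (metis add.commute)
qed

lemma Xvertex_eq_iff: "Xvertex u = Xvertex v \<longleftrightarrow> coset_rel u v"
  using Xvertex_eqD coset_rel_sym coset_rel_trans unfolding Xvertex_def by blast

lemma beq_Xvertex: "beq u v \<Longrightarrow> Xvertex u = Xvertex v"
  unfolding Xvertex_eq_iff coset_rel_iff by (metis append_Nil2 xpow_0)

lemma Xvertex_xpow: "Xvertex (u @ xpow n) = Xvertex u"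
  unfolding Xvertex_eq_iff coset_rel_iff by (metis append_Nil2 xpow_0 beq.refl)

lemma pos_append [simp]: "pos (u @ v) = pos u @ pos v"
  by (simp add: pos_def)

section \<open>The sixteen factorizations and the corners of a triangle\<close>

lemma factorizations_iff: "(h, a, b) \<in> factorizations \<longleftrightarrow> cof a b = Some h"
proof -
  have "list_all (\<lambda>h. list_all (\<lambda>a. list_all (\<lambda>b.
      list_ex (\<lambda>w. list_ex (\<lambda>i. (h, a, b) = (w ! i, w ! ((i + 1) mod 12), w ! ((i + 2) mod 12))) [0..<12]) brady_words
      \<longleftrightarrow> cof a b = Some h) gens) gens) gens"
    by code_simp
  then have "list_ex (\<lambda>w. list_ex (\<lambda>i. (h, a, b) = (w ! i, w ! ((i + 1) mod 12), w ! ((i + 2) mod 12))) [0..<12]) brady_words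
      \<longleftrightarrow> cof a b = Some h"
    using in_gens unfolding list_all_iff by blast
  moreover have "(h, a, b) \<in> factorizations \<longleftrightarrow>
     list_ex (\<lambda>w. list_ex (\<lambda>i. (h, a, b) = (w ! i, w ! ((i + 1) mod 12), w ! ((i + 2) mod 12))) [0..<12]) brady_words"
    unfolding factorizations_def list_ex_iff set_upt mem_Collect_eq by force
  ultimately show ?thesis by simp
qed

text \<open>h a b = x implies a b (x^-1 h x) = x: the edges of a triangle can be read from any
  corner, at the price of one twist.\<close>

lemma cof_rotate: "cof a b = Some h \<Longrightarrow> cof b (psi h) = Some a"
  by (cases a; cases b) auto

lemma cof_psi: "cof a b = Some h \<Longrightarrow> cof (psi a) (psi b) = Some (psi h)"
  by (cases a; cases b) auto

text \<open>One chosen factorization per coatom, so that each of the others is compared with this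
  one only.\<close>

primrec coatom_rep :: "gen \<Rightarrow> gen list" where
  "coatom_rep Ga = [Gd, Ge]" | "coatom_rep Gb = [Gc, Ga]" | "coatom_rep Gc = [Gd, Gf]"
| "coatom_rep Gd = [Ge, Gf]" | "coatom_rep Ge = [Gb, Gc]" | "coatom_rep Gf = [Gb, Ga]"

lemma beq_rel:
  assumes "(l, r) \<in> B4_rels"
  shows "beq (pos l) (pos r)"
  using beq.rel[OF assms, of "[]" "[]"] by simp

lemma beq_coatom_rep: "cof a b = Some h \<Longrightarrow> beq (pos [a, b]) (pos (coatom_rep h))"
proof -
  have R: "beq (pos [Gb,Ga]) (pos [Ga,Ge])" "beq (pos [Ga,Ge]) (pos [Ge,Gb])"
     "beq (pos [Gd,Ge]) (pos [Ge,Gc])" "beq (pos [Ge,Gc]) (pos [Gc,Gd])"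
     "beq (pos [Gb,Gc]) (pos [Gc,Gf])" "beq (pos [Gc,Gf]) (pos [Gf,Gb])"
     "beq (pos [Gd,Gf]) (pos [Gf,Ga])" "beq (pos [Gf,Ga]) (pos [Ga,Gd])"
     "beq (pos [Gc,Ga]) (pos [Ga,Gc])" "beq (pos [Ge,Gf]) (pos [Gf,Ge])"
    by (rule beq_rel; simp add: B4_rels_def)+
  note S = beq.refl R(1,3,5,7,9,10)[THEN beq.sym] R(2)[THEN beq.sym, THEN beq.trans, OF R(1)[THEN beq.sym]]
    R(4)[THEN beq.sym, THEN beq.trans, OF R(3)[THEN beq.sym]] R(6)[THEN beq.sym, THEN beq.trans, OF R(5)[THEN beq.sym]]
    R(8)[THEN beq.sym, THEN beq.trans, OF R(7)[THEN beq.sym]]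
  assume "cof a b = Some h"
  then have "(a, b, h) \<in> {(Ga,Gc,Gb),(Ga,Gd,Gc),(Ga,Ge,Gf),(Gb,Ga,Gf),(Gb,Gc,Ge),(Gc,Ga,Gb),(Gc,Gd,Ga),(Gc,Gf,Ge),
     (Gd,Ge,Ga),(Gd,Gf,Gc),(Ge,Gb,Gf),(Ge,Gc,Ga),(Ge,Gf,Gd),(Gf,Ga,Gc),(Gf,Gb,Ge),(Gf,Ge,Gd)}"
    by (cases a; cases b) simp_all
  then show ?thesis by (elim insertE emptyE) (simp_all add: S)
qed

lemma beq_cof: "cof a b = Some h \<Longrightarrow> cof c d = Some h \<Longrightarrow> beq (pos [a, b]) (pos [c, d])"
  by (rule beq.trans[OF beq_coatom_rep beq.sym[OF beq_coatom_rep]])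

lemma beq_cof3: "cof a b = Some h \<Longrightarrow> cof c d = Some h \<Longrightarrow> beq (pos [a, b, y]) (pos [c, d, y])"
  using beq_right[OF beq_cof, of a b h c d "pos [y]"] by (simp add: pos_def)

lemma beq_cof3': "cof a b = Some h \<Longrightarrow> cof c d = Some h \<Longrightarrow> beq (pos [y, a, b]) (pos [y, c, d])"
  using beq_left[OF beq_cof, of a b h c d "pos [y]"] by (simp add: pos_def)

lemma beq_factorization: "cof a b = Some h \<Longrightarrow> beq (pos [h, a, b]) xword"
proof -
  have b: "beq (pos [Gb, Gc, Ga]) xword"
    unfolding xword_def by (rule beq_cof3'[of _ _ Gb]) auto
  have e: "beq (pos [Ge, Gb, Gc]) xword"
    unfolding xword_def by (rule beq_cof3[of _ _ Gf]) auto
  have f: "beq (pos [Gf, Gb, Ga]) xword"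
    by (rule beq.trans[OF _ b], rule beq_cof3[of _ _ Ge]) auto
  have "beq (pos [Ga, Gd, Ge]) (pos [Ga, Ge, Gc])" by (rule beq_cof3'[of _ _ Ga]) auto
  moreover have "beq (pos [Ga, Ge, Gc]) xword"
    unfolding xword_def by (rule beq_cof3[of _ _ Gf]) auto
  ultimately have a: "beq (pos [Ga, Gd, Ge]) xword" by (rule beq.trans)
  have "beq (pos [Gc, Gd, Gf]) (pos [Gc, Gf, Ga])" by (rule beq_cof3'[of _ _ Gc]) auto
  moreover have "beq (pos [Gc, Gf, Ga]) (pos [Gb, Gc, Ga])" by (rule beq_cof3[of _ _ Ge]) auto
  ultimately have c: "beq (pos [Gc, Gd, Gf]) xword" by (rule beq.trans[OF _ beq.trans[OF _ b]])
  have "beq (pos [Gd, Ge, Gf]) (pos [Ge, Gc, Gf])" by (rule beq_cof3[of _ _ Ga]) auto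
  moreover have "beq (pos [Ge, Gc, Gf]) (pos [Ge, Gb, Gc])" by (rule beq_cof3'[of _ _ Ge]) auto
  ultimately have d: "beq (pos [Gd, Ge, Gf]) xword" by (rule beq.trans[OF _ beq.trans[OF _ e]])
  assume "cof a b = Some h"
  then have "beq (pos [h] @ pos [a, b]) (pos [h] @ pos (coatom_rep h))"
    by (intro beq_left beq_coatom_rep)
  moreover have "beq (pos [h] @ pos (coatom_rep h)) xword"
    using a b c d e f by (cases h) (auto simp: pos_def)
  ultimately have "beq (pos [h] @ pos [a, b]) xword" by (rule beq.trans)
  then show ?thesis by (simp add: pos_def)
qed

text \<open>If p q is the coatom of a, then a p q and p q psi(a) both spell x, whence a x = a p q
  psi(a) = x psi(a).\<close>

lemma beq_xword_commute: "beq (pos [a] @ xword) (xword @ pos [psi a])"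
proof -
  have "cof (hd (coatom_rep a)) (last (coatom_rep a)) = Some a" by (cases a) auto
  then obtain p q where pq: "cof p q = Some a" by blast
  have 1: "beq (pos [p, q, psi a]) xword" using beq_factorization[OF cof_rotate[OF pq]] .
  have "beq (pos [a] @ xword) (pos [a] @ pos [p, q, psi a])" using beq_left[OF beq.sym[OF 1]] .
  also have "pos [a] @ pos [p, q, psi a] = pos [a, p, q] @ pos [psi a]" by (simp add: pos_def)
  finally show ?thesis using beq_right[OF beq_factorization[OF pq]] beq.trans by blast
qed

lemma beq_xpow_commute: "beq (pos w @ xpow n) (xpow n @ pos (map (psi ^^ n) w))"
proof -
  have 1: "beq (pos w @ xword) (xword @ pos (map psi w))" for w
  proof (induction w)
    case (Cons a w)
    have "beq (pos (a # w) @ xword) (pos [a] @ xword @ pos (map psi w))"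
      using beq_left[OF Cons, of "pos [a]"] by (simp add: pos_def)
    moreover have "beq ((pos [a] @ xword) @ pos (map psi w)) ((xword @ pos [psi a]) @ pos (map psi w))"
      by (rule beq_right[OF beq_xword_commute])
    ultimately have "beq (pos (a # w) @ xword) ((xword @ pos [psi a]) @ pos (map psi w))"
      unfolding append.assoc by (rule beq.trans)
    then show ?case by (simp add: pos_def)
  qed (simp add: pos_def beq.refl)
  show ?thesis
  proof (induction n arbitrary: w)
    case (Suc n)
    have "beq (pos w @ xword @ xpow n) ((xword @ pos (map psi w)) @ xpow n)"
      using beq_right[OF 1, of w "xpow n"] by simp
    moreover have "beq (xword @ pos (map psi w) @ xpow n) (xword @ xpow n @ pos (map (psi ^^ n) (map psi w)))"
      using beq_left[OF Suc] .
    ultimately have "beq (pos w @ xword @ xpow n) (xword @ xpow n @ pos (map (psi ^^ n) (map psi w)))"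
      unfolding append.assoc by (rule beq.trans)
    then show ?case by (simp add: xpow_Suc funpow_Suc_right o_def del: funpow.simps)
  qed (simp add: beq.refl)
qed

lemma psi_pow4: "(psi ^^ 4) a = a"
  by (cases a) (simp_all add: eval_nat_numeral)

lemma Xvertex_change_rep:
  assumes "Xvertex g = Xvertex h"
  shows "\<exists>k. \<forall>w. Xvertex (g @ pos w) = Xvertex (h @ pos (map (psi ^^ k) w))"
proof -
  have fwd: "Xvertex (u @ pos w) = Xvertex (v @ pos (map (psi ^^ n) w))" if "beq (u @ xpow n) v" for u v n w
  proof -
    have "beq (u @ pos w @ xpow n) (u @ xpow n @ pos (map (psi ^^ n) w))"
      by (rule beq_left[OF beq_xpow_commute])
    moreover have "beq ((u @ xpow n) @ pos (map (psi ^^ n) w)) (v @ pos (map (psi ^^ n) w))"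
      by (rule beq_right[OF that])
    ultimately have "beq ((u @ pos w) @ xpow n) (v @ pos (map (psi ^^ n) w))"
      by (auto intro: beq.trans)
    then show ?thesis using beq_Xvertex Xvertex_xpow by metis
  qed
  from assms obtain n where n: "beq (g @ xpow n) h \<or> beq (h @ xpow n) g"
    using Xvertex_eq_iff coset_rel_def by auto
  show ?thesis
  proof (cases "beq (g @ xpow n) h")
    case True
    then show ?thesis using fwd by blast
  next
    case False
    have "psi ^^ 4 = id" using psi_pow4 by (auto simp only: fun_eq_iff id_apply)
    then have p: "psi ^^ (4 * n) = id" by (simp only: funpow_mult[symmetric] id_funpow)
    \<comment> \<open>\<open>psi\<close> has order 4, so its 3n-th power inverts its n-th power and
      negative powers of x can be avoided.\<close>
    have "Xvertex (g @ pos w) = Xvertex (h @ pos (map (psi ^^ (3 * n)) w))" for w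
    proof -
      have "(psi ^^ n) ((psi ^^ (3 * n)) a) = a" for a
      proof -
        have "(psi ^^ n) ((psi ^^ (3 * n)) a) = (psi ^^ (n + 3 * n)) a" by (simp only: funpow_add o_apply)
        then show ?thesis using p by simp
      qed
      then show ?thesis using fwd[of h n g "map (psi ^^ (3 * n)) w"] n False by (simp add: o_def)
    qed
    then show ?thesis by blast
  qed
qed

lemma cof_psi_pow: "cof a b = Some h \<Longrightarrow> cof ((psi ^^ n) a) ((psi ^^ n) b) = Some ((psi ^^ n) h)"
  by (induction n) (auto intro: cof_psi)

lemma Xtriangles_iff:
  "t \<in> Xtriangles \<longleftrightarrow> (\<exists>g a b h. cof a b = Some h \<and> t = {Xvertex g, Xvertex (g @ pos [a]), Xvertex (g @ pos [a, b])})"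
proof
  assume "t \<in> Xtriangles"
  then obtain g a1 a2 a3 where "cof a2 a3 = Some a1"
    "t = {Xvertex g, Xvertex (g @ pos [a1]), Xvertex (g @ pos [a1, a2])}"
    unfolding Xtriangles_def factorizations_iff by blast
  moreover have "cof a1 a2 = Some (phi a3)"
    using calculation(1) by (cases a2; cases a3; simp; auto)
  ultimately show "\<exists>g a b h. cof a b = Some h \<and> t = {Xvertex g, Xvertex (g @ pos [a]), Xvertex (g @ pos [a, b])}"
    by blast
next
  assume "\<exists>g a b h. cof a b = Some h \<and> t = {Xvertex g, Xvertex (g @ pos [a]), Xvertex (g @ pos [a, b])}"
  then show "t \<in> Xtriangles"
    unfolding Xtriangles_def factorizations_iff using cof_rotate by blast
qed

lemma Xvertex_rotate:
  assumes "cof a b = Some h"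
  shows "Xvertex (g @ pos [a, b, psi h]) = Xvertex g"
proof -
  have "beq (g @ pos [a, b, psi h]) (g @ xpow 1)"
    using beq_left[OF beq_factorization[OF cof_rotate[OF assms]]] by (simp add: xpow_Suc)
  then show ?thesis using beq_Xvertex Xvertex_xpow by metis
qed

text \<open>Rotation moves the base point to any corner; changing the representative of that corner
  then twists both letters by the same power of \<open>psi\<close>.\<close>

lemma triangle_at:
  assumes "t \<in> Xtriangles" "Xvertex g \<in> t"
  shows "\<exists>a b h. cof a b = Some h \<and> t = {Xvertex g, Xvertex (g @ pos [a]), Xvertex (g @ pos [a, b])}"
proof -
  obtain g0 a b h where ab: "cof a b = Some h"
    and t: "t = {Xvertex g0, Xvertex (g0 @ pos [a]), Xvertex (g0 @ pos [a, b])}"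
    using assms(1) unfolding Xtriangles_iff by (elim exE conjE) (rule that)
  have r: "cof b (psi h) = Some a" "cof (psi h) (psi a) = Some b"
    by (rule cof_rotate[OF ab], rule cof_rotate[OF cof_rotate[OF ab]])
  have t1: "t = {Xvertex (g0 @ pos [a]), Xvertex ((g0 @ pos [a]) @ pos [b]), Xvertex ((g0 @ pos [a]) @ pos [b, psi h])}"
    unfolding append.assoc pos_append[symmetric] append_Cons append_Nil Xvertex_rotate[OF ab] t
    by (simp only: insert_commute)
  have "Xvertex ((g0 @ pos [a]) @ pos [b, psi h, psi a]) = Xvertex (g0 @ pos [a])"
    using Xvertex_rotate[OF r(1)] .
  then have e: "Xvertex ((g0 @ pos [a, b]) @ pos [psi h, psi a]) = Xvertex (g0 @ pos [a])"
    unfolding append.assoc pos_append[symmetric] append_Cons append_Nil .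
  have t2: "t = {Xvertex (g0 @ pos [a, b]), Xvertex ((g0 @ pos [a, b]) @ pos [psi h]),
      Xvertex ((g0 @ pos [a, b]) @ pos [psi h, psi a])}"
    unfolding e unfolding append.assoc pos_append[symmetric] append_Cons append_Nil Xvertex_rotate[OF ab] t
    by (simp only: insert_commute)
  have "\<exists>g1 a1 b1 h1. cof a1 b1 = Some h1 \<and> Xvertex g = Xvertex g1 \<and>
    t = {Xvertex g1, Xvertex (g1 @ pos [a1]), Xvertex (g1 @ pos [a1, b1])}"
  proof -
    consider "Xvertex g = Xvertex g0" | "Xvertex g = Xvertex (g0 @ pos [a])" | "Xvertex g = Xvertex (g0 @ pos [a, b])"
      using assms(2) unfolding t by blast
    then show ?thesis
    proof cases
      case 1 then show ?thesis by (intro exI[of _ g0] exI[of _ a] exI[of _ b] exI[of _ h] conjI ab t)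
    next
      case 2 then show ?thesis by (intro exI[of _ "g0 @ pos [a]"] exI[of _ b] exI[of _ "psi h"] exI[of _ a] conjI r(1) t1)
    next
      case 3 then show ?thesis by (intro exI[of _ "g0 @ pos [a, b]"] exI[of _ "psi h"] exI[of _ "psi a"] exI[of _ b] conjI r(2) t2)
    qed
  qed
  then obtain g1 a1 b1 h1 where 1: "cof a1 b1 = Some h1" "Xvertex g = Xvertex g1"
    "t = {Xvertex g1, Xvertex (g1 @ pos [a1]), Xvertex (g1 @ pos [a1, b1])}"
    by (elim exE conjE) (rule that)
  obtain k where k: "\<forall>w. Xvertex (g1 @ pos w) = Xvertex (g @ pos (map (psi ^^ k) w))"
    using Xvertex_change_rep[OF 1(2)[symmetric]] by blast
  have "t = {Xvertex g, Xvertex (g @ pos [(psi ^^ k) a1]), Xvertex (g @ pos [(psi ^^ k) a1, (psi ^^ k) b1])}"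
    using k[rule_format, of "[a1]"] k[rule_format, of "[a1, b1]"] by (simp add: 1(2) 1(3))
  with cof_psi_pow[OF 1(1), of k] show ?thesis by (intro exI conjI)
qed

section \<open>Normal forms separate the vertices around a vertex\<close>

lemma nf_Atom: "wact (pos [a]) [] = [Atom a]"
  by (simp add: pos_def lact_True)

lemma nf_Coatom: "cof a b = Some h \<Longrightarrow> wact (pos [a, b]) [] = [Coatom h]"
  by (simp add: wact_pos2)

text \<open>The normal form depends on the coset only, and g can be cancelled from it on the
  left.\<close>

lemma Xvertex_eq_nf:
  assumes "Xvertex (g @ u) = Xvertex (g @ v)"
  shows "wact u [] = wact v []"
proof -
  have "wact (winv g) (wact (g @ u) []) = wact (winv g) (wact (g @ v) [])"
    using coset_rel_nf Xvertex_eqD[OF assms] by blast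
  then show ?thesis by (simp add: wact_winv normal_wact)
qed

lemma Xvertex_eq_nf':
  assumes "Xvertex g = Xvertex (g @ v)"
  shows "wact v [] = []"
  using Xvertex_eq_nf[of g "[]" v] assms by simp

lemma triangle_on_edge:
  assumes "t \<in> Xtriangles" "Xvertex g \<in> t" "Xvertex (g @ pos [a]) \<in> t"
  shows "\<exists>b h. cof a b = Some h \<and> t = {Xvertex g, Xvertex (g @ pos [a]), Xvertex (g @ pos [a, b])}"
proof -
  obtain a' b' h' where *: "cof a' b' = Some h'"
    "t = {Xvertex g, Xvertex (g @ pos [a']), Xvertex (g @ pos [a', b'])}"
    using triangle_at[OF assms(1,2)] by blast
  have "Xvertex (g @ pos [a]) \<noteq> Xvertex g"
    using Xvertex_eq_nf'[of g "pos [a]"] nf_Atom[of a] by auto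
  moreover have "Xvertex (g @ pos [a]) \<noteq> Xvertex (g @ pos [a', b'])"
    using Xvertex_eq_nf[of g "pos [a]" "pos [a', b']"] nf_Atom[of a] nf_Coatom[OF *(1)] by auto
  ultimately have "Xvertex (g @ pos [a]) = Xvertex (g @ pos [a'])" using assms(3) *(2) by auto
  then have "a = a'" using Xvertex_eq_nf nf_Atom by (metis list.inject simple.inject(1))
  then show ?thesis using * by blast
qed

text \<open>The link of a vertex is the incidence graph of the Fano plane with an incident point-line pair
  removed; \<open>b\<close> and \<open>d\<close> are the two points that were on the removed line.\<close>

lemma no_common_triangle:
  assumes "t \<in> Xtriangles" "Xvertex g \<in> t" "Xvertex (g @ pos [Gb]) \<in> t" "v \<in> t"
    and "t' \<in> Xtriangles" "Xvertex g \<in> t'" "Xvertex (g @ pos [Gd]) \<in> t'" "v \<in> t'"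
    and "v \<noteq> Xvertex g"
  shows False
proof -
  obtain y h where 1: "cof Gb y = Some h"
    "t = {Xvertex g, Xvertex (g @ pos [Gb]), Xvertex (g @ pos [Gb, y])}"
    using triangle_on_edge[OF assms(1-3)] by blast
  obtain z k where 2: "cof Gd z = Some k"
    "t' = {Xvertex g, Xvertex (g @ pos [Gd]), Xvertex (g @ pos [Gd, z])}"
    using triangle_on_edge[OF assms(5-7)] by blast
  have "h \<noteq> k" using 1(1) 2(1) by (cases y; cases z) auto
  have "v = Xvertex (g @ pos [Gb]) \<or> v = Xvertex (g @ pos [Gb, y])" using 1(2) assms(4,9) by blast
  then obtain u1 where u1: "v = Xvertex (g @ u1)" "wact u1 [] = [Atom Gb] \<or> wact u1 [] = [Coatom h]"
    using nf_Atom nf_Coatom[OF 1(1)] by blast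
  have "v = Xvertex (g @ pos [Gd]) \<or> v = Xvertex (g @ pos [Gd, z])" using 2(2) assms(8,9) by blast
  then obtain u2 where u2: "v = Xvertex (g @ u2)" "wact u2 [] = [Atom Gd] \<or> wact u2 [] = [Coatom k]"
    using nf_Atom nf_Coatom[OF 2(1)] by blast
  have "wact u1 [] = wact u2 []" using Xvertex_eq_nf[of g u1 u2] u1(1) u2(1) by simp
  then show False using u1(2) u2(2) \<open>h \<noteq> k\<close> by auto
qed

text \<open>Along the directed boundary of a triangle such a function takes the steps 1, 1, -2 in
  some cyclic order. Besides negated distances to a vertex the class contains the maxima provided by
  \<open>height_max\<close>.\<close>

definition height :: "(word set \<Rightarrow> int) \<Rightarrow> bool" where
  "height F \<longleftrightarrow> (\<forall>g a. F (Xvertex (g @ pos [a])) - F (Xvertex g) \<in> {1, -2})"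

lemma height_vdist: "height (\<lambda>v. c - vdist p v)"
  unfolding height_def vdist_Xvertex using pdist_step[of _ _ p] by (smt (verit) insert_iff singletonD)

lemma height_triangle:
  assumes "t \<in> Xtriangles"
  obtains v0 v1 v2 where "t = {v0, v1, v2}" "v0 \<noteq> v1" "v1 \<noteq> v2" "v0 \<noteq> v2"
    "\<And>F. height F \<Longrightarrow> F v1 - F v0 \<in> {1, -2} \<and> F v2 - F v1 \<in> {1, -2} \<and> F v0 - F v2 \<in> {1, -2}"
proof -
  obtain g a b h where *: "cof a b = Some h" "t = {Xvertex g, Xvertex (g @ pos [a]), Xvertex (g @ pos [a, b])}"
    using assms unfolding Xtriangles_iff by (elim exE conjE) (rule that)
  have e: "(g @ pos [a]) @ pos [b] = g @ pos [a, b]" "(g @ pos [a, b]) @ pos [psi h] = g @ pos [a, b, psi h]"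
    by (simp_all add: pos_def)
  have H: "F (Xvertex (g @ pos [a])) - F (Xvertex g) \<in> {1, -2} \<and>
      F (Xvertex (g @ pos [a, b])) - F (Xvertex (g @ pos [a])) \<in> {1, -2} \<and>
      F (Xvertex g) - F (Xvertex (g @ pos [a, b])) \<in> {1, -2}" if "height F" for F
  proof -
    have st: "F (Xvertex (u @ pos [y])) - F (Xvertex u) \<in> {1, -2}" for u y
      using that by (simp only: height_def)
    show ?thesis
      using st[of g a] st[of "g @ pos [a]" b] st[of "g @ pos [a, b]" "psi h"]
      unfolding e Xvertex_rotate[OF *(1)] by blast
  qed
  have ne: "Xvertex g \<noteq> Xvertex (g @ pos [a])" "Xvertex (g @ pos [a]) \<noteq> Xvertex (g @ pos [a, b])"
    "Xvertex g \<noteq> Xvertex (g @ pos [a, b])"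
    using H[OF height_vdist[of 0 "[]"]] by auto
  show thesis using that[OF *(2) ne H] .
qed

section \<open>The path metric\<close>

text \<open>An inductive form of the sequences in \<open>Xdist\<close>, so that estimates along a
  path follow by rule induction.\<close>

inductive chain :: "point \<Rightarrow> point \<Rightarrow> real \<Rightarrow> bool" where
  chain_refl: "p \<in> Xpoints \<Longrightarrow> chain p p 0"
| chain_step: "p \<in> Xpoints \<Longrightarrow> same_cell p q \<Longrightarrow> chain q r l \<Longrightarrow> chain p r (local_dist p q + l)"

lemma chain_Xpoints: "chain p q l \<Longrightarrow> p \<in> Xpoints \<and> q \<in> Xpoints"
  by (induction rule: chain.induct) auto

lemma local_dist_nonneg [simp]: "0 \<le> local_dist p q"
  by (simp add: local_dist_def sum_nonneg)

lemma chain_nonneg: "chain p q l \<Longrightarrow> 0 \<le> l"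
  by (induction rule: chain.induct) auto

lemma chain_of_sequence:
  assumes "\<forall>i\<le>n. c i \<in> Xpoints" "\<forall>i<n. same_cell (c i) (c (Suc i))"
  shows "chain (c 0) (c n) (\<Sum>i<n. local_dist (c i) (c (Suc i)))"
  using assms
proof (induction n arbitrary: c)
  case 0
  then show ?case by (simp add: chain_refl)
next
  case (Suc n)
  have "chain (c (Suc 0)) (c (Suc n)) (\<Sum>i<n. local_dist (c (Suc i)) (c (Suc (Suc i))))"
    using Suc.IH[of "\<lambda>i. c (Suc i)"] Suc.prems by simp
  then show ?case unfolding sum.lessThan_Suc_shift
    using Suc.prems by (intro chain_step) auto
qed

lemma sequence_of_chain:
  "chain p q l \<Longrightarrow> \<exists>c n. l = (\<Sum>i<n. local_dist (c i) (c (Suc i))) \<and> c 0 = p \<and> c n = q \<and>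
      (\<forall>i\<le>n. c i \<in> Xpoints) \<and> (\<forall>i<n. same_cell (c i) (c (Suc i)))"
proof (induction rule: chain.induct)
  case (chain_refl p)
  show ?case by (rule exI[of _ "\<lambda>_. p"], rule exI[of _ 0]) (use chain_refl in auto)
next
  case (chain_step p q r l)
  obtain c n where c: "l = (\<Sum>i<n. local_dist (c i) (c (Suc i)))" "c 0 = q" "c n = r"
    "\<forall>i\<le>n. c i \<in> Xpoints" "\<forall>i<n. same_cell (c i) (c (Suc i))"
    using chain_step.IH by blast
  show ?case
  proof (rule exI[of _ "case_nat p c"], rule exI[of _ "Suc n"], intro conjI allI impI)
    show "local_dist p q + l = (\<Sum>i<Suc n. local_dist (case i of 0 \<Rightarrow> p | Suc x \<Rightarrow> c x) (case Suc i of 0 \<Rightarrow> p | Suc x \<Rightarrow> c x))"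
      unfolding sum.lessThan_Suc_shift using c by simp
  next
    fix i assume "i \<le> Suc n"
    then show "(case i of 0 \<Rightarrow> p | Suc x \<Rightarrow> c x) \<in> Xpoints"
      using c chain_step.hyps by (cases i) auto
  next
    fix i assume "i < Suc n"
    then show "same_cell (case i of 0 \<Rightarrow> p | Suc x \<Rightarrow> c x) (case Suc i of 0 \<Rightarrow> p | Suc x \<Rightarrow> c x)"
      using c chain_step.hyps by (cases i) auto
  qed (use c in auto)
qed

lemma Xdist_chain: "Xdist p q = Inf {l. chain p q l}"
proof -
  have "{(\<Sum>i<n. local_dist (c i) (c (Suc i))) | c n. c 0 = p \<and> c n = q \<and>
      (\<forall>i\<le>n. c i \<in> Xpoints) \<and> (\<forall>i<n. same_cell (c i) (c (Suc i)))} = {l. chain p q l}"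
    (is "?A = ?B")
  proof (intro equalityI subsetI)
    fix l assume "l \<in> ?A"
    then show "l \<in> ?B" using chain_of_sequence by blast
  next
    fix l assume "l \<in> ?B"
    then have "chain p q l" by simp
    from sequence_of_chain[OF this] show "l \<in> ?A" by blast
  qed
  then show ?thesis by (simp add: Xdist_def)
qed

lemma chain_append: "chain p q l \<Longrightarrow> chain q r m \<Longrightarrow> chain p r (l + m)"
proof (induction rule: chain.induct)
  case (chain_step p q r' l)
  then show ?case using chain.chain_step[of p q r "l + m"] by (simp add: add.assoc)
qed simp

lemma local_dist_commute: "local_dist p q = local_dist q p"
  by (simp add: local_dist_def Un_commute power2_commute)

lemma same_cell_commute: "same_cell p q \<longleftrightarrow> same_cell q p"
  by (auto simp: same_cell_def)

lemma chain_one: "p \<in> Xpoints \<Longrightarrow> q \<in> Xpoints \<Longrightarrow> same_cell p q \<Longrightarrow> chain p q (local_dist p q)"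
  using chain_step[OF _ _ chain_refl, of p q] by simp

lemma chain_rev: "chain p q l \<Longrightarrow> chain q p l"
proof (induction rule: chain.induct)
  case (chain_step p q r l)
  then have "chain q p (local_dist q p)"
    using chain_one chain_Xpoints by (simp add: same_cell_commute)
  from chain_append[OF chain_step.IH this] show ?case by (simp add: local_dist_commute add.commute)
qed (rule chain_refl)

lemma Xdist_le_chain: "chain p q l \<Longrightarrow> Xdist p q \<le> l"
  unfolding Xdist_chain by (rule cInf_lower) (auto intro!: bdd_belowI[of _ 0] chain_nonneg)

lemma Xdist_le_local: "p \<in> Xpoints \<Longrightarrow> q \<in> Xpoints \<Longrightarrow> same_cell p q \<Longrightarrow> Xdist p q \<le> local_dist p q"
  by (rule Xdist_le_chain[OF chain_one])

lemma supp_vertex [simp]: "supp (vertex_point v) = {v}"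
  by (auto simp: supp_def vertex_point_def)

lemma Xtriangles_finite: "t \<in> Xtriangles \<Longrightarrow> finite t"
  by (rule height_triangle) auto

lemma vertex_point_Xpoints: "t \<in> Xtriangles \<Longrightarrow> v \<in> t \<Longrightarrow> vertex_point v \<in> Xpoints"
  unfolding Xpoints_def using Xtriangles_finite
  by (auto simp: vertex_point_def supp_def intro!: bexI[of _ t])

lemma atom_triangle: "\<exists>t\<in>Xtriangles. Xvertex g \<in> t \<and> Xvertex (g @ pos [a]) \<in> t"
proof -
  obtain b h where "cof a b = Some h" by (cases a) (use cof.simps(1-16) in blast)+
  then have "{Xvertex g, Xvertex (g @ pos [a]), Xvertex (g @ pos [a, b])} \<in> Xtriangles"
    unfolding Xtriangles_iff by (intro exI conjI) auto
  then show ?thesis by blast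
qed

lemma chain_edge: "\<exists>l. chain (vertex_point (Xvertex (g @ pos [a]))) (vertex_point (Xvertex g)) l"
proof -
  obtain t where t: "t \<in> Xtriangles" "Xvertex g \<in> t" "Xvertex (g @ pos [a]) \<in> t"
    using atom_triangle by blast
  then have "same_cell (vertex_point (Xvertex (g @ pos [a]))) (vertex_point (Xvertex g))"
    by (auto simp: same_cell_def)
  then show ?thesis using chain_one vertex_point_Xpoints t by blast
qed

lemma chain_to_base: "\<exists>l. chain (vertex_point (Xvertex g)) (vertex_point (Xvertex [])) l"
proof (induction g rule: rev_induct)
  case Nil
  obtain t where "t \<in> Xtriangles" "Xvertex [] \<in> t" using atom_triangle by blast
  then show ?case using chain_refl vertex_point_Xpoints by blast
next
  case (snoc x g)
  obtain s b where x: "x = (s, b)" by force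
  have "\<exists>l. chain (vertex_point (Xvertex (g @ [x]))) (vertex_point (Xvertex g)) l"
  proof (cases b)
    case True
    then show ?thesis using chain_edge[of g s] x by (simp add: pos_def)
  next
    case False
    have "beq ((g @ [x]) @ pos [s]) g"
      using beq.cancel[of g s False "[]"] x False by (simp add: pos_def)
    then have "Xvertex ((g @ [x]) @ pos [s]) = Xvertex g" by (rule beq_Xvertex)
    then show ?thesis using chain_edge[of "g @ [x]" s] chain_rev by metis
  qed
  then show ?case using snoc chain_append by blast
qed

text \<open>Guards against an infimum over the empty set: each point reaches a vertex of its
  triangle, and each vertex reaches the base vertex letter by letter.\<close>

lemma chain_exists:
  assumes "p \<in> Xpoints" "q \<in> Xpoints"
  shows "\<exists>l. chain p q l"
proof -
  have "\<exists>l. chain p (vertex_point (Xvertex [])) l" if p: "p \<in> Xpoints" for p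
  proof -
    obtain t where t: "t \<in> Xtriangles" "supp p \<subseteq> t" using p by (auto simp: Xpoints_def)
    then obtain g where g: "Xvertex g \<in> t" unfolding Xtriangles_iff by blast
    have "same_cell p (vertex_point (Xvertex g))" using t g by (auto simp: same_cell_def)
    then have "chain p (vertex_point (Xvertex g)) (local_dist p (vertex_point (Xvertex g)))"
      using chain_one p vertex_point_Xpoints t g by blast
    then show ?thesis using chain_to_base chain_append by blast
  qed
  then show ?thesis using assms chain_append chain_rev by meson
qed

lemma Xdist_ge:
  assumes "p \<in> Xpoints" "q \<in> Xpoints" "\<And>l. chain p q l \<Longrightarrow> c \<le> l"
  shows "c \<le> Xdist p q"
  unfolding Xdist_chain using chain_exists[OF assms(1,2)] assms(3) by (intro cInf_greatest) auto

lemma Xdist_nonneg: "p \<in> Xpoints \<Longrightarrow> q \<in> Xpoints \<Longrightarrow> 0 \<le> Xdist p q"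
  by (rule Xdist_ge) (auto intro: chain_nonneg)

lemma Xdist_commute: "Xdist p q = Xdist q p"
  unfolding Xdist_chain using chain_rev by (intro arg_cong[where f = Inf]) auto

lemma Xdist_triangle:
  assumes "p \<in> Xpoints" "q \<in> Xpoints" "r \<in> Xpoints"
  shows "Xdist p r \<le> Xdist p q + Xdist q r"
proof -
  have "Xdist p r - m \<le> Xdist p q" if m: "chain q r m" for m
    by (rule Xdist_ge[OF assms(1,2)]) (use Xdist_le_chain chain_append m in fastforce)
  then have "Xdist p r - Xdist p q \<le> Xdist q r"
    by (intro Xdist_ge[OF assms(2,3)]) (simp add: algebra_simps)
  then show ?thesis by simp
qed

lemma Xdist_lipschitz:
  assumes "p \<in> Xpoints" "q \<in> Xpoints" "0 \<le> C"
    and L: "\<And>p q. p \<in> Xpoints \<Longrightarrow> q \<in> Xpoints \<Longrightarrow> same_cell p q \<Longrightarrow> f p - f q \<le> C * local_dist p q"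
  shows "f p - f q \<le> C * Xdist p q"
proof -
  have *: "chain p q l \<Longrightarrow> f p - f q \<le> C * l" for l
  proof (induction rule: chain.induct)
    case (chain_step p q r l)
    then show ?case using L[of p q] chain_Xpoints[of q r l] by (simp add: algebra_simps)
  qed simp
  show ?thesis
  proof (cases "C = 0")
    case True
    then show ?thesis using chain_exists[OF assms(1,2)] * by auto
  next
    case False
    then have "C > 0" using assms(3) by simp
    then have "(f p - f q) / C \<le> Xdist p q"
      using * by (intro Xdist_ge[OF assms(1,2)]) (simp add: field_simps)
    then show ?thesis using \<open>C > 0\<close> by (simp add: field_simps)
  qed
qed

lemma local_dist_on:
  assumes "finite t" "supp p \<subseteq> t" "supp q \<subseteq> t"
  shows "local_dist p q = sqrt (1/2 * (\<Sum>v\<in>t. (p v - q v)\<^sup>2))"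
proof -
  have "(\<Sum>v\<in>supp p \<union> supp q. (p v - q v)\<^sup>2) = (\<Sum>v\<in>t. (p v - q v)\<^sup>2)"
    using assms by (intro sum.mono_neutral_left) (auto simp: supp_def)
  then show ?thesis by (simp add: local_dist_def)
qed

text \<open>The constant comes from dropping the other summands of \<open>local_dist\<close>. The
  estimate serves to separate points and to keep nearby points in one triangle.\<close>

lemma coordinate_lipschitz:
  assumes "p \<in> Xpoints" "q \<in> Xpoints"
  shows "p v - q v \<le> sqrt 2 * Xdist p q"
proof (rule Xdist_lipschitz[OF assms, where f = "\<lambda>p. p v"])
  fix p q assume "p \<in> Xpoints" "q \<in> Xpoints" "same_cell p q"
  then obtain t where t: "t \<in> Xtriangles" "supp p \<subseteq> t" "supp q \<subseteq> t" by (auto simp: same_cell_def)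
  have fin: "finite t" using Xtriangles_finite t by blast
  have "(p v - q v)\<^sup>2 \<le> (\<Sum>v\<in>t. (p v - q v)\<^sup>2)"
  proof (cases "v \<in> t")
    case True
    then show ?thesis using fin member_le_sum[of v t "\<lambda>v. (p v - q v)\<^sup>2"] by simp
  next
    case False
    then have "p v = 0" "q v = 0" using t by (auto simp: supp_def)
    then show ?thesis by (simp add: sum_nonneg)
  qed
  then have "p v - q v \<le> sqrt (\<Sum>v\<in>t. (p v - q v)\<^sup>2)" by (rule real_le_rsqrt)
  also have "\<dots> = sqrt 2 * local_dist p q"
    by (simp add: local_dist_on[OF fin t(2,3)] real_sqrt_mult[symmetric])
  finally show "p v - q v \<le> sqrt 2 * local_dist p q" .
qed simp

lemma Xdist_zero:
  assumes "p \<in> Xpoints" "q \<in> Xpoints" "Xdist p q = 0"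
  shows "p = q"
proof
  fix v
  show "p v = q v"
    using coordinate_lipschitz[OF assms(1,2), of v] coordinate_lipschitz[OF assms(2,1), of v] assms(3)
    by (simp add: Xdist_commute)
qed

section \<open>Height functions bound distances from below\<close>

definition aff :: "(word set \<Rightarrow> int) \<Rightarrow> point \<Rightarrow> real" where
  "aff F p = (\<Sum>v\<in>supp p. p v * real_of_int (F v))"

lemma aff_on:
  assumes "finite t" "supp p \<subseteq> t"
  shows "aff F p = (\<Sum>v\<in>t. p v * real_of_int (F v))"
  unfolding aff_def using assms by (intro sum.mono_neutral_left) (auto simp: supp_def)

lemma sum3: "v0 \<noteq> v1 \<Longrightarrow> v1 \<noteq> v2 \<Longrightarrow> v0 \<noteq> v2 \<Longrightarrow> sum f {v0, v1, v2} = f v0 + f v1 + (f v2 :: real)"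
  by (simp add: add.assoc)

lemma Xpoints_sum:
  assumes "p \<in> Xpoints" "finite t" "supp p \<subseteq> t"
  shows "(\<Sum>v\<in>t. p v) = 1"
proof -
  obtain t' where t': "t' \<in> Xtriangles" "supp p \<subseteq> t'" "(\<Sum>v\<in>t'. p v) = 1" using assms(1) by (auto simp: Xpoints_def)
  have "(\<Sum>v\<in>supp p. p v) = (\<Sum>v\<in>t'. p v)"
    using t' Xtriangles_finite by (intro sum.mono_neutral_left) (auto simp: supp_def)
  moreover have "(\<Sum>v\<in>supp p. p v) = (\<Sum>v\<in>t. p v)"
    using assms by (intro sum.mono_neutral_left) (auto simp: supp_def)
  ultimately show ?thesis using t' by simp
qed

text \<open>Cauchy-Schwarz for the squared norm x1^2 + x1 x2 + x2^2 in a basis of unit vectors at 60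
  degrees, with its dual form 4/3 (u^2 - u w + w^2); the defect is a square.\<close>

lemma hex_cauchy:
  fixes x1 x2 u w :: real
  shows "3 * (x1 * u + x2 * w)\<^sup>2 \<le> 4 * (x1\<^sup>2 + x1 * x2 + x2\<^sup>2) * (u\<^sup>2 - u * w + w\<^sup>2)"
proof -
  have "4 * (x1\<^sup>2 + x1 * x2 + x2\<^sup>2) * (u\<^sup>2 - u * w + w\<^sup>2) - 3 * (x1 * u + x2 * w)\<^sup>2
      = (x1 * u + 2 * x2 * u - 2 * x1 * w - x2 * w)\<^sup>2"
    by (simp add: power2_eq_square algebra_simps)
  then show ?thesis by (smt (verit) zero_le_power2)
qed

text \<open>The gradients of two height functions on a triangle coincide or make an angle of 120 degrees; so
  those of \<open>F\<close> and \<open>-G\<close> are opposite or make an angle of 60 degrees.\<close>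

lemma aff_lipschitz:
  assumes "height F" "height G" "0 \<le> \<alpha>" "0 \<le> \<beta>" "p \<in> Xpoints" "q \<in> Xpoints"
  shows "\<alpha> * (aff F p - aff F q) - \<beta> * (aff G p - aff G q)
       \<le> 2 * sqrt (\<alpha>\<^sup>2 + \<alpha> * \<beta> + \<beta>\<^sup>2) * Xdist p q"
proof -
  define f where "f = (\<lambda>p. \<alpha> * aff F p - \<beta> * aff G p)"
  have "f p - f q \<le> 2 * sqrt (\<alpha>\<^sup>2 + \<alpha> * \<beta> + \<beta>\<^sup>2) * Xdist p q"
  proof (rule Xdist_lipschitz[OF assms(5,6)])
    fix p q assume pq: "p \<in> Xpoints" "q \<in> Xpoints" "same_cell p q"
    then obtain t where t: "t \<in> Xtriangles" "supp p \<subseteq> t" "supp q \<subseteq> t" by (auto simp: same_cell_def)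
    have fin: "finite t" using Xtriangles_finite t by blast
    obtain v0 v1 v2 where v: "t = {v0, v1, v2}" "v0 \<noteq> v1" "v1 \<noteq> v2" "v0 \<noteq> v2"
      and H: "\<And>F. height F \<Longrightarrow> F v1 - F v0 \<in> {1, -2} \<and> F v2 - F v1 \<in> {1, -2} \<and> F v0 - F v2 \<in> {1, -2}"
      using height_triangle[OF t(1)] by metis
    define x0 x1 x2 where "x0 = p v0 - q v0" and "x1 = p v1 - q v1" and "x2 = p v2 - q v2"
    have x0: "x0 = - x1 - x2"
      using Xpoints_sum[OF pq(1) fin t(2)] Xpoints_sum[OF pq(2) fin t(3)] v
      by (simp add: sum3 x0_def x1_def x2_def)
    have affd: "aff K p - aff K q = x1 * real_of_int (K v1 - K v0) + x2 * real_of_int (K v2 - K v0)" for K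
    proof -
      have "aff K p - aff K q = x0 * K v0 + x1 * K v1 + x2 * K v2"
        using v by (simp add: aff_on[OF fin t(2)] aff_on[OF fin t(3)] sum3 x0_def x1_def x2_def algebra_simps)
      then show ?thesis by (simp add: x0 algebra_simps)
    qed
    define u where "u = \<alpha> * real_of_int (F v1 - F v0) - \<beta> * real_of_int (G v1 - G v0)"
    define w where "w = \<alpha> * real_of_int (F v2 - F v0) - \<beta> * real_of_int (G v2 - G v0)"
    define Q where "Q = \<alpha>\<^sup>2 + \<alpha> * \<beta> + \<beta>\<^sup>2"
    have fd: "f p - f q = x1 * u + x2 * w"
    proof -
      have "f p - f q = \<alpha> * (aff F p - aff F q) - \<beta> * (aff G p - aff G q)"
        by (simp add: f_def algebra_simps)
      then show ?thesis by (simp add: affd u_def w_def algebra_simps)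
    qed
    have pat: "(K v1 - K v0, K v2 - K v0) \<in> {(1, 2), (1, -1), (-2, -1)}" if "height K" for K
      using H[OF that] by auto
    have ab: "0 \<le> \<alpha> * \<beta>" using assms by simp
    \<comment> \<open>The left side is 3/4 of the squared gradient of f. It equals 3 (\<alpha> -
      \<beta>)^2 if F and G have the same pattern on the triangle and 3 Q otherwise.\<close>
    have Q: "u\<^sup>2 - u * w + w\<^sup>2 \<le> 3 * Q"
    proof -
      define a1 a2 b1 b2 where "a1 = F v1 - F v0" and "a2 = F v2 - F v0" and "b1 = G v1 - G v0" and "b2 = G v2 - G v0"
      have pats: "(a1, a2) \<in> {(1, 2), (1, -1), (-2, -1)}" "(b1, b2) \<in> {(1, 2), (1, -1), (-2, -1)}"
        unfolding a1_def a2_def b1_def b2_def by (rule pat[OF assms(1)], rule pat[OF assms(2)])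
      have uw: "u = \<alpha> * a1 - \<beta> * b1" "w = \<alpha> * a2 - \<beta> * b2"
        by (simp_all add: u_def w_def a1_def a2_def b1_def b2_def)
      show ?thesis
        unfolding uw using ab pats by (auto simp: Q_def power2_eq_square algebra_simps)
    qed
    have Q0: "0 \<le> Q" using ab by (simp add: Q_def)
    have ld: "(local_dist p q)\<^sup>2 = x1\<^sup>2 + x1 * x2 + x2\<^sup>2"
      using v by (simp add: local_dist_on[OF fin t(2,3)] sum3 x0_def[symmetric] x1_def[symmetric] x2_def[symmetric])
        (simp add: x0 power2_eq_square algebra_simps)
    have "3 * (f p - f q)\<^sup>2 \<le> 4 * (local_dist p q)\<^sup>2 * (u\<^sup>2 - u * w + w\<^sup>2)"
      unfolding fd ld by (rule hex_cauchy)
    also have "\<dots> \<le> 4 * (local_dist p q)\<^sup>2 * (3 * Q)"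
      by (rule mult_left_mono[OF Q]) simp
    finally have "(f p - f q)\<^sup>2 \<le> (2 * sqrt Q * local_dist p q)\<^sup>2"
      using Q0 by (simp add: power_mult_distrib)
    then have "f p - f q \<le> 2 * sqrt Q * local_dist p q"
      using Q0 by (intro power2_le_imp_le[of "f p - f q"]) auto
    then show "f p - f q \<le> 2 * sqrt (\<alpha>\<^sup>2 + \<alpha> * \<beta> + \<beta>\<^sup>2) * local_dist p q" by (simp add: Q_def)
  qed (use assms in auto)
  moreover have "f p - f q = \<alpha> * (aff F p - aff F q) - \<beta> * (aff G p - aff G q)"
    by (simp add: f_def right_diff_distrib)
  ultimately show ?thesis by simp
qed

text \<open>In a Euclidean plane the displacement with increments x, y, z is half the gradient of
  \<open>\<alpha> F - \<beta> G\<close>. This gradient is therefore parallel to the displacement,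
  and its Lipschitz bound is sharp. The order of x, y, z makes both coefficients
  nonnegative.\<close>

lemma Xdist_lower_ordered:
  assumes "height F" "height G" "p \<in> Xpoints" "q \<in> Xpoints"
    and "x = aff F p - aff F q" "z = aff G p - aff G q" "x + y + z = 0" "y \<le> x" "z \<le> y"
  shows "x\<^sup>2 + y\<^sup>2 + z\<^sup>2 \<le> 6 * (Xdist p q)\<^sup>2"
proof -
  define \<alpha> \<beta> Q where "\<alpha> = (x - y) / 3" and "\<beta> = (y - z) / 3" and "Q = \<alpha>\<^sup>2 + \<alpha> * \<beta> + \<beta>\<^sup>2"
  have ab: "0 \<le> \<alpha>" "0 \<le> \<beta>" using assms by (auto simp: \<alpha>_def \<beta>_def)
  have xz: "x = 2 * \<alpha> + \<beta>" "z = - \<alpha> - 2 * \<beta>" "y = \<beta> - \<alpha>" using assms(7) by (auto simp: \<alpha>_def \<beta>_def field_simps)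
  have Q0: "0 \<le> Q" using ab by (simp add: Q_def)
  have "\<alpha> * x - \<beta> * z \<le> 2 * sqrt Q * Xdist p q"
    using aff_lipschitz[OF assms(1,2) ab assms(3,4)] assms(5,6) by (simp add: Q_def)
  moreover have "\<alpha> * x - \<beta> * z = 2 * Q" by (simp add: xz Q_def power2_eq_square algebra_simps)
  moreover have "Q = sqrt Q * sqrt Q" using Q0 by simp
  ultimately have le: "sqrt Q * sqrt Q \<le> sqrt Q * Xdist p q" by simp
  have "sqrt Q \<le> Xdist p q"
  proof (cases "sqrt Q > 0")
    case True
    then show ?thesis by (rule mult_left_le_imp_le[OF le])
  next
    case False
    then show ?thesis using Xdist_nonneg[OF assms(3,4)] by linarith
  qed
  then have "(sqrt Q)\<^sup>2 \<le> (Xdist p q)\<^sup>2" using Q0 by (intro power_mono) auto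
  then have "Q \<le> (Xdist p q)\<^sup>2" using Q0 by simp
  moreover have "x\<^sup>2 + y\<^sup>2 + z\<^sup>2 = 6 * Q" by (simp add: xz Q_def power2_eq_square algebra_simps)
  ultimately show ?thesis by simp
qed

lemma Xdist_lower:
  assumes "height F0" "height F1" "height F2" "p \<in> Xpoints" "q \<in> Xpoints"
    and "x0 = aff F0 p - aff F0 q" "x1 = aff F1 p - aff F1 q" "x2 = aff F2 p - aff F2 q" "x0 + x1 + x2 = 0"
  shows "x0\<^sup>2 + x1\<^sup>2 + x2\<^sup>2 \<le> 6 * (Xdist p q)\<^sup>2"
proof -
  consider "x1 \<le> x0" "x2 \<le> x1" | "x2 \<le> x0" "x1 \<le> x2" | "x0 \<le> x1" "x2 \<le> x0"
    | "x2 \<le> x1" "x0 \<le> x2" | "x0 \<le> x2" "x1 \<le> x0" | "x1 \<le> x2" "x0 \<le> x1" by linarith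
  then show ?thesis
  proof cases
    case 1
    have "x0 + x1 + x2 = 0" using assms(9) by linarith
    from Xdist_lower_ordered[OF assms(1,3,4,5,6,8) this 1] show ?thesis by linarith
  next
    case 2
    have "x0 + x2 + x1 = 0" using assms(9) by linarith
    from Xdist_lower_ordered[OF assms(1,2,4,5,6,7) this 2] show ?thesis by linarith
  next
    case 3
    have "x1 + x0 + x2 = 0" using assms(9) by linarith
    from Xdist_lower_ordered[OF assms(2,3,4,5,7,8) this 3] show ?thesis by linarith
  next
    case 4
    have "x1 + x2 + x0 = 0" using assms(9) by linarith
    from Xdist_lower_ordered[OF assms(2,1,4,5,7,6) this 4] show ?thesis by linarith
  next
    case 5
    have "x2 + x0 + x1 = 0" using assms(9) by linarith
    from Xdist_lower_ordered[OF assms(3,2,4,5,8,7) this 5] show ?thesis by linarith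
  next
    case 6
    have "x2 + x1 + x0 = 0" using assms(9) by linarith
    from Xdist_lower_ordered[OF assms(3,1,4,5,8,6) this 6] show ?thesis by linarith
  qed
qed

lemma length_of_nonneg: "0 \<le> length_of L"
proof (induction L)
  case (Cons s L)
  then show ?case by (cases s) auto
qed simp

lemma pdist_self [simp]: "pdist u u = 0"
  by (simp add: pdist_def wact_winv)

lemma vdist_nonneg: "0 \<le> vdist p v"
  by (simp add: vdist_def pdist_def length_of_nonneg)

lemma triangle_vertex: "t \<in> Xtriangles \<Longrightarrow> v \<in> t \<Longrightarrow> \<exists>u. v = Xvertex u"
  by (auto simp: Xtriangles_iff)

text \<open>The upper bound is the one-step chain. For the lower bound, the negated distances to the
  three corners restrict to the triangle as three linear forms with constant sum, so
  \<open>Xdist_lower\<close> applies.\<close>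

lemma Xdist_same_cell:
  assumes "p \<in> Xpoints" "q \<in> Xpoints" "same_cell p q"
  shows "Xdist p q = local_dist p q"
proof (rule antisym[OF Xdist_le_local[OF assms]])
  obtain t where t: "t \<in> Xtriangles" "supp p \<subseteq> t" "supp q \<subseteq> t" using assms(3) by (auto simp: same_cell_def)
  have fin: "finite t" using Xtriangles_finite t by blast
  obtain v0 v1 v2 where v: "t = {v0, v1, v2}" "v0 \<noteq> v1" "v1 \<noteq> v2" "v0 \<noteq> v2"
    and H: "\<And>F. height F \<Longrightarrow> F v1 - F v0 \<in> {1, -2} \<and> F v2 - F v1 \<in> {1, -2} \<and> F v0 - F v2 \<in> {1, -2}"
    using height_triangle[OF t(1)] by metis
  have "v0 \<in> t" "v1 \<in> t" "v2 \<in> t" unfolding v(1) by simp_all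
  then obtain u0 u1 u2 where u: "v0 = Xvertex u0" "v1 = Xvertex u1" "v2 = Xvertex u2"
    using triangle_vertex[OF t(1)] by metis
  define F where "F = (\<lambda>u v. 0 - vdist u v)"
  have hF: "height (F u)" for u unfolding F_def by (rule height_vdist)
  have F0: "F u0 v0 = 0" "F u1 v1 = 0" "F u2 v2 = 0" by (simp_all add: F_def u vdist_Xvertex)
  have Fle: "F u v \<le> 0" for u v using vdist_nonneg[of u v] by (simp add: F_def)
  have F1: "F u0 v1 = -2" "F u0 v2 = -1"
    using H[OF hF, of u0] F0(1) Fle[of u0 v1] Fle[of u0 v2] by auto
  have F2: "F u1 v2 = -2" "F u1 v0 = -1"
    using H[OF hF, of u1] F0(2) Fle[of u1 v2] Fle[of u1 v0] by auto
  have F3: "F u2 v0 = -2" "F u2 v1 = -1"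
    using H[OF hF, of u2] F0(3) Fle[of u2 v0] Fle[of u2 v1] by auto
  define x0 x1 x2 where "x0 = p v0 - q v0" and "x1 = p v1 - q v1" and "x2 = p v2 - q v2"
  have x0: "x0 = - x1 - x2"
    using Xpoints_sum[OF assms(1) fin t(2)] Xpoints_sum[OF assms(2) fin t(3)] v
    by (simp add: sum3 x0_def x1_def x2_def)
  have affd: "aff K p - aff K q = x0 * K v0 + x1 * K v1 + x2 * K v2" for K
    using v by (simp add: aff_on[OF fin t(2)] aff_on[OF fin t(3)] sum3 x0_def x1_def x2_def algebra_simps)
  have "(- 2 * x1 - x2)\<^sup>2 + (- x0 - 2 * x2)\<^sup>2 + (- 2 * x0 - x1)\<^sup>2 \<le> 6 * (Xdist p q)\<^sup>2"
    by (rule Xdist_lower[OF hF hF hF assms(1,2), of _ u0 _ u1 _ u2]) (simp_all add: affd F0 F1 F2 F3 x0)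
  then have "x1\<^sup>2 + x1 * x2 + x2\<^sup>2 \<le> (Xdist p q)\<^sup>2"
    by (simp add: x0 power2_eq_square algebra_simps)
  moreover have "(local_dist p q)\<^sup>2 = x1\<^sup>2 + x1 * x2 + x2\<^sup>2"
    using v by (simp add: local_dist_on[OF fin t(2,3)] sum3 x0_def[symmetric] x1_def[symmetric] x2_def[symmetric])
      (simp add: x0 power2_eq_square algebra_simps)
  ultimately have "(local_dist p q)\<^sup>2 \<le> (Xdist p q)\<^sup>2" by simp
  then show "local_dist p q \<le> Xdist p q"
    by (rule power2_le_imp_le) (rule Xdist_nonneg[OF assms(1,2)])
qed

section \<open>Rigidity of flats\<close>

definition bpt :: "word set \<Rightarrow> word set \<Rightarrow> word set \<Rightarrow> real \<Rightarrow> real \<Rightarrow> real \<Rightarrow> point" where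
  "bpt v0 v1 v2 b0 b1 b2 = (\<lambda>v. (if v = v0 then b0 else 0) + (if v = v1 then b1 else 0) + (if v = v2 then b2 else 0))"

definition cpt :: "complex \<Rightarrow> complex \<Rightarrow> complex \<Rightarrow> real \<Rightarrow> real \<Rightarrow> real \<Rightarrow> complex" where
  "cpt z0 z1 z2 b0 b1 b2 = of_real b0 * z0 + of_real b1 * z1 + of_real b2 * z2"

definition bary :: "real \<Rightarrow> real \<Rightarrow> real \<Rightarrow> bool" where
  "bary b0 b1 b2 \<longleftrightarrow> 0 \<le> b0 \<and> 0 \<le> b1 \<and> 0 \<le> b2 \<and> b0 + b1 + b2 = 1"

definition unit_tri :: "complex \<Rightarrow> complex \<Rightarrow> complex \<Rightarrow> bool" where
  "unit_tri z0 z1 z2 \<longleftrightarrow> dist z0 z1 = 1 \<and> dist z0 z2 = 1 \<and> dist z1 z2 = 1"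

definition Xtri :: "word set \<Rightarrow> word set \<Rightarrow> word set \<Rightarrow> bool" where
  "Xtri v0 v1 v2 \<longleftrightarrow> {v0, v1, v2} \<in> Xtriangles \<and> v0 \<noteq> v1 \<and> v1 \<noteq> v2 \<and> v0 \<noteq> v2"

lemma card_triangle: "t \<in> Xtriangles \<Longrightarrow> card t = 3"
proof -
  assume "t \<in> Xtriangles"
  then obtain v0 v1 v2 where v: "t = {v0, v1, v2}" "v0 \<noteq> v1" "v1 \<noteq> v2" "v0 \<noteq> v2"
    by (rule height_triangle)
  show ?thesis unfolding v(1) using v(2-4) by simp
qed

lemma Xtri_iff: "Xtri v0 v1 v2 \<longleftrightarrow> {v0, v1, v2} \<in> Xtriangles"
proof
  assume t: "{v0, v1, v2} \<in> Xtriangles"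
  have "card {v0, v1, v2} = 3" using card_triangle[OF t] .
  then have "v0 \<noteq> v1 \<and> v1 \<noteq> v2 \<and> v0 \<noteq> v2" by (simp add: card_insert_if split: if_splits)
  then show "Xtri v0 v1 v2" using t by (simp add: Xtri_def)
qed (simp add: Xtri_def)

lemma bpt_simps:
  assumes "Xtri v0 v1 v2"
  shows "bpt v0 v1 v2 b0 b1 b2 v0 = b0" "bpt v0 v1 v2 b0 b1 b2 v1 = b1" "bpt v0 v1 v2 b0 b1 b2 v2 = b2"
  using assms by (auto simp: Xtri_def bpt_def)

lemma supp_bpt: "supp (bpt v0 v1 v2 b0 b1 b2) \<subseteq> {v0, v1, v2}"
  by (auto simp: supp_def bpt_def split: if_splits)

lemma bpt_Xpoints:
  assumes "Xtri v0 v1 v2" "bary b0 b1 b2"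
  shows "bpt v0 v1 v2 b0 b1 b2 \<in> Xpoints"
proof -
  have "(\<Sum>v\<in>{v0, v1, v2}. bpt v0 v1 v2 b0 b1 b2 v) = 1"
    using assms bpt_simps[OF assms(1)] by (simp add: sum3 Xtri_def bary_def)
  moreover have "0 \<le> bpt v0 v1 v2 b0 b1 b2 v" for v using assms(2) by (simp add: bpt_def bary_def)
  moreover have "{v0, v1, v2} \<in> Xtriangles" using assms(1) by (simp add: Xtri_def)
  ultimately show ?thesis unfolding Xpoints_def mem_Collect_eq
    by (intro bexI[of _ "{v0, v1, v2}"] conjI allI supp_bpt)
qed

lemma bpt_of_point:
  assumes "Xtri v0 v1 v2" "p \<in> Xpoints" "supp p \<subseteq> {v0, v1, v2}"
  shows "bary (p v0) (p v1) (p v2)" "p = bpt v0 v1 v2 (p v0) (p v1) (p v2)"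
proof -
  have "(\<Sum>v\<in>{v0, v1, v2}. p v) = 1" using Xpoints_sum[OF assms(2) _ assms(3)] by simp
  moreover have "0 \<le> p v" for v using assms(2) by (auto simp: Xpoints_def)
  ultimately show "bary (p v0) (p v1) (p v2)" using assms(1) by (simp add: sum3 Xtri_def bary_def)
  show "p = bpt v0 v1 v2 (p v0) (p v1) (p v2)"
  proof
    fix v
    show "p v = bpt v0 v1 v2 (p v0) (p v1) (p v2) v"
    proof (cases "v \<in> {v0, v1, v2}")
      case True
      then show ?thesis using bpt_simps[OF assms(1)] by (elim insertE) simp_all
    next
      case False
      then have "p v = 0" using assms(3) by (auto simp: supp_def)
      then show ?thesis using False by (simp add: bpt_def)
    qed
  qed
qed

lemma bpt_vertex: "bpt v0 v1 v2 1 0 0 = vertex_point v0" "bpt v0 v1 v2 0 1 0 = vertex_point v1"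
  "bpt v0 v1 v2 0 0 1 = vertex_point v2"
  by (auto simp: bpt_def vertex_point_def)

lemma bpt_rotate: "bpt v0 v1 v2 b0 b1 b2 = bpt v1 v2 v0 b1 b2 b0"
  by (auto simp: bpt_def)

lemma Xdist_bpt:
  assumes "Xtri v0 v1 v2" "bary b0 b1 b2" "bary c0 c1 c2"
  shows "(Xdist (bpt v0 v1 v2 b0 b1 b2) (bpt v0 v1 v2 c0 c1 c2))\<^sup>2
    = (b1 - c1)\<^sup>2 + (b1 - c1) * (b2 - c2) + (b2 - c2)\<^sup>2"
proof -
  have cell: "same_cell (bpt v0 v1 v2 b0 b1 b2) (bpt v0 v1 v2 c0 c1 c2)"
    using assms(1) unfolding same_cell_def Xtri_def by (intro bexI[of _ "{v0, v1, v2}"] conjI supp_bpt) simp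
  have bc: "b0 - c0 = - (b1 - c1) - (b2 - c2)" using assms by (simp add: bary_def)
  have hex: "(1/2) * ((b0 - c0)\<^sup>2 + (b1 - c1)\<^sup>2 + (b2 - c2)\<^sup>2) = (b1 - c1)\<^sup>2 + (b1 - c1) * (b2 - c2) + (b2 - c2)\<^sup>2"
    unfolding bc by (simp add: power2_eq_square algebra_simps)
  have dist: "Xdist (bpt v0 v1 v2 b0 b1 b2) (bpt v0 v1 v2 c0 c1 c2) = sqrt ((1/2) * ((b0 - c0)\<^sup>2 + (b1 - c1)\<^sup>2 + (b2 - c2)\<^sup>2))"
    using assms(1) Xdist_same_cell[OF bpt_Xpoints[OF assms(1,2)] bpt_Xpoints[OF assms(1,3)] cell]
    by (simp add: local_dist_on[OF _ supp_bpt supp_bpt] sum3 bpt_simps Xtri_def)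
  have "0 \<le> (1/2) * ((b0 - c0)\<^sup>2 + (b1 - c1)\<^sup>2 + (b2 - c2)\<^sup>2)" by simp
  then show ?thesis unfolding dist hex by simp
qed

lemma cmod_hex:
  assumes "cmod a = 1" "cmod b = 1" "cmod (a - b) = 1"
  shows "(cmod (of_real x * a + of_real y * b))\<^sup>2 = x\<^sup>2 + x * y + y\<^sup>2"
proof -
  have a: "(Re a)\<^sup>2 + (Im a)\<^sup>2 = 1" "(Re b)\<^sup>2 + (Im b)\<^sup>2 = 1" "(Re a - Re b)\<^sup>2 + (Im a - Im b)\<^sup>2 = 1"
    using assms by (simp_all add: cmod_def)
  then have ab: "2 * (Re a * Re b + Im a * Im b) = 1" by (simp add: power2_eq_square algebra_simps)
  have "(cmod (of_real x * a + of_real y * b))\<^sup>2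
     = x\<^sup>2 * ((Re a)\<^sup>2 + (Im a)\<^sup>2) + x * y * (2 * (Re a * Re b + Im a * Im b)) + y\<^sup>2 * ((Re b)\<^sup>2 + (Im b)\<^sup>2)"
    unfolding cmod_power2 by (simp add: power2_eq_square algebra_simps)
  then show ?thesis using a ab by simp
qed

lemma dist_cpt:
  assumes "unit_tri z0 z1 z2" "bary b0 b1 b2" "bary c0 c1 c2"
  shows "(dist (cpt z0 z1 z2 b0 b1 b2) (cpt z0 z1 z2 c0 c1 c2))\<^sup>2
    = (b1 - c1)\<^sup>2 + (b1 - c1) * (b2 - c2) + (b2 - c2)\<^sup>2"
proof -
  have b: "b0 = 1 - b1 - b2" "c0 = 1 - c1 - c2" using assms by (auto simp: bary_def)
  have "cpt z0 z1 z2 b0 b1 b2 - cpt z0 z1 z2 c0 c1 c2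
      = of_real (b1 - c1) * (z1 - z0) + of_real (b2 - c2) * (z2 - z0)"
    by (simp add: b cpt_def algebra_simps)
  moreover have "cmod (z1 - z0) = 1" "cmod (z2 - z0) = 1" "cmod ((z1 - z0) - (z2 - z0)) = 1"
    using assms(1) by (simp_all add: unit_tri_def dist_norm norm_minus_commute)
  ultimately show ?thesis
    using cmod_hex[of "z1 - z0" "z2 - z0" "b1 - c1" "b2 - c2"] by (simp only: dist_norm)
qed

lemma Xdist_bpt_eq_dist:
  assumes "Xtri v0 v1 v2" "unit_tri z0 z1 z2" "bary b0 b1 b2" "bary c0 c1 c2"
  shows "Xdist (bpt v0 v1 v2 b0 b1 b2) (bpt v0 v1 v2 c0 c1 c2) = dist (cpt z0 z1 z2 b0 b1 b2) (cpt z0 z1 z2 c0 c1 c2)"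
  by (rule power2_eq_imp_eq)
     (simp_all add: Xdist_bpt assms dist_cpt Xdist_nonneg bpt_Xpoints)

text \<open>The three coordinates stay positive at q, and a triangle that contains all three
  vertices is the given one.\<close>

lemma near_interior:
  assumes "Xtri v0 v1 v2" "p \<in> Xpoints" "q \<in> Xpoints"
    and "sqrt 2 * Xdist p q < p v0" "sqrt 2 * Xdist p q < p v1" "sqrt 2 * Xdist p q < p v2"
  shows "supp q \<subseteq> {v0, v1, v2}"
proof -
  obtain t where t: "t \<in> Xtriangles" "supp q \<subseteq> t" using assms(3) by (auto simp: Xpoints_def)
  have "0 < q v0" "0 < q v1" "0 < q v2"
    using coordinate_lipschitz[OF assms(2,3), of v0] coordinate_lipschitz[OF assms(2,3), of v1]
      coordinate_lipschitz[OF assms(2,3), of v2] assms(4-6) by linarith+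
  then have "{v0, v1, v2} \<subseteq> supp q" by (simp add: supp_def)
  then have sub: "{v0, v1, v2} \<subseteq> t" using t(2) by (rule subset_trans)
  have "card {v0, v1, v2} = card t" using card_triangle t(1) assms(1) by (simp add: Xtri_def)
  then have "{v0, v1, v2} = t" using card_subset_eq[OF Xtriangles_finite[OF t(1)] sub] by simp
  then show ?thesis using t(2) by simp
qed

text \<open>A continuity argument: while the image is in the triangle, \<open>locate\<close> gives
  its exact position, and by \<open>near_interior\<close> it cannot leave from an interior position
  in one small step. Interior points are reached along a segment from the start, boundary points as
  limits of interior ones.\<close>

lemma fill_triangle:
  fixes \<phi> :: "complex \<Rightarrow> point"
  assumes X: "\<And>u. \<phi> u \<in> Xpoints" and iso: "\<And>u v. Xdist (\<phi> u) (\<phi> v) = dist u v"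
    and tri: "Xtri v0 v1 v2" "unit_tri z0 z1 z2"
    and locate: "\<And>b0 b1 b2. bary b0 b1 b2 \<Longrightarrow> supp (\<phi> (cpt z0 z1 z2 b0 b1 b2)) \<subseteq> {v0, v1, v2} \<Longrightarrow>
        \<phi> (cpt z0 z1 z2 b0 b1 b2) = bpt v0 v1 v2 b0 b1 b2"
    and start: "bary s0 s1 s2" "0 < s0" "0 < s1" "0 < s2" "supp (\<phi> (cpt z0 z1 z2 s0 s1 s2)) \<subseteq> {v0, v1, v2}"
    and b: "bary b0 b1 b2"
  shows "\<phi> (cpt z0 z1 z2 b0 b1 b2) = bpt v0 v1 v2 b0 b1 b2"
proof -
  let ?c = "cpt z0 z1 z2" and ?b = "bpt v0 v1 v2" and ?T = "{v0, v1, v2}"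
  have int: "\<phi> (?c b0 b1 b2) = ?b b0 b1 b2"
    if b: "bary b0 b1 b2" and pos: "0 < b0" "0 < b1" "0 < b2" for b0 b1 b2
  proof -
    define g0 g1 g2 where "g0 = (\<lambda>x. (1 - x) * s0 + x * b0)" and "g1 = (\<lambda>x. (1 - x) * s1 + x * b1)"
      and "g2 = (\<lambda>x. (1 - x) * s2 + x * b2)"
    define c where "c = (\<lambda>x. ?c (g0 x) (g1 x) (g2 x))"
    define D where "D = dist (?c s0 s1 s2) (?c b0 b1 b2)"
    define m where "m = min (min (min s0 s1) s2) (min (min b0 b1) b2)"
    have m: "0 < m" "m \<le> s0" "m \<le> s1" "m \<le> s2" "m \<le> b0" "m \<le> b1" "m \<le> b2"
      using start pos by (auto simp: m_def)
    have ge: "m \<le> (1 - x) * s + x * y" if "0 \<le> x" "x \<le> 1" "m \<le> s" "m \<le> y" for x s y :: real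
    proof -
      have "m = (1 - x) * m + x * m" by (simp add: algebra_simps)
      also have "\<dots> \<le> (1 - x) * s + x * y" using that by (intro add_mono mult_left_mono) auto
      finally show ?thesis .
    qed
    have g: "m \<le> g0 x" "m \<le> g1 x" "m \<le> g2 x" if "0 \<le> x" "x \<le> 1" for x
      using that m ge by (auto simp: g0_def g1_def g2_def)
    have s1: "s0 = 1 - s1 - s2" "b0 = 1 - b1 - b2" using start(1) b by (auto simp: bary_def)
    have gb: "bary (g0 x) (g1 x) (g2 x)" if "0 \<le> x" "x \<le> 1" for x
    proof -
      have "g0 x + g1 x + g2 x = 1" by (simp add: g0_def g1_def g2_def s1 algebra_simps)
      then show ?thesis using g[OF that] m(1) by (simp add: bary_def)
    qed
    have dc: "dist (c x) (c y) = \<bar>x - y\<bar> * D" for x y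
    proof -
      have "c x - c y = of_real (y - x) * (?c s0 s1 s2 - ?c b0 b1 b2)"
        by (simp add: c_def cpt_def g0_def g1_def g2_def algebra_simps)
      then show ?thesis by (simp add: dist_norm D_def norm_mult abs_minus_commute flip: of_real_diff)
    qed
    \<comment> \<open>All coordinates along the segment are at least m, and a parameter step below
      this bound moves the image by less than m / sqrt 2.\<close>
    define \<epsilon> where "\<epsilon> = m / (sqrt 2 * D + 1)"
    have D0: "0 \<le> D" by (simp add: D_def)
    then have den: "0 < sqrt 2 * D + 1" by (simp add: add_nonneg_pos)
    have eps: "0 < \<epsilon>" using m(1) den by (simp add: \<epsilon>_def)
    have step: "supp (\<phi> (c y)) \<subseteq> ?T"
      if "supp (\<phi> (c x)) \<subseteq> ?T" "0 \<le> x" "x \<le> 1" "\<bar>x - y\<bar> < \<epsilon>" for x y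
    proof -
      have e: "\<phi> (c x) = ?b (g0 x) (g1 x) (g2 x)"
        unfolding c_def by (rule locate[OF gb[OF that(2,3)]]) (use that(1) in \<open>simp add: c_def\<close>)
      have "sqrt 2 * (\<bar>x - y\<bar> * D) \<le> \<bar>x - y\<bar> * (sqrt 2 * D + 1)" by (simp add: algebra_simps)
      also have "\<dots> < m" using that(4) den by (simp add: \<epsilon>_def pos_less_divide_eq)
      finally have "sqrt 2 * Xdist (\<phi> (c x)) (\<phi> (c y)) < m" by (simp add: iso dc)
      moreover have "m \<le> \<phi> (c x) v0" "m \<le> \<phi> (c x) v1" "m \<le> \<phi> (c x) v2"
        unfolding e bpt_simps[OF tri(1)] by (rule g[OF that(2,3)])+
      ultimately show ?thesis
        by (intro near_interior[OF tri(1) X[of "c x"] X[of "c y"]]) linarith+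
    qed
    have "supp (\<phi> (c 0)) \<subseteq> ?T \<longrightarrow> supp (\<phi> (c 1)) \<subseteq> ?T"
    proof -
      have "0 \<le> (0::real) \<and> (1::real) \<le> 1 \<longrightarrow> supp (\<phi> (c 0)) \<subseteq> ?T \<longrightarrow> supp (\<phi> (c 1)) \<subseteq> ?T"
      proof (rule Bolzano[where P = "\<lambda>x y. 0 \<le> x \<and> y \<le> 1 \<longrightarrow> supp (\<phi> (c x)) \<subseteq> ?T \<longrightarrow> supp (\<phi> (c y)) \<subseteq> ?T"])
        fix x y z :: real
        assume "0 \<le> x \<and> y \<le> 1 \<longrightarrow> supp (\<phi> (c x)) \<subseteq> ?T \<longrightarrow> supp (\<phi> (c y)) \<subseteq> ?T"
          "0 \<le> y \<and> z \<le> 1 \<longrightarrow> supp (\<phi> (c y)) \<subseteq> ?T \<longrightarrow> supp (\<phi> (c z)) \<subseteq> ?T" "x \<le> y" "y \<le> z"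
        then show "0 \<le> x \<and> z \<le> 1 \<longrightarrow> supp (\<phi> (c x)) \<subseteq> ?T \<longrightarrow> supp (\<phi> (c z)) \<subseteq> ?T" by auto
      next
        fix x :: real
        show "\<exists>d>0. \<forall>a b. a \<le> x \<and> x \<le> b \<and> b - a < d \<longrightarrow>
            0 \<le> a \<and> b \<le> 1 \<longrightarrow> supp (\<phi> (c a)) \<subseteq> ?T \<longrightarrow> supp (\<phi> (c b)) \<subseteq> ?T"
          using step eps by (intro exI[of _ \<epsilon>]) auto
      qed simp
      then show ?thesis by simp
    qed
    moreover have "c 0 = ?c s0 s1 s2" "c 1 = ?c b0 b1 b2"
      by (simp_all add: c_def g0_def g1_def g2_def)
    ultimately show ?thesis using start(5) locate[OF b] by simp
  qed
  define C where "C = dist (?c b0 b1 b2) (?c (1/3) (1/3) (1/3))"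
  \<comment> \<open>A shift by the fraction e towards the barycentre reaches an interior point at
    distance e C, both in the plane and in X.\<close>
  have bound: "Xdist (\<phi> (?c b0 b1 b2)) (?b b0 b1 b2) \<le> 2 * (e * C)" if e: "0 < e" "e \<le> 1" for e
  proof -
    define d0 d1 d2 where "d0 = (1 - e) * b0 + e * (1/3)" and "d1 = (1 - e) * b1 + e * (1/3)" and "d2 = (1 - e) * b2 + e * (1/3)"
    have pos: "0 < d0" "0 < d1" "0 < d2" using e b by (auto simp: d0_def d1_def d2_def bary_def add_nonneg_pos)
    have "d0 + d1 + d2 = (1 - e) * (b0 + b1 + b2) + e" by (simp add: d0_def d1_def d2_def algebra_simps)
    then have "d0 + d1 + d2 = 1" using b by (simp add: bary_def)
    then have d: "bary d0 d1 d2" using pos by (simp add: bary_def)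
    have "?c b0 b1 b2 - ?c d0 d1 d2 = of_real e * (?c b0 b1 b2 - ?c (1/3) (1/3) (1/3))"
      by (simp add: cpt_def d0_def d1_def d2_def algebra_simps)
    then have dd: "dist (?c b0 b1 b2) (?c d0 d1 d2) = e * C"
      using e by (simp add: dist_norm C_def norm_mult)
    have "Xdist (\<phi> (?c b0 b1 b2)) (?b b0 b1 b2)
       \<le> Xdist (\<phi> (?c b0 b1 b2)) (\<phi> (?c d0 d1 d2)) + Xdist (\<phi> (?c d0 d1 d2)) (?b b0 b1 b2)"
      by (rule Xdist_triangle) (simp_all add: X bpt_Xpoints tri b)
    also have "Xdist (\<phi> (?c d0 d1 d2)) (?b b0 b1 b2) = e * C"
      unfolding int[OF d pos] Xdist_bpt_eq_dist[OF tri d b] using dd by (simp add: dist_commute)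
    also have "Xdist (\<phi> (?c b0 b1 b2)) (\<phi> (?c d0 d1 d2)) = e * C"
      unfolding iso by (rule dd)
    also have "e * C + e * C = 2 * (e * C)" by simp
    finally show ?thesis .
  qed
  have C0: "0 \<le> C" by (simp add: C_def)
  have "Xdist (\<phi> (?c b0 b1 b2)) (?b b0 b1 b2) \<le> 0"
  proof (rule field_le_epsilon)
    fix e :: real assume e: "0 < e"
    define e' where "e' = min 1 (e / (2 * C + 1))"
    have C1: "0 < 2 * C + 1" using C0 by simp
    then have "0 < e'" "e' \<le> 1" "e' \<le> e / (2 * C + 1)" using e by (simp_all add: e'_def)
    moreover from this have "e' * (2 * C + 1) \<le> e" using pos_le_divide_eq[OF C1] by blast
    ultimately have "2 * (e' * C) \<le> e" by (simp add: algebra_simps)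
    then show "Xdist (\<phi> (?c b0 b1 b2)) (?b b0 b1 b2) \<le> 0 + e"
      using bound[OF \<open>0 < e'\<close> \<open>e' \<le> 1\<close>] by simp
  qed
  then show ?thesis
    using Xdist_zero[OF X bpt_Xpoints[OF tri(1) b]] Xdist_nonneg[OF X bpt_Xpoints[OF tri(1) b]] by (simp add: antisym)
qed

lemma cpt_vertex: "cpt z0 z1 z2 1 0 0 = z0" "cpt z0 z1 z2 0 1 0 = z1" "cpt z0 z1 z2 0 0 1 = z2"
  by (simp_all add: cpt_def)

text \<open>The equation of trilateration: original and image have the same distance to an anchor
  whose image is known, and both distances are the same quadratic form in barycentric
  coordinates.\<close>

lemma anchor_dist:
  fixes \<phi> :: "complex \<Rightarrow> point"
  assumes X: "\<And>u. \<phi> u \<in> Xpoints" and iso: "\<And>u v. Xdist (\<phi> u) (\<phi> v) = dist u v"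
    and tri: "Xtri v0 v1 v2" "unit_tri z0 z1 z2" and b: "bary b0 b1 b2"
    and supp: "supp (\<phi> (cpt z0 z1 z2 b0 b1 b2)) \<subseteq> {v0, v1, v2}"
    and p: "p = \<phi> (cpt z0 z1 z2 b0 b1 b2)"
    and a: "bary a0 a1 a2" "\<phi> (cpt z0 z1 z2 a0 a1 a2) = bpt v0 v1 v2 a0 a1 a2"
  shows "(b1 - a1)\<^sup>2 + (b1 - a1) * (b2 - a2) + (b2 - a2)\<^sup>2
    = (p v1 - a1)\<^sup>2 + (p v1 - a1) * (p v2 - a2) + (p v2 - a2)\<^sup>2"
proof -
  note pb = bpt_of_point[OF tri(1) X supp, folded p]
  have 1: "Xdist p (bpt v0 v1 v2 a0 a1 a2) = dist (cpt z0 z1 z2 b0 b1 b2) (cpt z0 z1 z2 a0 a1 a2)"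
    unfolding p a(2)[symmetric] by (rule iso)
  have 2: "(Xdist p (bpt v0 v1 v2 a0 a1 a2))\<^sup>2 = (p v1 - a1)\<^sup>2 + (p v1 - a1) * (p v2 - a2) + (p v2 - a2)\<^sup>2"
    using Xdist_bpt[OF tri(1) pb(1) a(1)] unfolding pb(2)[symmetric] .
  show ?thesis using dist_cpt[OF tri(2) b a(1)] unfolding 1[symmetric] 2 by (rule HOL.sym)
qed

text \<open>The corner and the two points at distance e along its edges are three anchors that are
  not collinear; differences of their equations are linear and determine the position.\<close>

lemma fill_from_corner:
  fixes \<phi> :: "complex \<Rightarrow> point"
  assumes X: "\<And>u. \<phi> u \<in> Xpoints" and iso: "\<And>u v. Xdist (\<phi> u) (\<phi> v) = dist u v"
    and tri: "Xtri v0 v1 v2" "unit_tri z0 z1 z2"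
    and e: "0 < e" "e < 1"
    and known: "\<And>b0 b1 b2. bary b0 b1 b2 \<Longrightarrow> 1 - e \<le> b0 \<Longrightarrow> \<phi> (cpt z0 z1 z2 b0 b1 b2) = bpt v0 v1 v2 b0 b1 b2"
    and b: "bary b0 b1 b2"
  shows "\<phi> (cpt z0 z1 z2 b0 b1 b2) = bpt v0 v1 v2 b0 b1 b2"
proof (rule fill_triangle[OF X iso tri _ _ _ _ _ _ b])
  have s: "bary (1 - e) (e / 2) (e / 2)" using e by (simp add: bary_def)
  then show "bary (1 - e) (e / 2) (e / 2)" .
  show "supp (\<phi> (cpt z0 z1 z2 (1 - e) (e / 2) (e / 2))) \<subseteq> {v0, v1, v2}"
    using known[OF s] supp_bpt by simp
next
  fix b0 b1 b2 assume b: "bary b0 b1 b2" and supp: "supp (\<phi> (cpt z0 z1 z2 b0 b1 b2)) \<subseteq> {v0, v1, v2}"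
  define p where "p = \<phi> (cpt z0 z1 z2 b0 b1 b2)"
  note A = anchor_dist[OF X iso tri b supp p_def]
  have a: "bary 1 0 0" "bary (1 - e) e 0" "bary (1 - e) 0 e" using e by (auto simp: bary_def)
  have 0: "b1\<^sup>2 + b1 * b2 + b2\<^sup>2 = (p v1)\<^sup>2 + p v1 * p v2 + (p v2)\<^sup>2"
    using A[OF a(1) known[OF a(1)]] e by simp
  have 1: "(b1 - e)\<^sup>2 + (b1 - e) * b2 + b2\<^sup>2 = (p v1 - e)\<^sup>2 + (p v1 - e) * p v2 + (p v2)\<^sup>2"
    using A[OF a(2) known[OF a(2)]] e by simp
  have 2: "b1\<^sup>2 + b1 * (b2 - e) + (b2 - e)\<^sup>2 = (p v1)\<^sup>2 + p v1 * (p v2 - e) + (p v2 - e)\<^sup>2"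
    using A[OF a(3) known[OF a(3)]] e by simp
  have "e * (2 * b1 + b2) = e * (2 * p v1 + p v2)" using 0 1 by (simp add: power2_eq_square algebra_simps)
  moreover have "e * (b1 + 2 * b2) = e * (p v1 + 2 * p v2)" using 0 2 by (simp add: power2_eq_square algebra_simps)
  ultimately have b12: "b1 = p v1" "b2 = p v2" using e by simp_all
  note pb = bpt_of_point[OF tri(1) X supp, folded p_def]
  have b0: "b0 = p v0" using b pb(1) b12 by (simp add: bary_def)
  show "\<phi> (cpt z0 z1 z2 b0 b1 b2) = bpt v0 v1 v2 b0 b1 b2"
    unfolding p_def[symmetric] unfolding b0 b12 by (rule pb(2))
qed (use e in auto)

text \<open>A flat that contains an edge must continue across it. With the end points as anchors a
  position is known up to reflection in the edge, and nonnegative barycentric coordinates exclude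
  the reflection.\<close>

lemma cross_edge:
  fixes \<phi> :: "complex \<Rightarrow> point"
  assumes X: "\<And>u. \<phi> u \<in> Xpoints" and iso: "\<And>u v. Xdist (\<phi> u) (\<phi> v) = dist u v"
    and z: "unit_tri z0 z1 z2" and v01: "v0 \<noteq> v1"
    and ends: "\<phi> z0 = vertex_point v0" "\<phi> z1 = vertex_point v1"
    and mid: "\<phi> ((z0 + z1) / 2) v0 = 1/2" "\<phi> ((z0 + z1) / 2) v1 = 1/2"
  shows "\<exists>v2. Xtri v0 v1 v2 \<and> \<phi> z2 = vertex_point v2"
proof -
  \<comment> \<open>A point of the new triangle at distance sqrt 3 / 10 from the midpoint of the
    edge: its image keeps positive weight on v0 and v1, so it lies in some triangle on this
    edge.\<close>
  define y where "y = cpt z0 z1 z2 (2/5) (2/5) (1/5)"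
  have m: "(z0 + z1) / 2 = cpt z0 z1 z2 (1/2) (1/2) 0" by (simp add: cpt_def)
  have ba: "bary (1/2) (1/2) 0" "bary (2/5) (2/5) (1/5)" by (auto simp: bary_def)
  have "(dist ((z0 + z1) / 2) y)\<^sup>2 = 3/100"
    unfolding y_def m by (subst dist_cpt[OF z ba]) (simp add: power2_eq_square)
  then have "(sqrt 2 * dist ((z0 + z1) / 2) y)\<^sup>2 = 6/100" by (simp add: power_mult_distrib)
  then have "(sqrt 2 * dist ((z0 + z1) / 2) y)\<^sup>2 < (1/2)\<^sup>2" by (simp add: power2_eq_square)
  then have d: "sqrt 2 * Xdist (\<phi> ((z0 + z1) / 2)) (\<phi> y) < 1/2"
    unfolding iso by (rule power2_less_imp_less) simp
  have pos: "0 < \<phi> y v0" "0 < \<phi> y v1"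
    using coordinate_lipschitz[OF X X, of "(z0 + z1) / 2" v0 y] coordinate_lipschitz[OF X X, of "(z0 + z1) / 2" v1 y] d mid by linarith+
  obtain t where t: "t \<in> Xtriangles" "supp (\<phi> y) \<subseteq> t" using X[of y] by (auto simp: Xpoints_def)
  have "{v0, v1} \<subseteq> supp (\<phi> y)" using pos by (simp add: supp_def)
  then have v01t: "{v0, v1} \<subseteq> t" using t(2) by (rule subset_trans)
  have "card (t - {v0, v1}) = 1"
    using card_Diff_subset[OF _ v01t] card_triangle[OF t(1)] v01 by simp
  then obtain v2 where v2: "t - {v0, v1} = {v2}" by (rule card_1_singletonE)
  have "t = {v0, v1} \<union> (t - {v0, v1})" using v01t by blast
  then have tt: "t = {v0, v1, v2}" unfolding v2 by (simp only: Un_insert_left Un_empty_left)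
  then have tri: "Xtri v0 v1 v2" using t(1) Xtri_iff by simp
  have "\<phi> (cpt z0 z1 z2 0 0 1) = bpt v0 v1 v2 0 0 1"
  proof (rule fill_triangle[OF X iso tri z _ ba(2)])
    show "supp (\<phi> (cpt z0 z1 z2 (2/5) (2/5) (1/5))) \<subseteq> {v0, v1, v2}" using t(2) tt by (simp add: y_def)
  next
    fix b0 b1 b2 assume b: "bary b0 b1 b2" and supp: "supp (\<phi> (cpt z0 z1 z2 b0 b1 b2)) \<subseteq> {v0, v1, v2}"
    define p where "p = \<phi> (cpt z0 z1 z2 b0 b1 b2)"
    note A = anchor_dist[OF X iso tri z b supp p_def]
    note pb = bpt_of_point[OF tri X supp, folded p_def]
    have a: "bary 1 0 0" "bary 0 1 0" by (auto simp: bary_def)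
    have 0: "b1\<^sup>2 + b1 * b2 + b2\<^sup>2 = (p v1)\<^sup>2 + p v1 * p v2 + (p v2)\<^sup>2"
      using A[OF a(1)] ends by (simp add: cpt_vertex bpt_vertex)
    have 1: "(b1 - 1)\<^sup>2 + (b1 - 1) * b2 + b2\<^sup>2 = (p v1 - 1)\<^sup>2 + (p v1 - 1) * p v2 + (p v2)\<^sup>2"
      using A[OF a(2)] ends by (simp add: cpt_vertex bpt_vertex)
    have k: "2 * b1 + b2 = 2 * p v1 + p v2" using 0 1 by (simp add: power2_eq_square algebra_simps)
    have q: "4 * (x\<^sup>2 + x * y + y\<^sup>2) = (2 * x + y)\<^sup>2 + 3 * y\<^sup>2" for x y :: real by (simp add: power2_eq_square algebra_simps)
    have "b2\<^sup>2 = (p v2)\<^sup>2" using 0 k q[of b1 b2] q[of "p v1" "p v2"] by simp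
    then have b2: "b2 = p v2" using b pb(1) by (simp add: bary_def)
    have b1: "b1 = p v1" using k b2 by simp
    have b0: "b0 = p v0" using b pb(1) b1 b2 by (simp add: bary_def)
    show "\<phi> (cpt z0 z1 z2 b0 b1 b2) = bpt v0 v1 v2 b0 b1 b2"
      unfolding p_def[symmetric] unfolding b0 b1 b2 by (rule pb(2))
  qed (auto simp: bary_def)
  then show ?thesis using tri unfolding cpt_vertex bpt_vertex by (intro exI conjI)
qed

section \<open>Flat regions with a singular corner\<close>

text \<open>Below the corner the region is a pile of strips between horizontal lines with constant labels \<open>row_lab\<close>;
  \<open>strip_lab\<close> labels the edges that cross a strip downwards and \<open>diag_lab\<close> is the coatom of its diagonals. Strips
  come in blocks of three, and the bit \<open>bs i\<close> selects the block \<open>i\<close>. Unlike a block with bit \<open>True\<close>, which returns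
  to its label, a block with bit \<open>False\<close> leads from a line with label \<open>y\<close> to one with label \<open>phi y\<close>: \<open>gauge\<close> counts these.\<close>

primrec gauge :: "(nat \<Rightarrow> bool) \<Rightarrow> nat \<Rightarrow> nat" where
  "gauge bs 0 = 0" | "gauge bs (Suc i) = gauge bs i + (if bs i then 0 else 1)"

definition strip_tab :: "bool \<Rightarrow> nat \<Rightarrow> gen" where
  "strip_tab x r = (if x then (if r = 0 then Gd else if r = 1 then Ga else Gf)
                    else (if r = 0 then Gc else if r = 1 then Ge else Ga))"

definition row_tab :: "bool \<Rightarrow> nat \<Rightarrow> gen" where
  "row_tab x r = (if x then (if r = 0 then Ga else if r = 1 then Gf else Gd)
                  else (if r = 0 then Ga else if r = 1 then Ga else Gb))"

definition diag_tab :: "bool \<Rightarrow> nat \<Rightarrow> gen" where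
  "diag_tab x r = (if x then Gc else if r = 0 then Gb else Gf)"

definition strip_lab :: "(nat \<Rightarrow> bool) \<Rightarrow> nat \<Rightarrow> gen" where
  "strip_lab bs j = (phi ^^ gauge bs (j div 3)) (strip_tab (bs (j div 3)) (j mod 3))"

definition row_lab :: "(nat \<Rightarrow> bool) \<Rightarrow> nat \<Rightarrow> gen" where
  "row_lab bs j = (phi ^^ gauge bs (j div 3)) (row_tab (bs (j div 3)) (j mod 3))"

definition diag_lab :: "(nat \<Rightarrow> bool) \<Rightarrow> nat \<Rightarrow> gen" where
  "diag_lab bs j = (phi ^^ gauge bs (j div 3)) (diag_tab (bs (j div 3)) (j mod 3))"

section \<open>Compatibility of the strip labels\<close>

lemma cof_phi_eq: "cof (phi a) (phi b) = map_option phi (cof a b)"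
  by (cases a; cases b) simp_all

lemma cof_phi_pow: "cof ((phi ^^ n) a) ((phi ^^ n) b) = map_option (phi ^^ n) (cof a b)"
  by (induction n) (simp_all add: cof_phi_eq option.map_comp o_def option.map_ident)

lemma psi_phi_pow: "psi ((phi ^^ n) a) = (phi ^^ n) (psi a)"
proof (induction n)
  case (Suc n)
  show ?case using arg_cong[OF Suc, of phi] by simp
qed simp

lemma phi_pow_Suc: "(phi ^^ Suc n) a = (phi ^^ n) (phi a)"
  by (simp add: funpow_swap1)

text \<open>With \<open>strip_row\<close>, both ways around a parallelogram of the strip spell the
  same coatom, so it closes up.\<close>

lemma row_strip: "cof (row_lab bs j) (strip_lab bs j) = Some (diag_lab bs j)"
  unfolding row_lab_def strip_lab_def diag_lab_def cof_phi_pow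
  by (simp add: row_tab_def strip_tab_def diag_tab_def)

lemma next_block: "Suc j mod 3 = 0 \<Longrightarrow> j mod 3 = 2 \<and> Suc j div 3 = Suc (j div 3)"
  by presburger

lemma same_block: "Suc j mod 3 \<noteq> 0 \<Longrightarrow> Suc j mod 3 = Suc (j mod 3) \<and> Suc j div 3 = j div 3 \<and> j mod 3 < 2"
  by presburger

lemma strip_row: "cof (strip_lab bs j) (row_lab bs (Suc j)) = Some (diag_lab bs j)"
proof (cases "Suc j mod 3 = 0")
  case True
  note b = next_block[OF True]
  show ?thesis unfolding row_lab_def strip_lab_def diag_lab_def
    by (cases "bs (j div 3)")
       (simp_all add: b True row_tab_def strip_tab_def diag_tab_def cof_phi_pow phi_pow_Suc del: funpow.simps)
next
  case False
  note b = same_block[OF False]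
  show ?thesis unfolding row_lab_def strip_lab_def diag_lab_def using b
    by (simp add: row_tab_def strip_tab_def diag_tab_def cof_phi_pow)
qed

text \<open>Makes the downward column a left-weighted word, so that a path across several lines has
  no shortcut. At a block boundary all four combinations of bits have to be compatible.\<close>

lemma strip_strip: "cof (strip_lab bs j) (strip_lab bs (Suc j)) = None"
proof (cases "Suc j mod 3 = 0")
  case True
  note b = next_block[OF True]
  show ?thesis unfolding strip_lab_def
    by (cases "bs (j div 3)"; cases "bs (Suc (j div 3))")
       (simp_all add: b True strip_tab_def cof_phi_pow phi_pow_Suc del: funpow.simps)
next
  case False
  note b = same_block[OF False]
  show ?thesis unfolding strip_lab_def using b
    by (simp add: strip_tab_def cof_phi_pow)
qed

text \<open>The analogue for the diagonals: the pair \<open>Coatom g\<close>,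
  \<open>Coatom h\<close> is left-weighted exactly when \<open>cof h (psi g) = None\<close>.\<close>

lemma diag_diag: "cof (diag_lab bs (Suc j)) (psi (diag_lab bs j)) = None"
proof (cases "Suc j mod 3 = 0")
  case True
  note b = next_block[OF True]
  show ?thesis unfolding diag_lab_def
    by (cases "bs (j div 3)"; cases "bs (Suc (j div 3))")
       (simp_all add: b True diag_tab_def psi_phi_pow cof_phi_pow phi_pow_Suc del: funpow.simps)
next
  case False
  note b = same_block[OF False]
  show ?thesis unfolding diag_lab_def using b
    by (simp add: diag_tab_def psi_phi_pow cof_phi_pow)
qed

lemma row_0: "row_lab bs 0 = Ga"
  by (simp add: row_lab_def row_tab_def)

section \<open>The two sectors above the line through the corner\<close>

definition D2 :: word where "D2 = pos [Gb, Ga]"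

definition npow :: "word \<Rightarrow> nat \<Rightarrow> word" where "npow w n = concat (replicate n w)"

lemma npow_0 [simp]: "npow w 0 = []" and npow_Suc: "npow w (Suc n) = w @ npow w n"
  by (simp_all add: npow_def)

lemma npow_Suc2: "npow w (Suc n) = npow w n @ w"
  by (induction n) (simp_all add: npow_def)

text \<open>Conjugation by \<open>ba\<close> on its three letters \<open>a, b, e\<close>.\<close>

fun th :: "gen \<Rightarrow> gen" where
  "th Ga = Gb" | "th Gb = Ge" | "th y = Ga"

definition in3 :: "gen \<Rightarrow> bool" where "in3 y \<longleftrightarrow> y = Ga \<or> y = Gb \<or> y = Ge"

lemma in3_cof:
  assumes "in3 y"
  shows "\<exists>y'. cof y y' = Some Gf \<and> cof y' (th y) = Some Gf" "\<exists>h. cof y Gc = Some h" "in3 (th y)"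
  using assms by (auto simp: in3_def intro: exI[of _ Ga] exI[of _ Gb] exI[of _ Ge])

lemma beq_D2: "cof y y' = Some Gf \<Longrightarrow> beq (pos [y, y']) D2"
  unfolding D2_def by (rule beq_cof[of _ _ Gf]) auto

lemma beq_th:
  assumes "in3 y"
  shows "beq (pos [y] @ D2) (D2 @ pos [th y])"
proof -
  obtain y' where y': "cof y y' = Some Gf" "cof y' (th y) = Some Gf" using in3_cof(1)[OF assms] by blast
  have "beq (pos [y] @ D2) (pos [y] @ pos [y', th y])"
    using beq_left[OF beq.sym[OF beq_D2[OF y'(2)]]] .
  also have "pos [y] @ pos [y', th y] = pos [y, y'] @ pos [th y]" by (simp add: pos_def)
  also have "beq \<dots> (D2 @ pos [th y])" by (rule beq_right[OF beq_D2[OF y'(1)]])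
  finally show ?thesis .
qed

lemma in3_pow: "in3 y \<Longrightarrow> in3 ((th ^^ n) y)"
  by (induction n) (auto intro: in3_cof(3))

lemma beq_th_pow:
  assumes "in3 y"
  shows "beq (pos [y] @ npow D2 n) (npow D2 n @ pos [(th ^^ n) y])"
proof (induction n)
  case (Suc n)
  have "beq (pos [y] @ npow D2 (Suc n)) ((npow D2 n @ pos [(th ^^ n) y]) @ D2)"
    using beq_right[OF Suc, of D2] by (simp add: npow_Suc2)
  also have "(npow D2 n @ pos [(th ^^ n) y]) @ D2 = npow D2 n @ (pos [(th ^^ n) y] @ D2)" by simp
  also have "beq \<dots> (npow D2 n @ (D2 @ pos [th ((th ^^ n) y)]))"
    by (rule beq_left[OF beq_th[OF in3_pow[OF assms]]])
  also have "npow D2 n @ (D2 @ pos [th ((th ^^ n) y)]) = npow D2 (Suc n) @ pos [(th ^^ Suc n) y]"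
    by (simp add: npow_Suc2)
  finally show ?case .
qed (simp add: beq.refl)

text \<open>Triangles ordered along their directed edges, because heights distinguish the direction
  of an edge.\<close>

definition otri :: "word set \<Rightarrow> word set \<Rightarrow> word set \<Rightarrow> bool" where
  "otri v0 v1 v2 \<longleftrightarrow> (\<exists>g a b h. cof a b = Some h \<and> v0 = Xvertex g \<and> v1 = Xvertex (g @ pos [a]) \<and> v2 = Xvertex (g @ pos [a, b]))"

lemma otriI:
  assumes "cof a b = Some h" "v0 = Xvertex g" "beq u1 (g @ pos [a])" "beq u2 (g @ pos [a, b])"
  shows "otri v0 (Xvertex u1) (Xvertex u2)"
  unfolding otri_def using assms beq_Xvertex by (intro exI[of _ g] exI[of _ a] exI[of _ b] exI[of _ h]) simp

lemma otri_rotate: "otri v0 v1 v2 \<Longrightarrow> otri v1 v2 v0"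
proof -
  assume "otri v0 v1 v2"
  then obtain g a b h where *: "cof a b = Some h" "v0 = Xvertex g" "v1 = Xvertex (g @ pos [a])" "v2 = Xvertex (g @ pos [a, b])"
    unfolding otri_def by (elim exE conjE) (rule that)
  have "v2 = Xvertex ((g @ pos [a]) @ pos [b])" "v0 = Xvertex ((g @ pos [a]) @ pos [b, psi h])"
    using * Xvertex_rotate[OF *(1), of g] by (simp_all add: pos_def)
  then show ?thesis unfolding otri_def using cof_rotate[OF *(1)] *(3)
    by (intro exI[of _ "g @ pos [a]"] exI[of _ b] exI[of _ "psi h"] exI[of _ a]) simp
qed

lemma otri_Xtri: "otri v0 v1 v2 \<Longrightarrow> Xtri v0 v1 v2"
  unfolding Xtri_iff Xtriangles_iff otri_def by (elim exE conjE, intro exI conjI) (assumption, simp)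

lemma otri_height: "otri v0 v1 v2 \<Longrightarrow> height F \<Longrightarrow> F v1 - F v0 \<in> {1, -2}"
  unfolding otri_def height_def by (elim exE conjE) simp

text \<open>Moving y past powers of ba permutes a, b, e, so every edge parallel to the first one
  carries one of these letters and completes to ba.\<close>

lemma sector_up:
  assumes "in3 y"
  shows "otri (Xvertex (h @ pos (replicate m y) @ npow D2 n)) (Xvertex (h @ pos (replicate (Suc m) y) @ npow D2 n))
     (Xvertex (h @ pos (replicate m y) @ npow D2 (Suc n)))"
proof -
  define \<alpha> where "\<alpha> = (th ^^ n) y"
  obtain \<beta> where \<beta>: "cof \<alpha> \<beta> = Some Gf" using in3_cof(1)[OF in3_pow[OF assms]] \<alpha>_def by blast
  have 1: "beq (h @ pos (replicate (Suc m) y) @ npow D2 n) ((h @ pos (replicate m y) @ npow D2 n) @ pos [\<alpha>])"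
    using beq_left[OF beq_th_pow[OF assms, of n], of "h @ pos (replicate m y)"]
    by (simp add: \<alpha>_def pos_def replicate_append_same[symmetric] del: replicate_Suc) (simp add: replicate_app_Cons_same)
  have 2: "beq (h @ pos (replicate m y) @ npow D2 (Suc n)) ((h @ pos (replicate m y) @ npow D2 n) @ pos [\<alpha>, \<beta>])"
    using beq_left[OF beq.sym[OF beq_D2[OF \<beta>]], of "h @ pos (replicate m y) @ npow D2 n"] by (simp add: npow_Suc2)
  show ?thesis by (rule otriI[OF \<beta> HOL.refl 1 2])
qed

lemma sector_down:
  assumes "in3 y"
  shows "otri (Xvertex (h @ pos (replicate m y) @ npow D2 (Suc n))) (Xvertex (h @ pos (replicate (Suc m) y) @ npow D2 (Suc n)))
     (Xvertex (h @ pos (replicate (Suc m) y) @ npow D2 n))"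
proof -
  define \<alpha> where "\<alpha> = (th ^^ Suc n) y"
  obtain k where k: "cof \<alpha> Gc = Some k" using in3_cof(2)[OF in3_pow[OF assms]] \<alpha>_def by blast
  have 1: "beq (h @ pos (replicate (Suc m) y) @ npow D2 (Suc n)) ((h @ pos (replicate m y) @ npow D2 (Suc n)) @ pos [\<alpha>])"
    using beq_left[OF beq_th_pow[OF assms, of "Suc n"], of "h @ pos (replicate m y)"]
    by (simp add: \<alpha>_def pos_def replicate_append_same[symmetric] del: replicate_Suc) (simp add: replicate_app_Cons_same)
  define g where "g = h @ pos (replicate m y) @ npow D2 (Suc n)"
  have "beq ((h @ pos (replicate (Suc m) y) @ npow D2 (Suc n)) @ pos [Gc]) ((g @ pos [\<alpha>]) @ pos [Gc])"
    unfolding g_def by (rule beq_right[OF 1])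
  \<comment> \<open>Since ba c = x, the letter c leads from level n + 1 back to level n modulo
    x.\<close>
  moreover have "(h @ pos (replicate (Suc m) y) @ npow D2 (Suc n)) @ pos [Gc] = (h @ pos (replicate (Suc m) y) @ npow D2 n) @ xpow 1"
    by (simp add: npow_Suc2 D2_def xpow_Suc xword_def pos_def)
  ultimately have "Xvertex (h @ pos (replicate (Suc m) y) @ npow D2 n) = Xvertex (g @ pos [\<alpha>, Gc])"
    using beq_Xvertex[of "(h @ pos (replicate (Suc m) y) @ npow D2 n) @ xpow 1" "(g @ pos [\<alpha>]) @ pos [Gc]"]
      Xvertex_xpow[of "h @ pos (replicate (Suc m) y) @ npow D2 n" 1]
    by (simp add: pos_def)
  then show ?thesis
    unfolding otri_def using k beq_Xvertex[OF 1]
    by (intro exI[of _ g] exI[of _ \<alpha>] exI[of _ Gc] exI[of _ k]) (simp add: g_def)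
qed

section \<open>The strips below the corner\<close>

definition col :: "(nat \<Rightarrow> bool) \<Rightarrow> nat \<Rightarrow> word" where
  "col bs j = pos (map (strip_lab bs) [0..<j])"

lemma col_Suc: "col bs (Suc j) = col bs j @ pos [strip_lab bs j]"
  by (simp add: col_def pos_def)

lemma beq_row_strip: "beq (pos [row_lab bs j, strip_lab bs j]) (pos [strip_lab bs j, row_lab bs (Suc j)])"
  by (rule beq_cof[OF row_strip strip_row])

lemma beq_row_pow:
  "beq (pos (replicate m (row_lab bs j)) @ pos [strip_lab bs j]) (pos [strip_lab bs j] @ pos (replicate m (row_lab bs (Suc j))))"
proof (induction m)
  case (Suc m)
  have "beq (pos (replicate (Suc m) (row_lab bs j)) @ pos [strip_lab bs j])
      (pos [row_lab bs j] @ (pos [strip_lab bs j] @ pos (replicate m (row_lab bs (Suc j)))))"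
    using beq_left[OF Suc, of "pos [row_lab bs j]"] by (simp add: pos_def)
  also have "pos [row_lab bs j] @ (pos [strip_lab bs j] @ pos (replicate m (row_lab bs (Suc j))))
      = pos [row_lab bs j, strip_lab bs j] @ pos (replicate m (row_lab bs (Suc j)))" by (simp add: pos_def)
  also have "beq \<dots> (pos [strip_lab bs j, row_lab bs (Suc j)] @ pos (replicate m (row_lab bs (Suc j))))"
    by (rule beq_right[OF beq_row_strip])
  also have "pos [strip_lab bs j, row_lab bs (Suc j)] @ pos (replicate m (row_lab bs (Suc j)))
      = pos [strip_lab bs j] @ pos (replicate (Suc m) (row_lab bs (Suc j)))" by (simp add: pos_def)
  finally show ?case .
qed (simp add: pos_def beq.refl)

definition low :: "(nat \<Rightarrow> bool) \<Rightarrow> nat \<Rightarrow> nat \<Rightarrow> word" where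
  "low bs m j = col bs j @ pos (replicate m (row_lab bs j))"

lemma low_Suc_row: "low bs (Suc m) j = low bs m j @ pos [row_lab bs j]"
  by (simp add: low_def pos_def replicate_append_same[symmetric] del: replicate_Suc) (simp add: replicate_append_same)

lemma beq_low_Suc: "beq (low bs m (Suc j)) (low bs m j @ pos [strip_lab bs j])"
  using beq_left[OF beq.sym[OF beq_row_pow[of m bs j]], of "col bs j"]
  by (simp add: low_def col_Suc)

lemma beq_low_Suc_Suc: "beq (low bs (Suc m) (Suc j)) (low bs m j @ pos [row_lab bs j, strip_lab bs j])"
  using beq_low_Suc[of bs "Suc m" j] unfolding low_Suc_row[of bs m j] by (simp add: pos_def)

lemma low_up:
  "otri (Xvertex (h @ low bs m j)) (Xvertex (h @ low bs m (Suc j))) (Xvertex (h @ low bs (Suc m) (Suc j)))"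
proof (rule otriI[OF strip_row HOL.refl])
  show 1: "beq (h @ low bs m (Suc j)) ((h @ low bs m j) @ pos [strip_lab bs j])"
    using beq_left[OF beq_low_Suc] by simp
  show "beq (h @ low bs (Suc m) (Suc j)) ((h @ low bs m j) @ pos [strip_lab bs j, row_lab bs (Suc j)])"
    using beq_right[OF 1, of "pos [row_lab bs (Suc j)]"] by (simp add: low_Suc_row pos_def)
qed

lemma low_down:
  "otri (Xvertex (h @ low bs m j)) (Xvertex (h @ low bs (Suc m) j)) (Xvertex (h @ low bs (Suc m) (Suc j)))"
proof (rule otriI[OF row_strip HOL.refl])
  show "beq (h @ low bs (Suc m) j) ((h @ low bs m j) @ pos [row_lab bs j])"
    by (simp add: low_Suc_row beq.refl)
  show "beq (h @ low bs (Suc m) (Suc j)) ((h @ low bs m j) @ pos [row_lab bs j, strip_lab bs j])"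
    using beq_left[OF beq_low_Suc_Suc] by simp
qed

text \<open>Lattice coordinates: \<open>(s, t)\<close> is the point \<open>s + t exp(\<i>\<pi>/3)\<close>, and the positive edges are
  \<open>(1, 0)\<close>, \<open>(-1, 1)\<close>, \<open>(0, -1)\<close>. The corner is the origin, and the region consists of the points with
  \<open>t \<ge> 0, s + t \<ge> 0\<close> or \<open>t \<le> 0, s \<ge> 0\<close>.\<close>

definition W :: "(nat \<Rightarrow> bool) \<Rightarrow> int \<Rightarrow> int \<Rightarrow> word" where
  "W bs s t = (if t < 0 then low bs (nat s) (nat (- t))
     else if s \<ge> 0 then pos (replicate (nat s) Ga) @ npow D2 (nat t)
     else pos (replicate (nat (- s)) Gb) @ npow D2 (nat (s + t)))"

definition V :: "word \<Rightarrow> (nat \<Rightarrow> bool) \<Rightarrow> int \<Rightarrow> int \<Rightarrow> word set" where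
  "V h bs s t = Xvertex (h @ W bs s t)"

lemma W_low: "t \<le> 0 \<Longrightarrow> s \<ge> 0 \<Longrightarrow> W bs s t = low bs (nat s) (nat (- t))"
  by (auto simp: W_def low_def col_def row_0 pos_def)

lemma W_a: "t \<ge> 0 \<Longrightarrow> s \<ge> 0 \<Longrightarrow> W bs s t = pos (replicate (nat s) Ga) @ npow D2 (nat t)"
  by (simp add: W_def)

lemma W_b: "s \<le> 0 \<Longrightarrow> s + t \<ge> 0 \<Longrightarrow> W bs s t = pos (replicate (nat (- s)) Gb) @ npow D2 (nat (s + t))"
  by (cases "s = 0") (auto simp: W_def pos_def)

text \<open>\<open>upP\<close> and \<open>dnP\<close> select the triangles of the region: those with
  corners (m,n), (m+1,n), (m,n+1) and those with corners (m+1,n+1), (m+1,n), (m,n+1).\<close>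

definition upP :: "int \<Rightarrow> int \<Rightarrow> bool" where "upP m n \<longleftrightarrow> (if n \<ge> 0 then m + n \<ge> 0 else m \<ge> 0)"
definition dnP :: "int \<Rightarrow> int \<Rightarrow> bool" where "dnP m n \<longleftrightarrow> (if n \<ge> 0 then m + n + 1 \<ge> 0 else m \<ge> 0)"

lemma otri_up:
  assumes "upP m n"
  shows "otri (V h bs m n) (V h bs (m + 1) n) (V h bs m (n + 1))"
proof -
  consider "n \<ge> 0" "m \<ge> 0" | "n \<ge> 0" "m < 0" "m + n \<ge> 0" | "n < 0" "m \<ge> 0"
    using assms unfolding upP_def by (smt (verit))
  then show ?thesis
  proof cases
    case 1
    then have n: "nat (m + 1) = Suc (nat m)" "nat (n + 1) = Suc (nat n)" by auto
    show ?thesis using 1 sector_up[of Ga h "nat m" "nat n"] by (simp add: V_def W_a n in3_def)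
  next
    case 2
    then have n: "nat (- m) = Suc (nat (- (m + 1)))" "nat (m + (n + 1)) = Suc (nat (m + n))"
      "nat (m + 1 + n) = Suc (nat (m + n))" by auto
    have "otri (V h bs (m + 1) n) (V h bs m (n + 1)) (V h bs m n)"
      using 2 sector_down[of Gb h "nat (- (m + 1))" "nat (m + n)"] unfolding V_def by (simp add: W_b n in3_def)
    then show ?thesis by (rule otri_rotate[OF otri_rotate])
  next
    case 3
    then have n: "nat (m + 1) = Suc (nat m)" "nat (- n) = Suc (nat (- (n + 1)))" by auto
    have "otri (V h bs m (n + 1)) (V h bs m n) (V h bs (m + 1) n)"
      using 3 low_up[of h bs "nat m" "nat (- (n + 1))"] unfolding V_def by (simp add: W_low n)
    then show ?thesis by (rule otri_rotate)
  qed
qed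

lemma otri_dn:
  assumes "dnP m n"
  shows "otri (V h bs (m + 1) (n + 1)) (V h bs (m + 1) n) (V h bs m (n + 1))"
proof -
  consider "n \<ge> 0" "m \<ge> 0" | "n \<ge> 0" "m < 0" "m + n + 1 \<ge> 0" | "n < 0" "m \<ge> 0"
    using assms unfolding dnP_def by (smt (verit))
  then show ?thesis
  proof cases
    case 1
    then have n: "nat (m + 1) = Suc (nat m)" "nat (n + 1) = Suc (nat n)" by auto
    have "otri (V h bs m (n + 1)) (V h bs (m + 1) (n + 1)) (V h bs (m + 1) n)"
      using 1 sector_down[of Ga h "nat m" "nat n"] by (simp add: V_def W_a n in3_def)
    then show ?thesis by (rule otri_rotate)
  next
    case 2
    then have n: "nat (- m) = Suc (nat (- (m + 1)))" "nat (m + (n + 1)) = nat (m + 1 + n)"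
      "nat (m + 1 + (n + 1)) = Suc (nat (m + 1 + n))" "nat (2 + (m + n)) = Suc (nat (m + 1 + n))" by auto
    have "otri (V h bs (m + 1) n) (V h bs m (n + 1)) (V h bs (m + 1) (n + 1))"
      using 2 sector_up[of Gb h "nat (- (m + 1))" "nat (m + 1 + n)"] unfolding V_def by (simp add: W_b n in3_def)
    then show ?thesis by (rule otri_rotate[OF otri_rotate])
  next
    case 3
    then have n: "nat (m + 1) = Suc (nat m)" "nat (- n) = Suc (nat (- (n + 1)))" by auto
    have "otri (V h bs m (n + 1)) (V h bs (m + 1) (n + 1)) (V h bs (m + 1) n)"
      using 3 low_down[of h bs "nat m" "nat (- (n + 1))"] unfolding V_def by (simp add: W_low n)
    then show ?thesis by (rule otri_rotate)
  qed
qed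

section \<open>Height functions that are linear on a flat region\<close>

definition inP :: "int \<Rightarrow> int \<Rightarrow> bool" where
  "inP s t \<longleftrightarrow> (t \<ge> 0 \<and> s + t \<ge> 0) \<or> (t \<le> 0 \<and> s \<ge> 0)"

context
  fixes F :: "word set \<Rightarrow> int" and h :: word and bs :: "nat \<Rightarrow> bool"
  assumes F: "height F"
begin

abbreviation (input) hv :: "int \<Rightarrow> int \<Rightarrow> int" where "hv s t \<equiv> F (V h bs s t)"

lemma step_e1:
  assumes "inP s t"
  shows "hv (s + 1) t - hv s t \<in> {1, -2}"
proof -
  have "upP s t" using assms by (auto simp: inP_def upP_def)
  from otri_height[OF otri_up[OF this] F] show ?thesis .
qed

lemma step_e2:
  assumes "inP s t" "inP (s - 1) (t + 1)"
  shows "hv (s - 1) (t + 1) - hv s t \<in> {1, -2}"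
proof -
  have "dnP (s - 1) t" using assms by (auto simp: inP_def dnP_def)
  from otri_height[OF otri_rotate[OF otri_dn[OF this]] F] show ?thesis by simp
qed

lemma step_e3:
  assumes "inP s (t - 1)"
  shows "hv s (t - 1) - hv s t \<in> {1, -2}"
proof -
  have "upP s (t - 1)" using assms by (auto simp: inP_def upP_def)
  from otri_height[OF otri_rotate[OF otri_rotate[OF otri_up[OF this]]] F] show ?thesis by simp
qed

text \<open>Telescoping: a positive edge raises a height by at most 1, and going back along it by at
  most 2. The next two lemmas do this in the other two directions.\<close>

lemma run_e1:
  assumes "inP s t" "s \<le> s'"
  shows "hv s' t \<le> hv s t + (s' - s)" "hv s t \<le> hv s' t + 2 * (s' - s)"
proof -
  have "hv (s + int n) t \<le> hv s t + int n \<and> hv s t \<le> hv (s + int n) t + 2 * int n" for n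
  proof (induction n)
    case (Suc n)
    have "inP (s + int n) t" using assms(1) by (auto simp: inP_def)
    from step_e1[OF this] have "hv (s + int (Suc n)) t - hv (s + int n) t \<in> {1, -2}" by (simp add: algebra_simps)
    then show ?case using Suc by auto
  qed simp
  from this[of "nat (s' - s)"] show "hv s' t \<le> hv s t + (s' - s)" "hv s t \<le> hv s' t + 2 * (s' - s)"
    using assms(2) by simp_all
qed

lemma run_e2:
  assumes "inP s t" "inP s' t'" "s + t = s' + t'" "t \<le> t'"
  shows "hv s' t' \<le> hv s t + (t' - t)" "hv s t \<le> hv s' t' + 2 * (t' - t)"
proof -
  have "int n \<le> t' - t \<Longrightarrow> hv (s - int n) (t + int n) \<le> hv s t + int n \<and> hv s t \<le> hv (s - int n) (t + int n) + 2 * int n" for n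
  proof (induction n)
    case (Suc n)
    have "inP (s - int n) (t + int n)" "inP (s - int n - 1) (t + int n + 1)"
      using assms Suc.prems by (auto simp: inP_def)
    from step_e2[OF this] have "hv (s - int (Suc n)) (t + int (Suc n)) - hv (s - int n) (t + int n) \<in> {1, -2}"
      by (simp add: algebra_simps)
    then show ?case using Suc by auto
  qed simp
  moreover have "s - int (nat (t' - t)) = s'" "t + int (nat (t' - t)) = t'" "int (nat (t' - t)) = t' - t" using assms by auto
  ultimately show "hv s' t' \<le> hv s t + (t' - t)" "hv s t \<le> hv s' t' + 2 * (t' - t)" by (metis order_refl)+
qed

lemma run_e3:
  assumes "inP s t" "inP s t'" "t' \<le> t"
  shows "hv s t' \<le> hv s t + (t - t')" "hv s t \<le> hv s t' + 2 * (t - t')"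
proof -
  have "int n \<le> t - t' \<Longrightarrow> hv s (t - int n) \<le> hv s t + int n \<and> hv s t \<le> hv s (t - int n) + 2 * int n" for n
  proof (induction n)
    case (Suc n)
    have "inP s (t - int n - 1)" using assms Suc.prems by (auto simp: inP_def)
    from step_e3[OF this] have "hv s (t - int (Suc n)) - hv s (t - int n) \<in> {1, -2}"
      by (simp add: algebra_simps)
    then show ?case using Suc by auto
  qed simp
  moreover have "t - int (nat (t - t')) = t'" "int (nat (t - t')) = t - t'" using assms by auto
  ultimately show "hv s t' \<le> hv s t + (t - t')" "hv s t \<le> hv s t' + 2 * (t - t')" by (metis order_refl)+
qed

text \<open>In each of the next three lemmas the point lies on a directed geodesic of the region from a far point
  to a far point; the height function changes by at most its linear model along every edge, so agreement at the
  ends forces agreement in between.\<close>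

lemma linear_300:
  assumes q: "hv (- K) K \<le> - 2 * K + C" and p: "hv K (- K) \<ge> 2 * K + C"
    and v: "inP s t" "t \<le> K" "s + t \<le> K" "- t \<le> K" "s \<le> K" "0 \<le> K"
  shows "hv s t = s - t + C"
proof (cases "t \<ge> 0")
  case True
  then have st: "s + t \<ge> 0" using v by (auto simp: inP_def)
  have "hv (- t) t \<le> hv (- K) K + 2 * (K - t)"
    using run_e2(2)[of "- t" t "- K" K] v True by (simp add: inP_def)
  moreover have "hv s t \<le> hv (- t) t + (s + t)"
    using run_e1(1)[of "- t" t s] st True by (simp add: inP_def)
  moreover have "hv (s + t) 0 \<le> hv s t + 2 * t"
    using run_e2(2)[of "s + t" 0 s t] v True st by (simp add: inP_def)
  moreover have "hv K 0 \<le> hv (s + t) 0 + (K - s - t)"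
    using run_e1(1)[of "s + t" 0 K] v st by (simp add: inP_def)
  moreover have "hv K (- K) \<le> hv K 0 + K"
    using run_e3(1)[of K 0 "- K"] v by (simp add: inP_def)
  ultimately show ?thesis using q p by (smt (verit))
next
  case False
  then have s: "s \<ge> 0" using v by (auto simp: inP_def)
  have "hv 0 0 \<le> hv (- K) K + 2 * K"
    using run_e2(2)[of 0 0 "- K" K] v by (simp add: inP_def)
  moreover have "hv s 0 \<le> hv 0 0 + s"
    using run_e1(1)[of 0 0 s] s by (simp add: inP_def)
  moreover have "hv s t \<le> hv s 0 - t"
    using run_e3(1)[of s 0 t] s False by (simp add: inP_def)
  moreover have "hv K t \<le> hv s t + (K - s)"
    using run_e1(1)[of s t K] v by simp
  moreover have "hv K (- K) \<le> hv K t + (t + K)"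
    using run_e3(1)[of K t "- K"] v False by (simp add: inP_def)
  ultimately show ?thesis using q p by (smt (verit))
qed

lemma linear_60:
  assumes q: "hv 0 (- K) \<le> - 2 * K + C" and p: "hv 0 K \<ge> 2 * K + C"
    and v: "inP s t" "t \<le> K" "s + t \<le> K" "- t \<le> K" "s \<le> K" "0 \<le> K"
  shows "hv s t = s + 2 * t + C"
proof (cases "s \<ge> 0")
  case True
  have "hv 0 t \<le> hv 0 (- K) + 2 * (t + K)"
    using run_e3(2)[of 0 t "- K"] v by (auto simp: inP_def)
  moreover have "hv s t \<le> hv 0 t + s"
  proof -
    have "inP 0 t" by (cases "t \<ge> 0") (auto simp: inP_def)
    from run_e1(1)[OF this True] show ?thesis by simp
  qed
  moreover have "hv 0 K \<le> hv s t + s + 2 * (K - t - s)"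
  proof (cases "t \<ge> 0")
    case T: True
    have "hv 0 (t + s) \<le> hv s t + s"
      using run_e2(1)[of s t 0 "t + s"] v T True by (simp add: inP_def)
    moreover have "hv 0 K \<le> hv 0 (t + s) + 2 * (K - t - s)"
      using run_e3(2)[of 0 K "t + s"] v T True by (simp add: inP_def)
    ultimately show ?thesis by (smt (verit))
  next
    case False
    have "hv s 0 \<le> hv s t + 2 * (- t)"
      using run_e3(2)[of s 0 t] False True by (simp add: inP_def)
    moreover have "hv 0 s \<le> hv s 0 + s"
      using run_e2(1)[of s 0 0 s] True by (simp add: inP_def)
    moreover have "hv 0 K \<le> hv 0 s + 2 * (K - s)"
      using run_e3(2)[of 0 K s] v True by (simp add: inP_def)
    ultimately show ?thesis by (smt (verit))
  qed
  ultimately show ?thesis using q p by (smt (verit))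
next
  case False
  then have st: "t \<ge> 0" "s + t \<ge> 0" using v by (auto simp: inP_def)
  have "hv 0 0 \<le> hv 0 (- K) + 2 * K"
    using run_e3(2)[of 0 0 "- K"] v by (simp add: inP_def)
  moreover have "hv s (- s) \<le> hv 0 0 + (- s)"
    using run_e2(1)[of 0 0 s "- s"] False by (simp add: inP_def)
  moreover have "hv s t \<le> hv s (- s) + 2 * (t + s)"
    using run_e3(2)[of s t "- s"] False st by (simp add: inP_def)
  moreover have "hv 0 t \<le> hv s t + (- s)"
    using run_e1(1)[of s t 0] v False by simp
  moreover have "hv 0 K \<le> hv 0 t + 2 * (K - t)"
    using run_e3(2)[of 0 K t] v st by (simp add: inP_def)
  ultimately show ?thesis using q p by (smt (verit))
qed

lemma linear_180:
  assumes p: "hv K 0 \<le> - 2 * K + C" and q1: "hv (- K) K \<ge> K + C" and q2: "hv 0 (- K) \<ge> K + C"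
    and v: "inP s t" "t \<le> K" "s + t \<le> K" "- t \<le> K" "s \<le> K" "0 \<le> K"
  shows "hv s t = - 2 * s - t + C"
proof (cases "t \<ge> 0")
  case True
  then have st: "s + t \<ge> 0" using v by (auto simp: inP_def)
  \<comment> \<open>Paths in this direction run into the removed wedge. In this half they end at
    (-K, K) on its upper side, in the other half at (0, -K) on its lower side.\<close>
  have "hv (K - t) t \<le> hv K 0 + t"
    using run_e2(1)[of K 0 "K - t" t] v True by (simp add: inP_def)
  moreover have "hv s t \<le> hv (K - t) t + 2 * (K - t - s)"
    using run_e1(2)[of s t "K - t"] v by simp
  moreover have "hv (- t) t \<le> hv s t + 2 * (s + t)"
    using run_e1(2)[of "- t" t s] st True by (simp add: inP_def)
  moreover have "hv (- K) K \<le> hv (- t) t + (K - t)"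
    using run_e2(1)[of "- t" t "- K" K] v True by (simp add: inP_def)
  ultimately show ?thesis using p q1 by (smt (verit))
next
  case False
  then have s: "s \<ge> 0" using v by (auto simp: inP_def)
  have "hv K t \<le> hv K 0 + (- t)"
    using run_e3(1)[of K 0 t] v False by (simp add: inP_def)
  moreover have "hv s t \<le> hv K t + 2 * (K - s)"
    using run_e1(2)[of s t K] v by simp
  moreover have "hv 0 t \<le> hv s t + 2 * s"
    using run_e1(2)[of 0 t s] s False by (simp add: inP_def)
  moreover have "hv 0 (- K) \<le> hv 0 t + (t + K)"
    using run_e3(1)[of 0 t "- K"] v False by (simp add: inP_def)
  ultimately show ?thesis using p q2 by (smt (verit))
qed

end

section \<open>Distances between far vertices of a region\<close>

lemma nf_atoms:
  "successively (\<lambda>a b. cof a b = None) ys \<Longrightarrow> wact (pos ys) [] = map Atom ys \<and> normal (map Atom ys)"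
proof (induction ys)
  case (Cons a ys)
  then have IH: "wact (pos ys) [] = map Atom ys" "normal (map Atom ys)"
    and l: "ys = [] \<or> cof a (hd ys) = None"
    by (auto simp: successively_Cons)
  have "normal (map Atom (a # ys))"
    using IH(2) l by (cases ys) (auto simp: normal_Cons)
  moreover have "wact (pos (a # ys)) [] = push (Atom a) (map Atom ys)"
    using IH(1) by (simp add: pos_def lact_True)
  ultimately show ?case using push_normal by simp
qed (simp add: pos_def)

lemma nf_coatoms:
  assumes "\<And>x. x \<in> set xs \<Longrightarrow> cof (a x) (b x) = Some (c x)" "normal (map (\<lambda>x. Coatom (c x)) xs)"
  shows "wact (pos (concat (map (\<lambda>x. [a x, b x]) xs))) [] = map (\<lambda>x. Coatom (c x)) xs"
  using assms
proof (induction xs)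
  case (Cons x xs)
  then have n: "normal (map (\<lambda>x. Coatom (c x)) xs)" by (simp add: normal_Cons)
  have "wact (pos (concat (map (\<lambda>x. [a x, b x]) (x # xs)))) []
      = wact (pos [a x, b x]) (wact (pos (concat (map (\<lambda>x. [a x, b x]) xs))) [])"
    by (simp add: pos_def)
  also have "\<dots> = push (Coatom (c x)) (map (\<lambda>x. Coatom (c x)) xs)"
    using Cons n wact_pos2[of "a x" "b x" "c x"] by simp
  also have "\<dots> = map (\<lambda>x. Coatom (c x)) (x # xs)" using Cons.prems push_normal by simp
  finally show ?case .
qed (simp add: pos_def)

text \<open>Modulo x an inverse letter is a coatom, so walking backwards along a left-weighted path
  prepends one coatom per edge; only the junction with L remains to be checked.\<close>

lemma nf_inverse_path:
  assumes "successively (\<lambda>a b. cof a b = None) ys" "ys \<noteq> []" "normal (Coatom (phi (hd ys)) # L)"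
  shows "normal (wact (winv (pos ys)) L) \<and> wact (winv (pos ys)) L \<noteq> [] \<and>
    hd (wact (winv (pos ys)) L) = Coatom (last ys) \<and> length_of (wact (winv (pos ys)) L) = 2 * int (length ys) + length_of L"
  using assms
proof (induction ys rule: rev_induct)
  case (snoc y ys)
  define M where "M = wact (winv (pos ys)) L"
  have step: "wact (winv (pos (ys @ [y]))) L = map (tw psi) (push (Coatom (phi y)) M)"
    by (simp add: M_def pos_def lact_False)
  have nM: "normal (Coatom (phi y) # M) \<and> length_of M = 2 * int (length ys) + length_of L"
  proof (cases "ys = []")
    case True
    then show ?thesis using snoc.prems by (simp add: M_def pos_def)
  next
    case False
    have "successively (\<lambda>a b. cof a b = None) ys" "cof (last ys) y = None"
      using snoc.prems(1) False by (auto simp: successively_append_iff)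
    moreover have "hd (ys @ [y]) = hd ys" using False by simp
    ultimately have "normal M" "M \<noteq> []" "hd M = Coatom (last ys)" "length_of M = 2 * int (length ys) + length_of L"
      using snoc.IH snoc.prems(3) False by (auto simp: M_def)
    then show ?thesis using \<open>cof (last ys) y = None\<close> by (simp add: normal_Cons)
  qed
  then have "push (Coatom (phi y)) M = Coatom (phi y) # M" using push_normal by blast
  moreover have "normal (map (tw psi) (Coatom (phi y) # M))" using nM normal_map_psi by blast
  ultimately show ?case using step nM by simp
qed simp

lemma pdist_prefix: "pdist (h @ u) (h @ p) = length_of (wact (winv u) (wact p []))"
  by (simp add: pdist_def wact_winv normal_wact)

lemma successively_replicate: "P x x \<Longrightarrow> successively P (replicate n x)"
  by (auto simp: successively_conv_nth)

lemma successively_map_upt: "(\<And>j. P (g j) (g (Suc j))) \<Longrightarrow> successively P (map g [0..<n])"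
  by (auto simp: successively_conv_nth)

lemma normal_map_upt:
  assumes "\<And>j. lweighted (g j) (g (Suc j))" "\<And>j. g j \<noteq> Unit \<and> g j \<noteq> Whole"
  shows "normal (map g [0..<n])"
  using assms successively_map_upt[of lweighted g n] by (auto simp: normal_def proper_def)

lemma beq_diagonal:
  "beq (low bs n n) (pos (concat (map (\<lambda>j. [row_lab bs j, strip_lab bs j]) [0..<n])))"
proof (induction n)
  case (Suc n)
  have "beq (low bs (Suc n) (Suc n)) (low bs n n @ pos [row_lab bs n, strip_lab bs n])"
    by (rule beq_low_Suc_Suc)
  also have "beq \<dots> (pos (concat (map (\<lambda>j. [row_lab bs j, strip_lab bs j]) [0..<n])) @ pos [row_lab bs n, strip_lab bs n])"
    by (rule beq_right[OF Suc])
  finally show ?case by simp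
qed (simp add: low_def col_def pos_def beq.refl)

lemma normal_diag: "normal (map (\<lambda>j. Coatom (diag_lab bs j)) [0..<n])"
  by (rule normal_map_upt) (simp_all add: diag_diag)

lemma nf_diagonal: "wact (low bs n n) [] = map (\<lambda>j. Coatom (diag_lab bs j)) [0..<n]"
  using beq_wact[OF beq_diagonal normal_Nil] nf_coatoms[OF row_strip normal_diag] by simp

lemma nf_col: "wact (col bs n) [] = map Atom (map (strip_lab bs) [0..<n]) \<and> normal (map Atom (map (strip_lab bs) [0..<n]))"
  unfolding col_def by (intro nf_atoms successively_map_upt strip_strip)

lemma nf_D2: "wact (npow D2 n) [] = replicate n (Coatom Gf) \<and> normal (replicate n (Coatom Gf))"
proof -
  have n: "normal (map (\<lambda>_. Coatom Gf) [0..<n])" by (rule normal_map_upt) simp_all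
  have "npow D2 n = pos (concat (map (\<lambda>_. [Gb, Ga]) [0..<n]))"
    by (induction n) (simp_all add: npow_Suc2 D2_def pos_def)
  then show ?thesis using nf_coatoms[OF _ n, of "\<lambda>_. Gb" "\<lambda>_. Ga"] n by (simp add: map_replicate_const)
qed

lemma hd_strip: "bs 0 \<Longrightarrow> strip_lab bs 0 = Gd"
  by (simp add: strip_lab_def strip_tab_def)

lemma hd_diag: "bs 0 \<Longrightarrow> diag_lab bs 0 = Gc"
  by (simp add: diag_lab_def diag_tab_def)

context
  fixes bs :: "nat \<Rightarrow> bool" and n :: nat and h :: word
  assumes bs0: "bs 0" and n: "n > 0"
begin

text \<open>The numbers in these names are the angles of the gradients in degrees. Here the junction
  at the corner is the left-weighted pair of the coatoms of \<open>Gd = phi Gb\<close> and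
  \<open>Gc\<close>.\<close>

lemma pdist_300: "pdist (h @ W bs (- int n) (int n)) (h @ W bs (int n) (- int n)) = 4 * int n"
proof -
  let ?L = "map (\<lambda>j. Coatom (diag_lab bs j)) [0..<n]"
  have "W bs (- int n) (int n) = pos (replicate n Gb)" by (simp add: W_b)
  moreover have "wact (W bs (int n) (- int n)) [] = ?L" by (simp add: W_low nf_diagonal)
  moreover have "?L \<noteq> [] \<and> hd ?L = Coatom Gc" using n by (simp add: hd_map hd_diag[of bs, OF bs0])
  then have "normal (Coatom (phi (hd (replicate n Gb))) # ?L)" using n normal_diag by (simp add: normal_Cons)
  moreover have "length_of ?L = 2 * int n" by (simp add: length_of_def o_def sum_list_triv)
  ultimately show ?thesis
    using nf_inverse_path[of "replicate n Gb" ?L] n by (simp add: pdist_prefix successively_replicate)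
qed

text \<open>At the corner the coatom of \<open>Gb = phi Gd\<close> meets that of \<open>Gf\<close>,
  a left-weighted pair.\<close>

lemma pdist_60: "pdist (h @ W bs 0 (- int n)) (h @ W bs 0 (int n)) = 4 * int n"
proof -
  let ?L = "replicate n (Coatom Gf)" and ?ys = "map (strip_lab bs) [0..<n]"
  have "W bs 0 (- int n) = pos ?ys" by (simp add: W_low low_def col_def pos_def)
  moreover have "wact (W bs 0 (int n)) [] = ?L" using nf_D2 by (simp add: W_a pos_def)
  moreover have "hd ?ys = Gd" using n by (simp add: hd_map hd_strip[of bs, OF bs0])
  then have "normal (Coatom (phi (hd ?ys)) # ?L)" using n nf_D2[of n] by (simp add: normal_Cons)
  moreover have "length_of ?L = 2 * int n" by (simp add: length_of_def sum_list_replicate)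
  moreover have "successively (\<lambda>a b. cof a b = None) ?ys" by (rule successively_map_upt) (rule strip_strip)
  ultimately show ?thesis
    using nf_inverse_path[of ?ys ?L] n by (simp add: pdist_prefix)
qed

text \<open>The targets lie on the two sides of the removed wedge. Their equal distances from (n, 0)
  make the corresponding height functions agree at that vertex.\<close>

lemma pdist_180:
  "pdist (h @ W bs (int n) 0) (h @ W bs (- int n) (int n)) = 3 * int n"
  "pdist (h @ W bs (int n) 0) (h @ W bs 0 (- int n)) = 3 * int n"
proof -
  let ?ys = "replicate n Ga" and ?L1 = "map Atom (replicate n Gb)" and ?L2 = "map Atom (map (strip_lab bs) [0..<n])"
  have w: "W bs (int n) 0 = pos ?ys" by (simp add: W_a)
  have s: "successively (\<lambda>a b. cof a b = None) ?ys" by (simp add: successively_replicate)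
  have "wact (W bs (- int n) (int n)) [] = ?L1" "normal ?L1"
    using nf_atoms[of "replicate n Gb"] by (simp_all add: W_b successively_replicate)
  moreover have "normal (Coatom (phi (hd ?ys)) # ?L1)" using n \<open>normal ?L1\<close> by (simp add: normal_Cons)
  moreover have "length_of ?L1 = int n" by (simp add: length_of_def sum_list_replicate)
  ultimately show "pdist (h @ W bs (int n) 0) (h @ W bs (- int n) (int n)) = 3 * int n"
    using nf_inverse_path[OF s, of ?L1] n w by (simp add: pdist_prefix)
  have "wact (W bs 0 (- int n)) [] = ?L2" "normal ?L2"
    using nf_col[of bs n] by (simp_all add: W_low low_def pos_def)
  moreover have "?L2 \<noteq> [] \<and> hd ?L2 = Atom Gd" using n by (simp add: hd_map hd_strip[of bs, OF bs0])
  then have "normal (Coatom (phi (hd ?ys)) # ?L2)" using n \<open>normal ?L2\<close> by (simp add: normal_Cons)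
  moreover have "length_of ?L2 = int n" by (simp add: length_of_def o_def sum_list_triv)
  ultimately show "pdist (h @ W bs (int n) 0) (h @ W bs 0 (- int n)) = 3 * int n"
    using nf_inverse_path[OF s, of ?L2] n w by (simp add: pdist_prefix)
qed

end

text \<open>Both functions change by 1 mod 3 along every positive edge, and every word is a path
  from the base vertex.\<close>

lemma height_congruent:
  assumes "height F" "height G" "F (Xvertex u) = G (Xvertex u)"
  shows "3 dvd F (Xvertex w) - G (Xvertex w)"
proof -
  have base: "3 dvd (F (Xvertex w) - G (Xvertex w)) - (F (Xvertex []) - G (Xvertex []))" for w
  proof (induction w rule: rev_induct)
    case (snoc l w)
    obtain s b where l: "l = (s, b)" by force
    have st: "F (Xvertex (g @ pos [s])) - F (Xvertex g) \<in> {1, -2}" "G (Xvertex (g @ pos [s])) - G (Xvertex g) \<in> {1, -2}" for g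
      using assms by (auto simp: height_def)
    have st3: "3 dvd (F (Xvertex (g @ pos [s])) - G (Xvertex (g @ pos [s]))) - (F (Xvertex g) - G (Xvertex g))" for g
    proof -
      have "(F (Xvertex (g @ pos [s])) - F (Xvertex g)) - (G (Xvertex (g @ pos [s])) - G (Xvertex g)) \<in> {0, 3, -3}"
        using st[of g] by auto
      then have "3 dvd (F (Xvertex (g @ pos [s])) - F (Xvertex g)) - (G (Xvertex (g @ pos [s])) - G (Xvertex g))" by auto
      then show ?thesis by (simp add: algebra_simps)
    qed
    show ?case
    proof (cases b)
      case True
      then have "w @ [l] = w @ pos [s]" by (simp add: l pos_def)
      then show ?thesis using dvd_add[OF st3[of w] snoc] by (simp add: algebra_simps)
    next
      case False
      have "beq ((w @ [l]) @ pos [s]) w"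
        using beq.cancel[of w s False "[]"] l False by (simp add: pos_def)
      then have "Xvertex ((w @ [l]) @ pos [s]) = Xvertex w" by (rule beq_Xvertex)
      then have "3 dvd (F (Xvertex w) - G (Xvertex w)) - (F (Xvertex (w @ [l])) - G (Xvertex (w @ [l])))"
        using st3[of "w @ [l]"] by simp
      from dvd_diff[OF snoc this] show ?thesis by (simp add: algebra_simps)
    qed
  qed simp
  have "F (Xvertex w) - G (Xvertex w) = ((F (Xvertex w) - G (Xvertex w)) - (F (Xvertex []) - G (Xvertex []))) -
      ((F (Xvertex u) - G (Xvertex u)) - (F (Xvertex []) - G (Xvertex [])))" using assms(3) by simp
  then show ?thesis using dvd_diff[OF base[of w] base[of u]] by simp
qed

text \<open>By the congruence the functions are equal or at least 3 apart, and an edge changes their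
  difference by at most 3, so the order is never reversed along an edge.\<close>

lemma height_max:
  assumes "height F" "height G" "F (Xvertex u) = G (Xvertex u)"
  shows "height (\<lambda>v. max (F v) (G v))"
  unfolding height_def
proof (intro allI)
  fix g a
  define x y x' y' where "x = F (Xvertex g)" and "y = G (Xvertex g)"
    and "x' = F (Xvertex (g @ pos [a]))" and "y' = G (Xvertex (g @ pos [a]))"
  have "x' - x \<in> {1, -2}" "y' - y \<in> {1, -2}"
    using assms unfolding height_def x_def y_def x'_def y'_def by blast+
  moreover have "3 dvd x - y" unfolding x_def y_def by (rule height_congruent[OF assms])
  then have "x - y = 0 \<or> x - y \<ge> 3 \<or> x - y \<le> -3" by presburger
  ultimately have "max x' y' - max x y \<in> {1, -2}" by auto
  then show "max (F (Xvertex (g @ pos [a]))) (G (Xvertex (g @ pos [a]))) - max (F (Xvertex g)) (G (Xvertex g)) \<in> {1, -2}"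
    by (simp add: x_def y_def x'_def y'_def)
qed

text \<open>F2 and F3 come from a single far target each. The gradient of F1 points into the removed
  wedge, so F1 is the maximum over one far target on each side of it.\<close>

lemma flat_heights:
  assumes "bs 0"
  obtains F1 F2 F3 c1 c2 c3 where "height F1" "height F2" "height F3"
    "\<And>s t. inP s t \<Longrightarrow> \<bar>s\<bar> \<le> int M \<Longrightarrow> \<bar>t\<bar> \<le> int M \<Longrightarrow> F1 (V h bs s t) = - 2 * s - t + c1"
    "\<And>s t. inP s t \<Longrightarrow> \<bar>s\<bar> \<le> int M \<Longrightarrow> \<bar>t\<bar> \<le> int M \<Longrightarrow> F2 (V h bs s t) = s - t + c2"
    "\<And>s t. inP s t \<Longrightarrow> \<bar>s\<bar> \<le> int M \<Longrightarrow> \<bar>t\<bar> \<le> int M \<Longrightarrow> F3 (V h bs s t) = s + 2 * t + c3"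
proof -
  \<comment> \<open>The bound 2 M covers s + t on the box, and the extra 1 keeps n positive.\<close>
  define n where "n = 2 * M + 1"
  have n: "n > 0" by (simp add: n_def)
  define G where "G = (\<lambda>c s t v. c - vdist (h @ W bs s t) v)"
  have hG: "height (G c s t)" for c s t unfolding G_def by (rule height_vdist)
  have GV: "G c s t (V h bs s' t') = c - pdist (h @ W bs s' t') (h @ W bs s t)" for c s t s' t'
    by (simp add: G_def V_def vdist_Xvertex)
  define F2 where "F2 = G 0 (int n) (- int n)"
  define F3 where "F3 = G 0 0 (int n)"
  define A where "A = G (int n) (- int n) (int n)"
  define B where "B = G (int n) 0 (- int n)"
  define F1 where "F1 = (\<lambda>v. max (A v) (B v))"
  have AB: "A (V h bs (int n) 0) = - 2 * int n" "B (V h bs (int n) 0) = - 2 * int n"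
    by (simp_all add: A_def B_def GV pdist_180[of bs, OF assms n])
  have hF1: "height F1" unfolding F1_def
    by (rule height_max[of _ _ "h @ W bs (int n) 0"]) (use hG AB in \<open>simp_all add: A_def B_def V_def\<close>)
  have F1: "F1 (V h bs s t) = - 2 * s - t + 0" if "inP s t" "\<bar>s\<bar> \<le> int M" "\<bar>t\<bar> \<le> int M" for s t
  proof (rule linear_180[OF hF1, of _ _ "int n"])
    show "F1 (V h bs (int n) 0) \<le> - 2 * int n + 0" using AB by (simp add: F1_def)
    have "A (V h bs (- int n) (int n)) = int n" by (simp add: A_def GV)
    then show "int n + 0 \<le> F1 (V h bs (- int n) (int n))" by (simp add: F1_def)
    have "B (V h bs 0 (- int n)) = int n" by (simp add: B_def GV)
    then show "int n + 0 \<le> F1 (V h bs 0 (- int n))" by (simp add: F1_def)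
  qed (use that in \<open>auto simp: n_def\<close>)
  have F2: "F2 (V h bs s t) = s - t + (- 2 * int n)" if "inP s t" "\<bar>s\<bar> \<le> int M" "\<bar>t\<bar> \<le> int M" for s t
  proof (rule linear_300[of F2, of _ _ "int n"])
    show "height F2" using hG by (simp add: F2_def)
    show "F2 (V h bs (- int n) (int n)) \<le> - 2 * int n + - 2 * int n"
      using pdist_300[of bs, OF assms n] by (simp add: F2_def GV)
    show "2 * int n + - 2 * int n \<le> F2 (V h bs (int n) (- int n))" by (simp add: F2_def GV)
  qed (use that in \<open>auto simp: n_def\<close>)
  have F3: "F3 (V h bs s t) = s + 2 * t + (- 2 * int n)" if "inP s t" "\<bar>s\<bar> \<le> int M" "\<bar>t\<bar> \<le> int M" for s t
  proof (rule linear_60[of F3, of _ _ "int n"])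
    show "height F3" using hG by (simp add: F3_def)
    show "F3 (V h bs 0 (- int n)) \<le> - 2 * int n + - 2 * int n"
      using pdist_60[of bs, OF assms n] by (simp add: F3_def GV)
    show "2 * int n + - 2 * int n \<le> F3 (V h bs 0 (int n))" by (simp add: F3_def GV)
  qed (use that in \<open>auto simp: n_def\<close>)
  show thesis using that[OF hF1 _ _ F1 F2 F3] hG by (simp add: F2_def F3_def)
qed

section \<open>Flat discs\<close>

text \<open>\<open>cS\<close> and \<open>cT\<close> are the coordinates in the basis 1, exp(i pi /
  3); \<open>lat\<close> is the inverse map and \<open>hexq\<close> the squared norm.\<close>

definition cS :: "complex \<Rightarrow> real" where "cS u = Re u - Im u / sqrt 3"
definition cT :: "complex \<Rightarrow> real" where "cT u = 2 * Im u / sqrt 3"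
definition lat :: "real \<Rightarrow> real \<Rightarrow> complex" where "lat s t = Complex (s + t / 2) (t * sqrt 3 / 2)"

definition hexq :: "real \<Rightarrow> real \<Rightarrow> real" where "hexq s t = s\<^sup>2 + s * t + t\<^sup>2"

lemma cST_lat [simp]: "cS (lat s t) = s" "cT (lat s t) = t"
  by (simp_all add: cS_def cT_def lat_def)

lemma lat_cST [simp]: "lat (cS u) (cT u) = u"
  by (rule complex_eqI) (simp_all add: cS_def cT_def lat_def)

lemma cST_linear [simp]:
  "cS (u + v) = cS u + cS v" "cT (u + v) = cT u + cT v"
  "cS (u - v) = cS u - cS v" "cT (u - v) = cT u - cT v"
  "cS (of_real a * u) = a * cS u" "cT (of_real a * u) = a * cT u"
  "cS 0 = 0" "cT 0 = 0"
  by (simp_all add: cS_def cT_def field_simps)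

lemma cST_eq_iff: "u = v \<longleftrightarrow> cS u = cS v \<and> cT u = cT v"
  by (metis lat_cST)

lemma cmod_hexq: "(cmod u)\<^sup>2 = hexq (cS u) (cT u)"
proof -
  define w where "w = Im u / sqrt 3"
  have im: "(Im u)\<^sup>2 = 3 * w\<^sup>2" by (simp add: w_def power_divide)
  have st: "cS u = Re u - w" "cT u = 2 * w" by (simp_all add: cS_def cT_def w_def)
  show ?thesis
    unfolding cmod_power2 hexq_def st im by (simp add: power2_eq_square algebra_simps)
qed

lemma dist_hexq: "(dist u v)\<^sup>2 = hexq (cS u - cS v) (cT u - cT v)"
  using cmod_hexq[of "u - v"] by (simp add: dist_norm)

lemma unit_triI:
  assumes "hexq (cS z0 - cS z1) (cT z0 - cT z1) = 1" "hexq (cS z0 - cS z2) (cT z0 - cT z2) = 1"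
    "hexq (cS z1 - cS z2) (cT z1 - cT z2) = 1"
  shows "unit_tri z0 z1 z2"
proof -
  have "dist u v = 1" if "hexq (cS u - cS v) (cT u - cT v) = 1" for u v
    using dist_hexq[of u v] that by (simp add: power2_eq_1_iff) (smt (verit) zero_le_dist)
  then show ?thesis using assms by (simp add: unit_tri_def)
qed

lemma cST_cpt:
  "cS (cpt z0 z1 z2 b0 b1 b2) = b0 * cS z0 + b1 * cS z1 + b2 * cS z2"
  "cT (cpt z0 z1 z2 b0 b1 b2) = b0 * cT z0 + b1 * cT z1 + b2 * cT z2"
  by (simp_all add: cpt_def)

text \<open>The developing map of the region, given on the whole plane through the lattice cell of
  u. Whether that cell is a triangle of the region is recorded separately by
  \<open>Ptri\<close>.\<close>

definition fm :: "word \<Rightarrow> (nat \<Rightarrow> bool) \<Rightarrow> complex \<Rightarrow> point" where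
  "fm h bs u = (let m = \<lfloor>cS u\<rfloor>; n = \<lfloor>cT u\<rfloor>; x = cS u - m; y = cT u - n in
     if x + y < 1 then bpt (V h bs m n) (V h bs (m + 1) n) (V h bs m (n + 1)) (1 - x - y) x y
     else bpt (V h bs (m + 1) (n + 1)) (V h bs (m + 1) n) (V h bs m (n + 1)) (x + y - 1) (1 - y) (1 - x))"

definition in_up :: "int \<Rightarrow> int \<Rightarrow> complex \<Rightarrow> bool" where
  "in_up m n u \<longleftrightarrow> real_of_int m \<le> cS u \<and> real_of_int n \<le> cT u \<and> cS u + cT u \<le> m + n + 1"

definition in_dn :: "int \<Rightarrow> int \<Rightarrow> complex \<Rightarrow> bool" where
  "in_dn m n u \<longleftrightarrow> cS u \<le> m + 1 \<and> cT u \<le> n + 1 \<and> real_of_int (m + n + 1) \<le> cS u + cT u"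

lemma fm_floor:
  assumes "real_of_int m \<le> cS u" "cS u < m + 1" "real_of_int n \<le> cT u" "cT u < n + 1"
  shows "fm h bs u = (if cS u - m + (cT u - n) < 1
     then bpt (V h bs m n) (V h bs (m + 1) n) (V h bs m (n + 1)) (1 - (cS u - m) - (cT u - n)) (cS u - m) (cT u - n)
     else bpt (V h bs (m + 1) (n + 1)) (V h bs (m + 1) n) (V h bs m (n + 1)) (cS u - m + (cT u - n) - 1) (1 - (cT u - n)) (1 - (cS u - m)))"
proof -
  have "\<lfloor>cS u\<rfloor> = m" "\<lfloor>cT u\<rfloor> = n" using assms by linarith+
  then show ?thesis by (simp add: fm_def Let_def)
qed

lemma bpt_zero: "bpt v0 v1 v2 0 x y = bpt v0' v1 v2 0 x y"
  by (simp add: bpt_def)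

text \<open>The formula extends to the closed triangle: at boundary points the floors may select a
  neighbouring cell, which gives the same point of X.\<close>

lemma fm_up:
  assumes "in_up m n u"
  shows "fm h bs u = bpt (V h bs m n) (V h bs (m + 1) n) (V h bs m (n + 1))
    (1 - (cS u - m) - (cT u - n)) (cS u - m) (cT u - n)"
proof -
  have u: "real_of_int m \<le> cS u" "real_of_int n \<le> cT u" "cS u + cT u \<le> m + n + 1" using assms by (auto simp: in_up_def)
  then consider "cS u < m + 1" "cT u < n + 1" | "cS u = m + 1" "cT u = n" | "cS u = m" "cT u = n + 1" by linarith
  then show ?thesis
  proof cases
    case 1
    show ?thesis
    proof (cases "cS u - m + (cT u - n) < 1")
      case True
      then show ?thesis using fm_floor[OF u(1) 1(1) u(2) 1(2)] by simp
    next
      case False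
      then have e: "cT u - n = 1 - (cS u - m)" using u by linarith
      show ?thesis unfolding fm_floor[OF u(1) 1(1) u(2) 1(2)] e using bpt_zero by simp
    qed
  next
    case 2
    have "fm h bs u = bpt (V h bs (m + 1) n) (V h bs (m + 1 + 1) n) (V h bs (m + 1) (n + 1)) 1 0 0"
      using fm_floor[of "m + 1" u n] 2 by simp
    then show ?thesis using 2 by (simp add: bpt_vertex)
  next
    case 3
    have "fm h bs u = bpt (V h bs m (n + 1)) (V h bs (m + 1) (n + 1)) (V h bs m (n + 1 + 1)) 1 0 0"
      using fm_floor[of m u "n + 1"] 3 by simp
    then show ?thesis using 3 by (simp add: bpt_vertex)
  qed
qed

lemma fm_dn:
  assumes "in_dn m n u"
  shows "fm h bs u = bpt (V h bs (m + 1) (n + 1)) (V h bs (m + 1) n) (V h bs m (n + 1))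
    (cS u - m + (cT u - n) - 1) (1 - (cT u - n)) (1 - (cS u - m))"
proof -
  have u: "cS u \<le> m + 1" "cT u \<le> n + 1" "real_of_int (m + n + 1) \<le> cS u + cT u" using assms by (auto simp: in_dn_def)
  then have l: "real_of_int m \<le> cS u" "real_of_int n \<le> cT u" by (simp_all add: algebra_simps)
  consider "cS u < m + 1" "cT u < n + 1" | "cS u = m + 1" "cT u < n + 1" | "cS u < m + 1" "cT u = n + 1"
    | "cS u = m + 1" "cT u = n + 1" using u by linarith
  then show ?thesis
  proof cases
    case 1
    then have "\<not> cS u - m + (cT u - n) < 1" using u by simp
    then show ?thesis using fm_floor[OF l(1) 1(1) l(2) 1(2)] by simp
  next
    case 2
    have "fm h bs u = bpt (V h bs (m + 1) n) (V h bs (m + 1 + 1) n) (V h bs (m + 1) (n + 1)) (1 - (cT u - n)) 0 (cT u - n)"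
      using fm_floor[of "m + 1" u n] 2 l by simp
    then show ?thesis using 2 by (simp add: bpt_def fun_eq_iff)
  next
    case 3
    have "fm h bs u = bpt (V h bs m (n + 1)) (V h bs (m + 1) (n + 1)) (V h bs m (n + 1 + 1)) (1 - (cS u - m)) (cS u - m) 0"
      using fm_floor[of m u "n + 1"] 3 l by simp
    then show ?thesis using 3 by (simp add: bpt_def fun_eq_iff)
  next
    case 4
    have "fm h bs u = bpt (V h bs (m + 1) (n + 1)) (V h bs (m + 1 + 1) (n + 1)) (V h bs (m + 1) (n + 1 + 1)) 1 0 0"
      using fm_floor[of "m + 1" u "n + 1"] 4 by simp
    then show ?thesis using 4 by (simp add: bpt_vertex)
  qed
qed

lemma fm_vertex: "fm h bs (lat (of_int m) (of_int n)) = vertex_point (V h bs m n)"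
  using fm_up[of m n "lat (of_int m) (of_int n)"] by (simp add: in_up_def bpt_vertex)

definition Ptri :: "complex \<Rightarrow> complex \<Rightarrow> bool" where
  "Ptri u v \<longleftrightarrow> (\<exists>m n. upP m n \<and> in_up m n u \<and> in_up m n v \<or> dnP m n \<and> in_dn m n u \<and> in_dn m n v)"

lemma cell_representation:
  assumes "Ptri u v"
  obtains v0 v1 v2 z0 z1 z2 b0 b1 b2 c0 c1 c2 where
    "Xtri v0 v1 v2" "unit_tri z0 z1 z2" "bary b0 b1 b2" "bary c0 c1 c2"
    "u = cpt z0 z1 z2 b0 b1 b2" "v = cpt z0 z1 z2 c0 c1 c2"
    "fm h bs u = bpt v0 v1 v2 b0 b1 b2" "fm h bs v = bpt v0 v1 v2 c0 c1 c2"
proof -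
  obtain m n where "upP m n \<and> in_up m n u \<and> in_up m n v \<or> dnP m n \<and> in_dn m n u \<and> in_dn m n v"
    using assms by (auto simp: Ptri_def)
  then consider "upP m n" "in_up m n u" "in_up m n v" | "dnP m n" "in_dn m n u" "in_dn m n v" by blast
  then show thesis
  proof cases
    case 1
    have z: "unit_tri (lat m n) (lat (m + 1) n) (lat m (n + 1))"
      by (rule unit_triI) (simp_all add: hexq_def)
    have b: "bary (1 - (cS u - m) - (cT u - n)) (cS u - m) (cT u - n)" if "in_up m n u" for u
      using that by (simp add: bary_def in_up_def)
    have c: "u = cpt (lat m n) (lat (m + 1) n) (lat m (n + 1)) (1 - (cS u - m) - (cT u - n)) (cS u - m) (cT u - n)" for u
      unfolding cST_eq_iff[of u] by (simp add: cST_cpt algebra_simps)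
    show thesis
      by (rule that[OF otri_Xtri[OF otri_up[OF 1(1)]] z b[OF 1(2)] b[OF 1(3)] c c fm_up[OF 1(2)] fm_up[OF 1(3)]])
  next
    case 2
    have z: "unit_tri (lat (m + 1) (n + 1)) (lat (m + 1) n) (lat m (n + 1))"
      by (rule unit_triI) (simp_all add: hexq_def)
    have b: "bary (cS u - m + (cT u - n) - 1) (1 - (cT u - n)) (1 - (cS u - m))" if "in_dn m n u" for u
      using that by (simp add: bary_def in_dn_def)
    have c: "u = cpt (lat (m + 1) (n + 1)) (lat (m + 1) n) (lat m (n + 1)) (cS u - m + (cT u - n) - 1) (1 - (cT u - n)) (1 - (cS u - m))" for u
      unfolding cST_eq_iff[of u] by (simp add: cST_cpt algebra_simps)
    show thesis
      by (rule that[OF otri_Xtri[OF otri_dn[OF 2(1)]] z b[OF 2(2)] b[OF 2(3)] c c fm_dn[OF 2(2)] fm_dn[OF 2(3)]])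
  qed
qed

lemma Ptri_Xpoints: "Ptri u u \<Longrightarrow> fm h bs u \<in> Xpoints"
  by (rule cell_representation[of u u h bs]) (simp_all add: bpt_Xpoints)

lemma Ptri_Xdist:
  assumes "Ptri u v"
  shows "Xdist (fm h bs u) (fm h bs v) = dist u v"
  by (rule cell_representation[OF assms, of h bs]) (simp add: Xdist_bpt_eq_dist)

lemma aff_bpt:
  assumes "Xtri v0 v1 v2"
  shows "aff F (bpt v0 v1 v2 b0 b1 b2) = b0 * F v0 + b1 * F v1 + b2 * F v2"
proof -
  have "aff F (bpt v0 v1 v2 b0 b1 b2) = (\<Sum>v\<in>{v0, v1, v2}. bpt v0 v1 v2 b0 b1 b2 v * real_of_int (F v))"
    by (rule aff_on[OF _ supp_bpt]) simp
  then show ?thesis using assms bpt_simps[OF assms] by (simp add: sum3 Xtri_def)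
qed

text \<open>The height functions of \<open>flat_heights\<close> are linear on a finite box only, so
  M is taken large enough for the cell of u.\<close>

lemma aff_linear:
  assumes "Ptri u u"
  shows "\<exists>M. \<forall>F \<alpha> \<beta> \<gamma>. (\<forall>s t. inP s t \<longrightarrow> \<bar>s\<bar> \<le> int M \<longrightarrow> \<bar>t\<bar> \<le> int M \<longrightarrow> F (V h bs s t) = \<alpha> * s + \<beta> * t + \<gamma>)
    \<longrightarrow> aff F (fm h bs u) = \<alpha> * cS u + \<beta> * cT u + \<gamma>"
proof -
  obtain m n where mn: "upP m n \<and> in_up m n u \<or> dnP m n \<and> in_dn m n u"
    using assms by (auto simp: Ptri_def)
  define M where "M = nat (\<bar>m\<bar> + \<bar>n\<bar> + 1)"
  have "aff F (fm h bs u) = \<alpha> * cS u + \<beta> * cT u + \<gamma>"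
    if F: "\<forall>s t. inP s t \<longrightarrow> \<bar>s\<bar> \<le> int M \<longrightarrow> \<bar>t\<bar> \<le> int M \<longrightarrow> F (V h bs s t) = \<alpha> * s + \<beta> * t + \<gamma>" for F \<alpha> \<beta> \<gamma>
    using mn
  proof
    assume "upP m n \<and> in_up m n u"
    then have up: "upP m n" "in_up m n u" by auto
    have "inP m n" "inP (m + 1) n" "inP m (n + 1)" using up(1) by (auto simp: inP_def upP_def split: if_splits)
    then have "F (V h bs m n) = \<alpha> * m + \<beta> * n + \<gamma>" "F (V h bs (m + 1) n) = \<alpha> * (m + 1) + \<beta> * n + \<gamma>"
      "F (V h bs m (n + 1)) = \<alpha> * m + \<beta> * (n + 1) + \<gamma>"
      using F by (auto simp: M_def)
    then show ?thesis
      unfolding fm_up[OF up(2)] aff_bpt[OF otri_Xtri[OF otri_up[OF up(1)]]] by (simp add: algebra_simps)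
  next
    assume "dnP m n \<and> in_dn m n u"
    then have dn: "dnP m n" "in_dn m n u" by auto
    have "inP (m + 1) (n + 1)" "inP (m + 1) n" "inP m (n + 1)" using dn(1) by (auto simp: inP_def dnP_def split: if_splits)
    then have "F (V h bs (m + 1) (n + 1)) = \<alpha> * (m + 1) + \<beta> * (n + 1) + \<gamma>" "F (V h bs (m + 1) n) = \<alpha> * (m + 1) + \<beta> * n + \<gamma>"
      "F (V h bs m (n + 1)) = \<alpha> * m + \<beta> * (n + 1) + \<gamma>"
      using F by (auto simp: M_def)
    then show ?thesis
      unfolding fm_dn[OF dn(2)] aff_bpt[OF otri_Xtri[OF otri_dn[OF dn(1)]]] by (simp add: algebra_simps)
  qed
  then show ?thesis by blast
qed

text \<open>(-2x - y)^2 + (x - y)^2 + (x + 2y)^2 = 6 (x^2 + x y + y^2) turns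
  \<open>Xdist_lower\<close> into the Euclidean distance.\<close>

lemma fm_lower:
  assumes "bs 0" "Ptri u u" "Ptri v v"
  shows "dist u v \<le> Xdist (fm h bs u) (fm h bs v)"
proof -
  let ?L = "\<lambda>M w. \<forall>F \<alpha> \<beta> \<gamma>. (\<forall>s t. inP s t \<longrightarrow> \<bar>s\<bar> \<le> int M \<longrightarrow> \<bar>t\<bar> \<le> int M \<longrightarrow> F (V h bs s t) = \<alpha> * s + \<beta> * t + \<gamma>)
    \<longrightarrow> aff F (fm h bs w) = \<alpha> * cS w + \<beta> * cT w + \<gamma>"
  obtain M1 where M1: "?L M1 u" using aff_linear[OF assms(2)] by blast
  obtain M2 where M2: "?L M2 v" using aff_linear[OF assms(3)] by blast
  define M where "M = max M1 M2"
  obtain F1 F2 F3 c1 c2 c3 where H: "height F1" "height F2" "height F3"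
    and F1: "\<And>s t. inP s t \<Longrightarrow> \<bar>s\<bar> \<le> int M \<Longrightarrow> \<bar>t\<bar> \<le> int M \<Longrightarrow> F1 (V h bs s t) = - 2 * s - t + c1"
    and F2: "\<And>s t. inP s t \<Longrightarrow> \<bar>s\<bar> \<le> int M \<Longrightarrow> \<bar>t\<bar> \<le> int M \<Longrightarrow> F2 (V h bs s t) = s - t + c2"
    and F3: "\<And>s t. inP s t \<Longrightarrow> \<bar>s\<bar> \<le> int M \<Longrightarrow> \<bar>t\<bar> \<le> int M \<Longrightarrow> F3 (V h bs s t) = s + 2 * t + c3"
    by (rule flat_heights[where bs = bs and M = M and h = h, OF assms(1)]) (rule that; assumption)
  have M: "int M1 \<le> int M" "int M2 \<le> int M" by (simp_all add: M_def)
  have lin: "aff F (fm h bs u) - aff F (fm h bs v) = \<alpha> * (cS u - cS v) + \<beta> * (cT u - cT v)"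
    if "\<And>s t. inP s t \<Longrightarrow> \<bar>s\<bar> \<le> int M \<Longrightarrow> \<bar>t\<bar> \<le> int M \<Longrightarrow> F (V h bs s t) = \<alpha> * s + \<beta> * t + \<gamma>" for F \<alpha> \<beta> \<gamma>
  proof -
    have "aff F (fm h bs u) = \<alpha> * cS u + \<beta> * cT u + \<gamma>"
      by (rule M1[rule_format]) (use that M in \<open>meson order_trans\<close>)
    moreover have "aff F (fm h bs v) = \<alpha> * cS v + \<beta> * cT v + \<gamma>"
      by (rule M2[rule_format]) (use that M in \<open>meson order_trans\<close>)
    ultimately show ?thesis by (simp add: algebra_simps)
  qed
  define x y where "x = cS u - cS v" and "y = cT u - cT v"
  have "(- 2 * x - y)\<^sup>2 + (x - y)\<^sup>2 + (x + 2 * y)\<^sup>2 \<le> 6 * (Xdist (fm h bs u) (fm h bs v))\<^sup>2"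
  proof (rule Xdist_lower[OF H])
    show "- 2 * x - y = aff F1 (fm h bs u) - aff F1 (fm h bs v)"
      using lin[of F1 "-2" "-1" c1] F1 by (simp add: x_def y_def)
    show "x - y = aff F2 (fm h bs u) - aff F2 (fm h bs v)"
      using lin[of F2 1 "-1" c2] F2 by (simp add: x_def y_def)
    show "x + 2 * y = aff F3 (fm h bs u) - aff F3 (fm h bs v)"
      using lin[of F3 1 2 c3] F3 by (simp add: x_def y_def)
  qed (use assms in \<open>simp_all add: Ptri_Xpoints\<close>)
  then have "(dist u v)\<^sup>2 \<le> (Xdist (fm h bs u) (fm h bs v))\<^sup>2"
    unfolding dist_hexq hexq_def x_def[symmetric] y_def[symmetric] by (simp add: power2_eq_square algebra_simps)
  then show ?thesis
    by (rule power2_le_imp_le) (simp add: Xdist_nonneg Ptri_Xpoints assms)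
qed

text \<open>No lattice line of the corresponding direction separates the two points.\<close>

definition nib :: "real \<Rightarrow> real \<Rightarrow> bool" where
  "nib x y \<longleftrightarrow> (\<forall>k::int. \<not> (min x y < k \<and> k < max x y))"

lemma nib_cell:
  fixes x y :: real
  assumes "nib x y"
  obtains m :: int where "m \<le> x" "m \<le> y" "x \<le> m + 1" "y \<le> m + 1"
proof -
  define m where "m = \<lfloor>min x y\<rfloor>"
  have m: "m \<le> min x y" "min x y < real_of_int (m + 1)" unfolding m_def by linarith+
  then have "\<not> real_of_int (m + 1) < max x y" using assms[unfolded nib_def, rule_format, of "m + 1"] by blast
  then show thesis using that[of m] m by auto
qed

lemma nib_local: "\<exists>d>0. \<forall>y. \<bar>y - x\<bar> < d \<longrightarrow> nib x y"
proof (cases "x = of_int \<lfloor>x\<rfloor>")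
  case True
  have "nib x y" if "\<bar>y - x\<bar> < 1" for y
    unfolding nib_def
  proof (intro allI notI)
    fix k :: int assume k: "min x y < k \<and> k < max x y"
    then have "of_int \<lfloor>x\<rfloor> - 1 < real_of_int k" "real_of_int k < of_int \<lfloor>x\<rfloor> + 1" using that True by linarith+
    then have "k = \<lfloor>x\<rfloor>" by linarith
    then show False using k True by linarith
  qed
  then show ?thesis by (intro exI[of _ 1]) auto
next
  case False
  define d where "d = min (x - \<lfloor>x\<rfloor>) (\<lfloor>x\<rfloor> + 1 - x)"
  have "d > 0" using False by (simp add: d_def) linarith
  moreover have "nib x y" if "\<bar>y - x\<bar> < d" for y
    unfolding nib_def
  proof (intro allI notI)
    fix k :: int assume k: "min x y < k \<and> k < max x y"
    have "of_int \<lfloor>x\<rfloor> < y" "y < of_int \<lfloor>x\<rfloor> + 1" "of_int \<lfloor>x\<rfloor> < x" "x < of_int \<lfloor>x\<rfloor> + 1"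
      using that False by (auto simp: d_def)
    then have "of_int \<lfloor>x\<rfloor> < real_of_int k" "real_of_int k < of_int \<lfloor>x\<rfloor> + 1" using k by linarith+
    then have "\<lfloor>x\<rfloor> < k" "k < \<lfloor>x\<rfloor> + 1" by linarith+
    then show False by linarith
  qed
  ultimately show ?thesis by blast
qed

text \<open>The first two conditions give a common parallelogram, the third a common side of its
  diagonal.\<close>

lemma common_triangle:
  assumes "nib (cS u) (cS v)" "nib (cT u) (cT v)" "nib (cS u + cT u) (cS v + cT v)"
  obtains m n where "in_up m n u \<and> in_up m n v \<or> in_dn m n u \<and> in_dn m n v"
proof -
  obtain m :: int where m: "m \<le> cS u" "m \<le> cS v" "cS u \<le> m + 1" "cS v \<le> m + 1" using nib_cell[OF assms(1)] by auto
  obtain n :: int where n: "n \<le> cT u" "n \<le> cT v" "cT u \<le> n + 1" "cT v \<le> n + 1" using nib_cell[OF assms(2)] by auto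
  have "\<not> (min (cS u + cT u) (cS v + cT v) < real_of_int (m + n + 1) \<and> real_of_int (m + n + 1) < max (cS u + cT u) (cS v + cT v))"
    using assms(3) unfolding nib_def by blast
  then show thesis using that[of m n] m n by (auto simp: in_up_def in_dn_def min_def max_def split: if_splits)
qed

text \<open>The removed wedge of 120 degrees with apex 0, including its sides.\<close>

definition inW :: "complex \<Rightarrow> bool" where
  "inW u \<longleftrightarrow> (cT u \<ge> 0 \<and> cS u + cT u \<le> 0) \<or> (cT u \<le> 0 \<and> cS u \<le> 0)"

lemma up_inW: "in_up m n u \<Longrightarrow> \<not> upP m n \<Longrightarrow> inW u"
proof -
  assume u: "in_up m n u" and "\<not> upP m n"
  then consider "n \<ge> 0" "m + n \<le> -1" | "n \<le> -1" "m \<le> -1" by (auto simp: upP_def split: if_splits)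
  then show "inW u"
  proof cases
    case 1
    then have "real_of_int n \<ge> 0" "real_of_int m + real_of_int n \<le> -1" by linarith+
    then show ?thesis using u by (auto simp: inW_def in_up_def)
  next
    case 2
    then have "real_of_int n \<le> -1" "real_of_int m \<le> -1" by linarith+
    then have "cT u \<le> 0 \<and> cS u \<le> 0" using u unfolding in_up_def by linarith
    then show ?thesis by (simp add: inW_def)
  qed
qed

lemma dn_inW: "in_dn m n u \<Longrightarrow> \<not> dnP m n \<Longrightarrow> inW u"
proof -
  assume u: "in_dn m n u" and "\<not> dnP m n"
  then consider "n \<ge> 0" "m + n \<le> -2" | "n \<le> -1" "m \<le> -1" by (auto simp: dnP_def split: if_splits)
  then show "inW u"
  proof cases
    case 1
    then have "real_of_int n \<ge> 0" "real_of_int m + real_of_int n \<le> -2" by linarith+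
    then have "cT u \<ge> 0 \<and> cS u + cT u \<le> 0" using u unfolding in_dn_def by simp
    then show ?thesis by (simp add: inW_def)
  next
    case 2
    then have "real_of_int n \<le> -1" "real_of_int m \<le> -1" by linarith+
    then have "cT u \<le> 0 \<and> cS u \<le> 0" using u unfolding in_dn_def by linarith
    then show ?thesis by (simp add: inW_def)
  qed
qed

lemma hexq_zero:
  assumes "hexq s t \<le> 0"
  shows "s = 0 \<and> t = 0"
proof -
  have e: "4 * hexq s t = (2 * s + t)\<^sup>2 + 3 * t\<^sup>2" by (simp add: hexq_def power2_eq_square algebra_simps)
  have "(2 * s + t)\<^sup>2 + 3 * t\<^sup>2 \<le> 0" using e assms by linarith
  then have "3 * t\<^sup>2 \<le> 0" "(2 * s + t)\<^sup>2 \<le> 0" by (smt (verit) zero_le_power2)+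
  then show "s = 0 \<and> t = 0" by simp
qed

context
  fixes h :: word and bs :: "nat \<Rightarrow> bool" and r cs ct :: real
  assumes bs0: "bs 0" and c: "0 \<le> ct" "ct \<le> cs" and r: "0 \<le> r" "r\<^sup>2 \<le> hexq cs ct"
begin

text \<open>The centre c makes an angle of at least 90 degrees with every point u of the wedge, so
  |u - c|^2 >= |u|^2 + |c|^2 >= |u|^2 + r^2. The expression bounded in the proof is twice the inner
  product of u and c.\<close>

lemma disc_avoids_wedge:
  assumes "u \<in> cball (lat cs ct) r" "inW u"
  shows "u = 0"
proof -
  have "(dist u (lat cs ct))\<^sup>2 \<le> r\<^sup>2" using assms(1) by (intro power_mono) (auto simp: dist_commute)
  then have le: "hexq (cS u - cs) (cT u - ct) \<le> hexq cs ct" unfolding dist_hexq using r(2) by simp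
  have "cS u * (2 * cs + ct) + cT u * (2 * ct + cs) \<le> 0"
    using assms(2) unfolding inW_def
  proof
    assume a: "0 \<le> cT u \<and> cS u + cT u \<le> 0"
    then have "cS u * (2 * cs + ct) \<le> (- cT u) * (2 * cs + ct)" using c by (intro mult_right_mono) auto
    moreover have "cT u * (ct - cs) \<le> 0" using a c by (simp add: mult_nonneg_nonpos)
    ultimately show ?thesis by (simp add: algebra_simps)
  next
    assume a: "cT u \<le> 0 \<and> cS u \<le> 0"
    then have "cS u * (2 * cs + ct) \<le> 0" "cT u * (2 * ct + cs) \<le> 0" using c by (auto intro: mult_nonpos_nonneg)
    then show ?thesis by linarith
  qed
  then have "hexq (cS u) (cT u) \<le> 0" using le by (simp add: hexq_def power2_eq_square algebra_simps)
  then show ?thesis using hexq_zero cST_eq_iff[of u 0] by auto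
qed

lemma disc_Ptri_self:
  assumes "u \<in> cball (lat cs ct) r"
  shows "Ptri u u"
proof (cases "inW u")
  case True
  then have "u = 0" using disc_avoids_wedge assms by blast
  then show ?thesis unfolding Ptri_def by (intro exI[of _ 0]) (simp add: upP_def in_up_def)
next
  case False
  have "nib x x" for x by (simp add: nib_def)
  then obtain m n where "in_up m n u \<or> in_dn m n u" using common_triangle[of u u] by metis
  then show ?thesis unfolding Ptri_def using False up_inW dn_inW by blast
qed

lemma disc_Ptri:
  assumes "u \<in> cball (lat cs ct) r" "v \<in> cball (lat cs ct) r"
    and "nib (cS u) (cS v)" "nib (cT u) (cT v)" "nib (cS u + cT u) (cS v + cT v)"
  shows "Ptri u v"
proof (cases "u = v")
  case True
  then show ?thesis using disc_Ptri_self assms by blast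
next
  case False
  then have "\<not> inW u \<or> \<not> inW v" using disc_avoids_wedge assms(1,2) by blast
  then show ?thesis
    using common_triangle[OF assms(3-5)] up_inW dn_inW unfolding Ptri_def by metis
qed

text \<open>The segment from u to v maps to a path in X of the same length: each of its points
  shares a triangle with all nearby points of the segment, and there \<open>fm\<close> preserves
  distances. Bolzano's principle adds up the pieces.\<close>

lemma disc_upper:
  assumes "u \<in> cball (lat cs ct) r" "v \<in> cball (lat cs ct) r"
  shows "Xdist (fm h bs u) (fm h bs v) \<le> dist u v"
proof -
  define g where "g = (\<lambda>x. u + of_real x * (v - u))"
  define f where "f = (\<lambda>x. fm h bs (g x))"
  have g01: "f 0 = fm h bs u" "f 1 = fm h bs v" by (simp_all add: f_def g_def)
  have gin: "g x \<in> cball (lat cs ct) r" if "0 \<le> x" "x \<le> 1" for x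
  proof -
    have "g x = (1 - x) *\<^sub>R u + x *\<^sub>R v" by (simp add: g_def scaleR_conv_of_real algebra_simps)
    then show ?thesis using convexD_alt[OF convex_cball assms that] by simp
  qed
  have gd: "dist (g x) (g y) = \<bar>x - y\<bar> * dist u v" for x y
  proof -
    have "g x - g y = of_real (x - y) * (v - u)" by (simp add: g_def algebra_simps)
    then show ?thesis by (simp add: dist_norm norm_mult norm_minus_commute del: of_real_diff)
  qed
  have "0 \<le> (0::real) \<and> (1::real) \<le> 1 \<longrightarrow> Xdist (f 0) (f 1) \<le> (1 - 0) * dist u v"
  proof (rule Bolzano[where P = "\<lambda>x y. 0 \<le> x \<and> y \<le> 1 \<longrightarrow> Xdist (f x) (f y) \<le> (y - x) * dist u v"])
    fix x y z :: real
    assume 1: "0 \<le> x \<and> y \<le> 1 \<longrightarrow> Xdist (f x) (f y) \<le> (y - x) * dist u v"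
      "0 \<le> y \<and> z \<le> 1 \<longrightarrow> Xdist (f y) (f z) \<le> (z - y) * dist u v" "x \<le> y" "y \<le> z"
    show "0 \<le> x \<and> z \<le> 1 \<longrightarrow> Xdist (f x) (f z) \<le> (z - x) * dist u v"
    proof
      assume 2: "0 \<le> x \<and> z \<le> 1"
      have "Xdist (f x) (f z) \<le> Xdist (f x) (f y) + Xdist (f y) (f z)"
        unfolding f_def by (intro Xdist_triangle Ptri_Xpoints disc_Ptri_self gin) (use 1 2 in auto)
      also have "\<dots> \<le> (y - x) * dist u v + (z - y) * dist u v" using 1 2 by (intro add_mono) auto
      finally show "Xdist (f x) (f z) \<le> (z - x) * dist u v" by (simp add: algebra_simps)
    qed
  next
    fix x :: real assume x: "0 \<le> x" "x \<le> 1"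
    define p q where "p = cS (v - u)" and "q = cT (v - u)"
    have gc: "cS (g y) = cS u + y * p" "cT (g y) = cT u + y * q" for y by (simp_all add: g_def p_def q_def)
    obtain d1 where d1: "d1 > 0" "\<And>y. \<bar>y - cS (g x)\<bar> < d1 \<Longrightarrow> nib (cS (g x)) y" using nib_local by blast
    obtain d2 where d2: "d2 > 0" "\<And>y. \<bar>y - cT (g x)\<bar> < d2 \<Longrightarrow> nib (cT (g x)) y" using nib_local by blast
    obtain d3 where d3: "d3 > 0" "\<And>y. \<bar>y - (cS (g x) + cT (g x))\<bar> < d3 \<Longrightarrow> nib (cS (g x) + cT (g x)) y" using nib_local by blast
    define B where "B = \<bar>p\<bar> + \<bar>q\<bar> + 1"
    have B: "B > 0" by (simp add: B_def)
    define d where "d = min d1 (min d2 d3) / B"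
    have d0: "d > 0" using d1 d2 d3 B by (simp add: d_def)
    have loc: "Ptri (g x) (g y)" if y: "0 \<le> y" "y \<le> 1" "\<bar>y - x\<bar> < d" for y
    proof -
      have dB: "\<bar>y - x\<bar> * B < min d1 (min d2 d3)" using y(3) B by (simp add: d_def pos_less_divide_eq)
      have "\<bar>(y - x) * k\<bar> < min d1 (min d2 d3)" if "\<bar>k\<bar> \<le> B" for k
      proof -
        have "\<bar>(y - x) * k\<bar> \<le> \<bar>y - x\<bar> * B" unfolding abs_mult using that by (intro mult_left_mono) auto
        then show ?thesis using dB by linarith
      qed
      then have k: "\<bar>(y - x) * p\<bar> < d1" "\<bar>(y - x) * q\<bar> < d2" "\<bar>(y - x) * (p + q)\<bar> < d3"
        by (auto simp: B_def) 
      have "\<bar>cS (g y) - cS (g x)\<bar> < d1" "\<bar>cT (g y) - cT (g x)\<bar> < d2" "\<bar>(cS (g y) + cT (g y)) - (cS (g x) + cT (g x))\<bar> < d3"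
        using k unfolding gc by (simp_all add: algebra_simps)
      then show ?thesis by (intro disc_Ptri gin d1 d2 d3 x y)
    qed
    have "Xdist (f a) (f b) \<le> (b - a) * dist u v"
      if ab: "a \<le> x" "x \<le> b" "b - a < d" "0 \<le> a" "b \<le> 1" for a b
    proof -
      have "f y \<in> Xpoints" if "0 \<le> y" "y \<le> 1" for y
        unfolding f_def by (rule Ptri_Xpoints[OF disc_Ptri_self[OF gin[OF that]]])
      then have "Xdist (f a) (f b) \<le> Xdist (f a) (f x) + Xdist (f x) (f b)"
        using ab x by (intro Xdist_triangle) auto
      also have "Xdist (f a) (f x) = Xdist (f x) (f a)"
        by (rule Xdist_commute)
      also have "Xdist (f x) (f a) + Xdist (f x) (f b) = dist (g x) (g a) + dist (g x) (g b)"
        using Ptri_Xdist[OF loc[of a]] Ptri_Xdist[OF loc[of b]] ab x by (simp add: f_def)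
      also have "\<dots> = (b - a) * dist u v" using ab unfolding gd by (simp add: algebra_simps)
      finally show ?thesis .
    qed
    then show "\<exists>d>0. \<forall>a b. a \<le> x \<and> x \<le> b \<and> b - a < d \<longrightarrow> 0 \<le> a \<and> b \<le> 1 \<longrightarrow> Xdist (f a) (f b) \<le> (b - a) * dist u v"
      using d0 by blast
  qed simp
  then show ?thesis by (simp add: g01)
qed

lemma disc_isometry:
  assumes "u \<in> cball (lat cs ct) r" "v \<in> cball (lat cs ct) r"
  shows "Xdist (fm h bs u) (fm h bs v) = dist u v"
  using disc_upper[OF assms] fm_lower[of bs, OF bs0 disc_Ptri_self[OF assms(1)] disc_Ptri_self[OF assms(2)]]
  by (rule antisym)

end

section \<open>Discs that extend to no flat\<close>

text \<open>The unit sphere inside the ball determines an orthogonal map. Distances to the images of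
  0 and of u / |u| force equality in Cauchy-Schwarz, which fixes the image of u.\<close>

lemma isometry_cball_extend:
  fixes f :: "'a::real_inner \<Rightarrow> 'a"
  assumes "1 \<le> r" and iso: "\<And>u v. u \<in> cball 0 r \<Longrightarrow> v \<in> cball 0 r \<Longrightarrow> dist (f u) (f v) = dist u v"
  shows "\<exists>g. (\<forall>u v. dist (g u) (g v) = dist u v) \<and> (\<forall>u\<in>cball 0 r. g u = f u)"
proof -
  define f0 where "f0 = (\<lambda>u. f u - f 0)"
  have n0: "norm (f0 u) = norm u" if "u \<in> cball 0 r" for u
    using iso[OF that, of 0] assms(1) by (simp add: f0_def dist_norm)
  have d0: "dist (f0 u) (f0 v) = dist u v" if "u \<in> cball 0 r" "v \<in> cball 0 r" for u v
    using iso[OF that] by (simp add: f0_def dist_norm)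
  obtain g where g: "orthogonal_transformation g" "\<forall>x. norm x = 1 \<longrightarrow> g x = f0 x"
    using isometry_sphere_extend[of f0] n0 d0 assms(1) by auto
  have lin: "linear g" using g(1) by (rule orthogonal_transformation_linear)
  have "f0 u = g u" if u: "u \<in> cball 0 r" for u
  proof (cases "u = 0")
    case True
    then show ?thesis using lin by (simp add: f0_def linear_0)
  next
    case False
    define x where "x = u /\<^sub>R norm u"
    have x: "norm x = 1" "u = norm u *\<^sub>R x" using False by (simp_all add: x_def)
    define v y where "v = f0 u" and "y = f0 x"
    have xr: "x \<in> cball 0 r" using x(1) assms(1) by simp
    have nv: "norm v = norm u" "norm y = 1" using n0[OF u] n0[OF xr] x(1) by (simp_all add: v_def y_def)
    have "u - x = (norm u - 1) *\<^sub>R x" using x(2) by (simp add: algebra_simps)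
    then have "dist u x = \<bar>norm u - 1\<bar>" using x(1) by (simp add: dist_norm)
    then have "(norm (v - y))\<^sup>2 = (norm u - 1)\<^sup>2" using d0[OF u xr] by (simp add: v_def y_def dist_norm)
    moreover have sq: "(norm (v - a *\<^sub>R y))\<^sup>2 = (norm v)\<^sup>2 - 2 * a * (v \<bullet> y) + a\<^sup>2 * (norm y)\<^sup>2" for a
      unfolding power2_norm_eq_inner by (simp add: inner_diff inner_commute algebra_simps power2_eq_square)
    ultimately have vy: "v \<bullet> y = norm u"
      using nv sq[of 1] by (simp add: power2_eq_square algebra_simps)
    have "(norm (v - norm u *\<^sub>R y))\<^sup>2 = 0" unfolding sq using nv vy by (simp add: power2_eq_square)
    then have "v = norm u *\<^sub>R y" by simp
    also have "\<dots> = g u" using g(2) x lin by (metis linear_scale y_def)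
    finally show ?thesis by (simp add: v_def)
  qed
  then have "\<forall>u\<in>cball 0 r. f 0 + g u = f u" by (auto simp: f0_def algebra_simps)
  moreover have "dist (f 0 + g u) (f 0 + g v) = dist u v" for u v
    using g(1) by (metis dist_add_cancel dist_norm linear_diff lin orthogonal_transformation_norm)
  ultimately show ?thesis by (intro exI[of _ "\<lambda>u. f 0 + g u"]) auto
qed

lemma vertex_point_inj: "vertex_point v = vertex_point w \<Longrightarrow> v = w"
  by (metis singleton_inject supp_vertex)

lemma dist_corner:
  assumes "unit_tri z0 z1 z2" "bary b0 b1 b2" "1 - e \<le> b0"
  shows "dist (cpt z0 z1 z2 b0 b1 b2) z0 \<le> e"
proof -
  have b: "0 \<le> b1" "0 \<le> b2" "b1 + b2 \<le> e" using assms(2,3) by (auto simp: bary_def)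
  have "(dist (cpt z0 z1 z2 b0 b1 b2) (cpt z0 z1 z2 1 0 0))\<^sup>2 = b1\<^sup>2 + b1 * b2 + b2\<^sup>2"
    using dist_cpt[OF assms(1,2), of 1 0 0] by (simp add: bary_def)
  also have "\<dots> \<le> (b1 + b2)\<^sup>2" using b by (simp add: power2_eq_square algebra_simps)
  also have "\<dots> \<le> e\<^sup>2" using b by (intro power_mono) auto
  finally have "(dist (cpt z0 z1 z2 b0 b1 b2) z0)\<^sup>2 \<le> e\<^sup>2" by (simp only: cpt_vertex)
  then show ?thesis by (rule power2_le_imp_le) (use b in linarith)
qed

text \<open>A neighbourhood of the corner z0 in the triangle lies in the disc, and from one corner
  the whole triangle is determined.\<close>

lemma fill_known:
  fixes \<Phi> :: "complex \<Rightarrow> point"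
  assumes X: "\<And>u. \<Phi> u \<in> Xpoints" and iso: "\<And>u v. Xdist (\<Phi> u) (\<Phi> v) = dist u v"
    and tri: "Xtri v0 v1 v2" "unit_tri z0 z1 z2" and z0: "dist z0 c < r"
    and known: "\<And>b0 b1 b2. bary b0 b1 b2 \<Longrightarrow> cpt z0 z1 z2 b0 b1 b2 \<in> cball c r \<Longrightarrow>
       \<Phi> (cpt z0 z1 z2 b0 b1 b2) = bpt v0 v1 v2 b0 b1 b2"
    and b: "bary b0 b1 b2"
  shows "\<Phi> (cpt z0 z1 z2 b0 b1 b2) = bpt v0 v1 v2 b0 b1 b2"
proof -
  define e where "e = min (1/2) (r - dist z0 c)"
  have e: "0 < e" "e < 1" "e \<le> r - dist z0 c" using z0 by (auto simp: e_def)
  show ?thesis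
  proof (rule fill_from_corner[OF X iso tri e(1,2) _ b])
    fix b0 b1 b2 assume a: "bary b0 b1 b2" "1 - e \<le> b0"
    have "dist (cpt z0 z1 z2 b0 b1 b2) c \<le> dist (cpt z0 z1 z2 b0 b1 b2) z0 + dist z0 c" by (rule dist_triangle)
    also have "\<dots> \<le> r" using dist_corner[OF tri(2) a] e(3) by linarith
    finally show "\<Phi> (cpt z0 z1 z2 b0 b1 b2) = bpt v0 v1 v2 b0 b1 b2"
      by (intro known[OF a(1)]) (simp add: dist_commute)
  qed
qed

lemma edge_forced:
  fixes \<Phi> :: "complex \<Rightarrow> point"
  assumes X: "\<And>u. \<Phi> u \<in> Xpoints" and iso: "\<And>u v. Xdist (\<Phi> u) (\<Phi> v) = dist u v"
    and tri: "Xtri v0 v1 v2" "unit_tri z0 z1 z2" and z0: "dist z0 c < r"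
    and known: "\<And>b0 b1 b2. bary b0 b1 b2 \<Longrightarrow> cpt z0 z1 z2 b0 b1 b2 \<in> cball c r \<Longrightarrow>
       \<Phi> (cpt z0 z1 z2 b0 b1 b2) = bpt v0 v1 v2 b0 b1 b2"
    and z3: "unit_tri z1 z2 z3"
  shows "\<exists>v3. Xtri v1 v2 v3 \<and> \<Phi> z3 = vertex_point v3"
proof (rule cross_edge[OF X iso z3])
  note fill = fill_known[OF X iso tri z0 known]
  show "v1 \<noteq> v2" using tri(1) by (simp add: Xtri_def)
  show "\<Phi> z1 = vertex_point v1" using fill[of 0 1 0] by (simp add: bary_def cpt_vertex bpt_vertex)
  show "\<Phi> z2 = vertex_point v2" using fill[of 0 0 1] by (simp add: bary_def cpt_vertex bpt_vertex)
  have "(z1 + z2) / 2 = cpt z0 z1 z2 0 (1/2) (1/2)" by (simp add: cpt_def)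
  then have "\<Phi> ((z1 + z2) / 2) = bpt v0 v1 v2 0 (1/2) (1/2)" using fill[of 0 "1/2" "1/2"] by (simp add: bary_def)
  then show "\<Phi> ((z1 + z2) / 2) v1 = 1/2" "\<Phi> ((z1 + z2) / 2) v2 = 1/2" by (simp_all add: bpt_simps[OF tri(1)])
qed

lemma V_origin: "V h bs 0 0 = Xvertex h" "V h bs (- 1) 1 = Xvertex (h @ pos [Gb])"
  "bs 0 \<Longrightarrow> V h bs 0 (- 1) = Xvertex (h @ pos [Gd])"
proof -
  have "W bs 0 0 = []" by (simp add: W_a pos_def)
  then show "V h bs 0 0 = Xvertex h" by (simp add: V_def)
  have "W bs (- 1) 1 = pos [Gb]" by (simp add: W_b)
  then show "V h bs (- 1) 1 = Xvertex (h @ pos [Gb])" by (simp add: V_def)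
  assume "bs 0"
  then have "W bs 0 (- 1) = pos [Gd]" by (simp add: W_low low_def col_def pos_def hd_strip)
  then show "V h bs 0 (- 1) = Xvertex (h @ pos [Gd])" by (simp add: V_def)
qed

text \<open>The triangles (0,1), (0,0), (-1,1) and (1,-1), (0,0), (0,-1) have a corner inside the
  disc, so a flat contains them and continues across their edges labelled b and d. Both
  continuations have their third vertex at (-1,0), against
  \<open>no_common_triangle\<close>.\<close>

lemma disc_not_extendable:
  fixes \<Phi> :: "complex \<Rightarrow> point"
  assumes X: "\<And>u. \<Phi> u \<in> Xpoints" and iso: "\<And>u v. Xdist (\<Phi> u) (\<Phi> v) = dist u v"
    and agree: "\<And>u. u \<in> cball c r \<Longrightarrow> \<Phi> u = fm h bs u" and bs0: "bs 0"
    and near: "dist (lat 0 1) c < r" "dist (lat 1 (- 1)) c < r"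
  shows False
proof -
  have "\<exists>v3. Xtri (V h bs 0 0) (V h bs (- 1) 1) v3 \<and> \<Phi> (lat (- 1) 0) = vertex_point v3"
  proof (rule edge_forced[OF X iso _ _ near(1)])
    have "dnP (- 1) 0" by (simp add: dnP_def)
    from otri_Xtri[OF otri_dn[OF this]] show "Xtri (V h bs 0 1) (V h bs 0 0) (V h bs (- 1) 1)" by simp
    show "unit_tri (lat 0 1) (lat 0 0) (lat (- 1) 1)" by (rule unit_triI) (simp_all add: hexq_def)
    show "unit_tri (lat 0 0) (lat (- 1) 1) (lat (- 1) 0)" by (rule unit_triI) (simp_all add: hexq_def)
    fix b0 b1 b2 assume b: "bary b0 b1 b2" and in_ball: "cpt (lat 0 1) (lat 0 0) (lat (- 1) 1) b0 b1 b2 \<in> cball c r"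
    define u where "u = cpt (lat 0 1) (lat 0 0) (lat (- 1) 1) b0 b1 b2"
    have u: "cS u = - b2" "cT u = b0 + b2" by (simp_all add: u_def cST_cpt)
    have "in_dn (- 1) 0 u" using b by (simp add: in_dn_def u bary_def)
    from fm_dn[OF this, of h bs] have F: "fm h bs u = bpt (V h bs 0 1) (V h bs 0 0) (V h bs (- 1) 1) (cS u + 1 + cT u - 1) (1 - cT u) (1 - (cS u + 1))"
      by simp
    have e: "cS u + 1 + cT u - 1 = b0" "1 - cT u = b1" "1 - (cS u + 1) = b2" using b by (simp_all add: u bary_def)
    show "\<Phi> (cpt (lat 0 1) (lat 0 0) (lat (- 1) 1) b0 b1 b2) = bpt (V h bs 0 1) (V h bs 0 0) (V h bs (- 1) 1) b0 b1 b2"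
      using agree[OF in_ball] F unfolding e u_def[symmetric] by simp
  qed
  then obtain v3 where v3: "Xtri (V h bs 0 0) (V h bs (- 1) 1) v3" "\<Phi> (lat (- 1) 0) = vertex_point v3" by blast
  have "\<exists>v3. Xtri (V h bs 0 0) (V h bs 0 (- 1)) v3 \<and> \<Phi> (lat (- 1) 0) = vertex_point v3"
  proof (rule edge_forced[OF X iso _ _ near(2)])
    have "upP 0 (- 1)" by (simp add: upP_def)
    from otri_Xtri[OF otri_rotate[OF otri_up[OF this]]] show "Xtri (V h bs 1 (- 1)) (V h bs 0 0) (V h bs 0 (- 1))" by simp
    show "unit_tri (lat 1 (- 1)) (lat 0 0) (lat 0 (- 1))" by (rule unit_triI) (simp_all add: hexq_def)
    show "unit_tri (lat 0 0) (lat 0 (- 1)) (lat (- 1) 0)" by (rule unit_triI) (simp_all add: hexq_def)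
    fix b0 b1 b2 assume b: "bary b0 b1 b2" and in_ball: "cpt (lat 1 (- 1)) (lat 0 0) (lat 0 (- 1)) b0 b1 b2 \<in> cball c r"
    define u where "u = cpt (lat 1 (- 1)) (lat 0 0) (lat 0 (- 1)) b0 b1 b2"
    have u: "cS u = b0" "cT u = - b0 - b2" by (simp_all add: u_def cST_cpt)
    have "in_up 0 (- 1) u" using b by (simp add: in_up_def u bary_def)
    from fm_up[OF this, of h bs] have F: "fm h bs u = bpt (V h bs 0 (- 1)) (V h bs 1 (- 1)) (V h bs 0 0) (1 - cS u - (cT u + 1)) (cS u) (cT u + 1)"
      by simp
    have e: "1 - cS u - (cT u + 1) = b2" "cS u = b0" "cT u + 1 = b1" using b by (simp_all add: u bary_def)
    show "\<Phi> (cpt (lat 1 (- 1)) (lat 0 0) (lat 0 (- 1)) b0 b1 b2) = bpt (V h bs 1 (- 1)) (V h bs 0 0) (V h bs 0 (- 1)) b0 b1 b2"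
      using agree[OF in_ball] F bpt_rotate[of "V h bs 0 (- 1)"] unfolding e(1) unfolding e(2,3) u_def[symmetric] by simp
  qed
  then obtain v3' where v3': "Xtri (V h bs 0 0) (V h bs 0 (- 1)) v3'" "\<Phi> (lat (- 1) 0) = vertex_point v3'" by blast
  have "v3' = v3" using v3(2) v3'(2) vertex_point_inj by metis
  then have t: "Xtri (Xvertex h) (Xvertex (h @ pos [Gb])) v3" "Xtri (Xvertex h) (Xvertex (h @ pos [Gd])) v3"
    using v3(1) v3'(1) V_origin[where h = h and bs = bs] bs0 by simp_all
  have "v3 \<noteq> Xvertex h" using t(1) unfolding Xtri_def by (elim conjE) (rule not_sym)
  then show False
    by (intro no_common_triangle[of "{Xvertex h, Xvertex (h @ pos [Gb]), v3}" h v3 "{Xvertex h, Xvertex (h @ pos [Gd]), v3}"])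
       (use t in \<open>simp_all add: Xtri_def\<close>)
qed

section \<open>Counting\<close>

text \<open>The path from the corner to the centre. Placing the corner at \<open>u0\<close> times
  its inverse puts the centre at the given vertex.\<close>

definition cword :: "int \<Rightarrow> int \<Rightarrow> word" where
  "cword cs ct = pos (replicate (nat cs) Ga) @ npow D2 (nat ct)"

definition disc :: "word \<Rightarrow> (nat \<Rightarrow> bool) \<Rightarrow> int \<Rightarrow> int \<Rightarrow> real \<Rightarrow> point set" where
  "disc h bs cs ct r = (\<lambda>u. fm h bs (u + lat cs ct)) ` cball 0 r"

context
  fixes u0 h :: word and cs ct :: int and r :: real
  assumes h: "h = u0 @ winv (cword cs ct)"
    and c: "0 \<le> ct" "ct \<le> cs" and r: "1 \<le> r" "r\<^sup>2 \<le> hexq cs ct"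
begin

lemma shift_cball: "u \<in> cball 0 r \<Longrightarrow> u + z \<in> cball z r" for u z :: complex
  by (metis add_diff_cancel_right' dist_0_norm dist_commute dist_norm mem_cball)

lemma disc_iso:
  assumes "bs 0" "u \<in> cball 0 r" "v \<in> cball 0 r"
  shows "Xdist (fm h bs (u + lat cs ct)) (fm h bs (v + lat cs ct)) = dist u v"
proof -
  have "Xdist (fm h bs (u + lat cs ct)) (fm h bs (v + lat cs ct)) = dist (u + lat cs ct) (v + lat cs ct)"
    by (rule disc_isometry[of bs "real_of_int ct" "real_of_int cs" r]) (use assms c r shift_cball in auto)
  then show ?thesis by simp
qed

lemma disc_points:
  assumes "bs 0" "u \<in> cball 0 r"
  shows "fm h bs (u + lat cs ct) \<in> Xpoints"
proof -
  have "u + lat cs ct \<in> cball (lat cs ct) r" using assms(2) by (rule shift_cball)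
  then show ?thesis
    using c r assms by (intro Ptri_Xpoints disc_Ptri_self[of bs "real_of_int ct" "real_of_int cs" r]) auto
qed

lemma disc_center: "fm h bs (lat cs ct) = vertex_point (Xvertex u0)"
proof -
  have "W bs cs ct = cword cs ct" using c by (simp add: W_a cword_def)
  then have "V h bs cs ct = Xvertex (u0 @ winv (cword cs ct) @ cword cs ct)" by (simp add: V_def h)
  also have "\<dots> = Xvertex u0"
    using beq_Xvertex[OF beq_left[OF beq_winv', of u0 "cword cs ct"]] by simp
  finally show ?thesis by (simp add: fm_vertex)
qed

lemma disc_flat_ball:
  assumes "bs 0"
  shows "flat_ball (vertex_point (Xvertex u0)) r (disc h bs cs ct r)"
  unfolding flat_ball_def disc_def
  by (intro exI[of _ "\<lambda>u. fm h bs (u + lat cs ct)"] conjI ballI)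
     (simp_all add: disc_center disc_points disc_iso assms)

lemma disc_in_no_flat:
  assumes "bs 0" "hexq cs (ct - 1) < r\<^sup>2" "hexq (cs - 1) (ct + 1) < r\<^sup>2"
  shows "\<not> (\<exists>F. is_flat F \<and> disc h bs cs ct r \<subseteq> F)"
proof
  assume "\<exists>F. is_flat F \<and> disc h bs cs ct r \<subseteq> F"
  then obtain \<phi> :: "complex \<Rightarrow> point" where \<phi>: "\<And>u. \<phi> u \<in> Xpoints" "\<And>u v. Xdist (\<phi> u) (\<phi> v) = dist u v"
    and sub: "disc h bs cs ct r \<subseteq> range \<phi>" unfolding is_flat_def by blast
  \<comment> \<open>The disc pulled back to the parameter plane of the flat is an isometric copy of
    a ball. Its extension g reparametrizes the flat so that it agrees with \<open>fm\<close> on the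
    disc.\<close>
  define \<psi> where "\<psi> = (\<lambda>u. SOME y. \<phi> y = fm h bs (u + lat cs ct))"
  have \<psi>: "\<phi> (\<psi> u) = fm h bs (u + lat cs ct)" if "u \<in> cball 0 r" for u
  proof -
    have "fm h bs (u + lat cs ct) \<in> range \<phi>" using sub that by (auto simp: disc_def)
    then have "\<exists>y. \<phi> y = fm h bs (u + lat cs ct)" by (metis rangeE)
    then show ?thesis unfolding \<psi>_def by (rule someI_ex)
  qed
  have "dist (\<psi> u) (\<psi> v) = dist u v" if "u \<in> cball 0 r" "v \<in> cball 0 r" for u v
    using \<phi>(2)[of "\<psi> u" "\<psi> v"] \<psi>[OF that(1)] \<psi>[OF that(2)] disc_iso[of bs, OF assms(1) that] by simp
  from isometry_cball_extend[OF r(1) this] obtain g where g: "\<And>u v. dist (g u) (g v) = dist u v" "\<And>u. u \<in> cball 0 r \<Longrightarrow> g u = \<psi> u"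
    by blast
  have near: "dist z (lat cs ct) < r" if "hexq (cs - cS z) (ct - cT z) < r\<^sup>2" for z
  proof -
    have "(dist (lat cs ct) z)\<^sup>2 < r\<^sup>2" unfolding dist_hexq using that by simp
    then show ?thesis using r(1) by (metis dist_commute power2_less_imp_less order_trans zero_le_one)
  qed
  show False
  proof (rule disc_not_extendable[where \<Phi> = "\<lambda>u. \<phi> (g (u - lat cs ct))" and c = "lat cs ct" and r = r and h = h and bs = bs])
    fix u assume "u \<in> cball (lat cs ct) r"
    then have "u - lat cs ct \<in> cball 0 r" by (simp add: dist_norm norm_minus_commute)
    then show "\<phi> (g (u - lat cs ct)) = fm h bs u" using g(2) \<psi> by simp
  qed (use \<phi> g(1) assms near in \<open>simp_all add: dist_norm\<close>)
qed

text \<open>Discs are sets, so their parametrizations have to be compared. Seen from the centre, 0,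
  1 and exp(i pi / 3) lie in the sector where \<open>W\<close> is independent of the bits, and
  distances to these three anchors determine a point.\<close>

lemma disc_determines_map:
  assumes "bs 0" "bs' 0" "disc h bs cs ct r = disc h bs' cs ct r" "u \<in> cball 0 r"
  shows "fm h bs (u + lat cs ct) = fm h bs' (u + lat cs ct)"
proof -
  have "fm h bs (u + lat cs ct) \<in> disc h bs' cs ct r" using assms(3,4) by (auto simp: disc_def)
  then obtain v where v: "v \<in> cball 0 r" "fm h bs (u + lat cs ct) = fm h bs' (v + lat cs ct)" by (auto simp: disc_def)
  have D: "dist u a = dist v a" if a: "a \<in> cball 0 r" "fm h bs (a + lat cs ct) = fm h bs' (a + lat cs ct)" for a
    using disc_iso[of bs, OF assms(1,4) a(1)] disc_iso[of bs', OF assms(2) v(1) a(1)] v(2) a(2) by simp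
  have anchor: "fm h bs (lat (of_int i) (of_int j) + lat cs ct) = fm h bs' (lat (of_int i) (of_int j) + lat cs ct)"
    if "0 \<le> i" "0 \<le> j" for i j :: int
  proof -
    have e: "lat (of_int i) (of_int j) + lat cs ct = lat (of_int (i + cs)) (of_int (j + ct))"
      by (simp add: cST_eq_iff)
    have "W bs (i + cs) (j + ct) = W bs' (i + cs) (j + ct)" using that c by (simp add: W_a)
    then show ?thesis unfolding e fm_vertex V_def by simp
  qed
  have ball: "lat a b \<in> cball 0 r" if "hexq a b \<le> 1" for a b
  proof -
    have "(cmod (lat a b))\<^sup>2 \<le> 1\<^sup>2" using that by (simp add: cmod_hexq)
    then have "cmod (lat a b) \<le> 1" by (rule power2_le_imp_le) simp
    then show ?thesis using r(1) by simp
  qed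
  have H: "hexq (cS u - of_int i) (cT u - of_int j) = hexq (cS v - of_int i) (cT v - of_int j)"
    if "0 \<le> i" "0 \<le> j" "hexq (of_int i) (of_int j) \<le> 1" for i j :: int
  proof -
    have "dist u (lat (of_int i) (of_int j)) = dist v (lat (of_int i) (of_int j))"
      by (rule D[OF ball[OF that(3)] anchor[OF that(1,2)]])
    then have "(dist u (lat (of_int i) (of_int j)))\<^sup>2 = (dist v (lat (of_int i) (of_int j)))\<^sup>2" by simp
    then show ?thesis unfolding dist_hexq by simp
  qed
  have "2 * cS u + cT u = 2 * cS v + cT v" "cS u + 2 * cT u = cS v + 2 * cT v"
    using H[of 0 0] H[of 1 0] H[of 0 1] by (simp_all add: hexq_def power2_eq_square algebra_simps)
  then have "u = v" by (simp add: cST_eq_iff)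
  then show ?thesis using v by simp
qed

lemma disc_distinct:
  assumes bs: "bs 0" "bs' 0" and i: "\<And>j. j < i \<Longrightarrow> bs j = bs' j" "bs i" "\<not> bs' i"
    and room: "real_of_int ct + 3 * real i + 1 \<le> r"
  shows "disc h bs cs ct r \<noteq> disc h bs' cs ct r"
proof
  assume D: "disc h bs cs ct r = disc h bs' cs ct r"
  \<comment> \<open>About half the depth N = ct + 3 i + 1 of the target line below the centre, so
    that (x, -N) is nearly straight down; its squared norm N^2 + x (x - N) is at most N^2.\<close>
  define x where "x = (ct + 3 * int i + 1) div 2"
  define m where "m = nat (cs + x - 1)"
  have i0: "i > 0" using i bs by (cases i) auto
  have x: "2 * x \<le> ct + 3 * int i + 1" "ct + 3 * int i + 1 \<le> 2 * x + 1" "1 \<le> x" using c i0 by (auto simp: x_def)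
  have m: "int (Suc m) = cs + x" using x c by (simp add: m_def)
  define q where "q = lat (of_int x) (of_int (- (ct + 3 * int i + 1)))"
  have "hexq (of_int x) (of_int (- (ct + 3 * int i + 1))) \<le> (of_int (ct + 3 * int i + 1))\<^sup>2"
  proof -
    have "x\<^sup>2 + x * (- (ct + 3 * int i + 1)) \<le> 0"
    proof -
      have "x * (x - (ct + 3 * int i + 1)) \<le> 0" using x c by (intro mult_nonneg_nonpos) auto
      then show ?thesis by (simp add: power2_eq_square algebra_simps)
    qed
    then have "real_of_int (x\<^sup>2 + x * (- (ct + 3 * int i + 1))) \<le> 0" by linarith
    then show ?thesis by (simp add: hexq_def power2_eq_square algebra_simps)
  qed
  moreover have "(of_int (ct + 3 * int i + 1))\<^sup>2 \<le> r\<^sup>2" using room c by (intro power_mono) auto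
  ultimately have "(cmod q)\<^sup>2 \<le> r\<^sup>2" by (simp add: cmod_hexq q_def)
  then have "cmod q \<le> r" by (rule power2_le_imp_le) (use r(1) in linarith)
  then have qr: "q \<in> cball 0 r" by simp
  have q: "q + lat cs ct = lat (of_int (int (Suc m))) (of_int (- int (Suc (3 * i))))"
    unfolding m q_def by (simp add: cST_eq_iff)
  have VV: "V h bs (int (Suc m)) (- int (Suc (3 * i))) = V h bs' (int (Suc m)) (- int (Suc (3 * i)))"
    using disc_determines_map[of bs bs', OF bs D qr] unfolding q fm_vertex by (rule vertex_point_inj)
  have V: "Xvertex (h @ low bs (Suc m) (Suc (3 * i))) = Xvertex (h @ low bs' (Suc m) (Suc (3 * i)))"
  proof -
    have "W \<zeta> (int (Suc m)) (- int (Suc (3 * i))) = low \<zeta> (Suc m) (Suc (3 * i))" for \<zeta>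
      using W_low[of "- int (Suc (3 * i))" "int (Suc m)" \<zeta>] by (simp del: of_nat_Suc of_nat_mult)
    then show ?thesis using VV by (simp only: V_def)
  qed
  have g: "gauge bs j = gauge bs' j" if "j \<le> i" for j
    using that i(1) by (induction j) auto
  have s: "strip_lab bs j = strip_lab bs' j" if "j < 3 * i" for j
  proof -
    have "j div 3 < i" using that by auto
    then show ?thesis using g[of "j div 3"] i(1) by (simp add: strip_lab_def)
  qed
  have ro: "row_lab bs (3 * i) = row_lab bs' (3 * i)" using g[of i] by (simp add: row_lab_def row_tab_def)
  have ma: "map (strip_lab bs) [0..<3 * i] = map (strip_lab bs') [0..<3 * i]" using s by simp
  have lo: "low bs m (3 * i) = low bs' m (3 * i)" unfolding low_def col_def ro ma ..
  have e: "Xvertex (h @ low \<zeta> (Suc m) (Suc (3 * i))) = Xvertex ((h @ low \<zeta> m (3 * i)) @ pos [row_lab \<zeta> (3 * i), strip_lab \<zeta> (3 * i)])" for \<zeta>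
    using beq_Xvertex[OF beq_left[OF beq_low_Suc_Suc]] by simp
  have "wact (pos [row_lab bs (3 * i), strip_lab bs (3 * i)]) [] = wact (pos [row_lab bs' (3 * i), strip_lab bs' (3 * i)]) []"
    by (rule Xvertex_eq_nf[of "h @ low bs m (3 * i)"]) (use V lo in \<open>simp only: e\<close>)
  then have "diag_lab bs (3 * i) = diag_lab bs' (3 * i)" by (simp add: nf_Coatom[OF row_strip])
  then have "(phi ^^ gauge bs i) Gc = (phi ^^ gauge bs i) Gb" using g[of i] i(2,3) by (simp add: diag_lab_def diag_tab_def)
  moreover have "inj (phi ^^ gauge bs i)"
    by (rule inj_fn) (metis injI psi_phi)
  ultimately have "Gc = Gb" by (blast dest: injD)
  then show False by simp
qed

end

text \<open>\<open>(cs, ct)\<close> is the centre of the disc of radius \<open>r\<close> seen from the corner. The conditions put the corner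
  outside the open disc and two of its neighbours, \<open>(0, 1)\<close> and \<open>(1, -1)\<close>, inside.\<close>

lemma center_exists:
  assumes "7 \<le> r"
  obtains cs ct :: int where "0 \<le> ct" "ct \<le> 2" "ct \<le> cs" "r\<^sup>2 \<le> hexq cs ct"
    "hexq cs (ct - 1) < r\<^sup>2" "hexq (cs - 1) (ct + 1) < r\<^sup>2"
proof -
  have "\<exists>s::nat. r\<^sup>2 \<le> (real s)\<^sup>2 + real s + 1"
  proof -
    obtain s :: nat where s: "r \<le> real s" using real_arch_simple by blast
    have "r\<^sup>2 \<le> (real s)\<^sup>2" using s assms by (intro power_mono) auto
    then show ?thesis by (intro exI[of _ s]) simp
  qed
  \<comment> \<open>The centres (s,0), (s-1,2), (s,1) serve r^2 in the intervals (s^2-s+1, s^2],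
    (s^2-s+7, s^2+3] and (s^2+3, s^2+s+1]. For s >= 7 these cover (s^2-s+1, s^2+s+1], which contains
    r^2 by minimality of s.\<close>
  define s where "s = (LEAST s::nat. r\<^sup>2 \<le> (real s)\<^sup>2 + real s + 1)"
  have s1: "r\<^sup>2 \<le> (real s)\<^sup>2 + real s + 1" unfolding s_def by (rule LeastI_ex) fact
  have "7\<^sup>2 \<le> r\<^sup>2" using assms by (intro power_mono) auto
  then have r49: "49 \<le> r\<^sup>2" by simp
  have s7: "7 \<le> s"
  proof (rule ccontr)
    assume "\<not> 7 \<le> s"
    then have "real s \<le> 6" by simp
    moreover from this have "(real s)\<^sup>2 \<le> 6\<^sup>2" by (intro power_mono) auto
    ultimately show False using s1 r49 by simp
  qed
  have "\<not> r\<^sup>2 \<le> (real (s - 1))\<^sup>2 + real (s - 1) + 1"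
    using not_less_Least[of "s - 1" "\<lambda>s. r\<^sup>2 \<le> (real s)\<^sup>2 + real s + 1"] s7 by (simp add: s_def)
  moreover have "real (s - 1) = real s - 1" using s7 by simp
  ultimately have s2: "(real s)\<^sup>2 - real s + 1 < r\<^sup>2" by (simp add: power2_eq_square algebra_simps)
  have sr: "7 \<le> real s" using s7 by simp
  consider "r\<^sup>2 \<le> (real s)\<^sup>2" | "(real s)\<^sup>2 < r\<^sup>2" "r\<^sup>2 \<le> (real s)\<^sup>2 + 3" | "(real s)\<^sup>2 + 3 < r\<^sup>2" by linarith
  then show thesis
  proof cases
    case 1
    show thesis by (rule that[of 0 "int s"]) (use 1 s2 s7 in \<open>simp_all add: hexq_def power2_eq_square algebra_simps\<close>)
  next
    case 2
    show thesis by (rule that[of 2 "int s - 1"]) (use 2 s2 s7 sr in \<open>simp_all add: hexq_def power2_eq_square algebra_simps\<close>)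
  next
    case 3
    show thesis by (rule that[of 1 "int s"]) (use 3 s1 s7 sr in \<open>simp_all add: hexq_def power2_eq_square algebra_simps\<close>)
  qed
qed

text \<open>From 2 / sqrt 3 < 1.155 and a rounding error below 1: mu k < 0.155 k - 0.845.\<close>

lemma mu_bound:
  assumes "k \<ge> 0"
  shows "2 * real_of_int (mu k) - 4 < 31/100 * real_of_int k - 569/100"
proof -
  have "(2 / sqrt 3)\<^sup>2 < (231/200)\<^sup>2" by (simp add: power_divide)
  then have s: "2 / sqrt 3 < 231/200" by (rule power2_less_imp_less) simp
  have "real_of_int (mu k) < real_of_int k * (2 / sqrt 3 - 1) + (2 / sqrt 3 - 3) + 1"
    unfolding mu_def by linarith
  moreover have "real_of_int k * (2 / sqrt 3 - 1) \<le> real_of_int k * (31/200)"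
    using s assms by (intro mult_left_mono) auto
  ultimately show ?thesis using s by linarith
qed

theorem theorem16:
  fixes w0 :: "word set" and k :: int and r :: real
  assumes "w0 \<in> Xvertices" and "k \<ge> 32" and "real_of_int k - 1 \<le> r" and "r \<le> real_of_int k"
  shows "ereal ((3/2) powr real_of_int (2 * mu k - 4)) \<le> mrp (vertex_point w0) r"
proof -
  obtain u0 where u0: "w0 = Xvertex u0" using assms(1) by (auto simp: Xvertices_def)
  have kr: "real_of_int k \<ge> 32" "r \<ge> 31" using assms by linarith+
  have "7 \<le> r" using kr by simp
  then obtain cs ct :: int where c: "0 \<le> ct" "ct \<le> 2" "ct \<le> cs" "r\<^sup>2 \<le> hexq cs ct"
    "hexq cs (ct - 1) < r\<^sup>2" "hexq (cs - 1) (ct + 1) < r\<^sup>2"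
    by (rule center_exists)
  define h where "h = u0 @ winv (cword cs ct)"
  define B where "B = nat (2 * mu k - 4)"
  \<comment> \<open>Bit 0 is fixed so that the first label below the corner is d; the bits 1 to B
    remain free.\<close>
  define bs where "bs = (\<lambda>A i. i = 0 \<or> i \<in> (A :: nat set))"
  define S where "S = {D. flat_ball (vertex_point w0) r D \<and> \<not> (\<exists>F. is_flat F \<and> D \<subseteq> F)}"
  have r1: "1 \<le> r" using kr by simp
  \<comment> \<open>A block is three strips deep and 3 times 0.31 is less than 1: 2 + 3 B + 1 < 0.93
    k - 14.07 <= k - 1 <= r.\<close>
  have room: "real_of_int ct + 3 * real i + 1 \<le> r" if "i \<in> {1..B}" for i
  proof -
    have "real i \<le> real B" "B > 0" using that by auto
    moreover have "real B = 2 * real_of_int (mu k) - 4" using \<open>B > 0\<close> by (simp add: B_def)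
    then have "real B < 31/100 * real_of_int k - 569/100" using mu_bound[of k] assms(2) by simp
    moreover have "real_of_int ct \<le> 2" using c by simp
    ultimately show ?thesis using assms(3) kr by linarith
  qed
  have inS: "disc h (bs A) cs ct r \<in> S" for A
    unfolding S_def u0 mem_Collect_eq
    using disc_flat_ball[OF h_def c(1,3) r1 c(4), of "bs A"] disc_in_no_flat[OF h_def c(1,3) r1 c(4) _ c(5,6), of "bs A"]
    by (simp add: bs_def)
  have inj: "inj_on (\<lambda>A. disc h (bs A) cs ct r) (Pow {1..B})"
  proof (rule inj_onI, rule ccontr)
    fix A A' assume A: "A \<in> Pow {1..B}" "A' \<in> Pow {1..B}" "disc h (bs A) cs ct r = disc h (bs A') cs ct r" "A \<noteq> A'"
    define i where "i = (LEAST i. bs A i \<noteq> bs A' i)"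
    have "\<exists>i. bs A i \<noteq> bs A' i"
    proof -
      obtain i where "i \<in> A \<longleftrightarrow> i \<notin> A'" using A(4) by blast
      moreover from this have "i \<noteq> 0" using A(1,2) by auto
      ultimately show ?thesis by (auto simp: bs_def)
    qed
    then have i: "bs A i \<noteq> bs A' i" unfolding i_def by (rule LeastI_ex)
    have lt: "bs A j = bs A' j" if "j < i" for j using not_less_Least[of j] that unfolding i_def by blast
    have "i \<in> {1..B}" using i A(1,2) by (auto simp: bs_def)
    note room = room[OF this]
    have z: "bs A 0" "bs A' 0" by (simp_all add: bs_def)
    show False
    proof (cases "bs A i")
      case True
      then show False using disc_distinct[OF h_def c(1,3) r1 c(4) z lt True _ room] i A(3) by simp
    next
      case False
      then show False using disc_distinct[OF h_def c(1,3) r1 c(4) z(2,1) lt[symmetric] _ False room] i A(3) by simp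
    qed
  qed
  have "ereal ((3/2) powr real_of_int (2 * mu k - 4)) \<le> (if finite S then ereal (real (card S)) else \<infinity>)"
  proof (cases "finite S")
    case True
    have "card ((\<lambda>A. disc h (bs A) cs ct r) ` Pow {1..B}) \<le> card S"
      using inS by (intro card_mono[OF True]) auto
    then have "2 ^ B \<le> card S" using card_image[OF inj] by (simp add: card_Pow)
    then have cS: "(2::real) ^ B \<le> real (card S)" by (metis of_nat_le_iff of_nat_numeral of_nat_power)
    have "(3/2) powr real_of_int (2 * mu k - 4) \<le> (3/2::real) powr real B"
      by (intro powr_mono) (auto simp: B_def)
    also have "\<dots> = (3/2) ^ B" by (simp add: powr_realpow)
    also have "\<dots> \<le> 2 ^ B" by (intro power_mono) auto
    also note cS
    finally show ?thesis using True by simp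
  qed simp
  then show ?thesis by (simp only: mrp_def Let_def S_def)
qed

end
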